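(* Let $T\in(0,\infty)$, and let $\alpha\in(0,1)$ and $p,q\in(1,\infty)$ be such that $$\max\{1/\alpha,d\}<p\le d+1/\alpha,\qquad p<q\le2p.$$ Then, for $\psi\in\mathbb H_{p,0}^{\alpha,1}((0,T)\times B_1)$, $$\|\psi\|_{L_q((0,T)\times B_1)}\le N\,T^{\frac{\alpha p}q-\frac1p+\frac1q}\Big(\sum_{0\le|\beta|\le1}\|D_x^\beta\psi\|_{L_p((0,T)\times B_1)}\Big)^{1-\theta}\|\partial_t^\alpha\psi\|_{L_p((0,T)\times B_1)}^{\theta},$$ where $N=N(d,\alpha,p,q)$ and $\theta=p/q\in(0,1)$.
   Context: $B_1$ is the open unit ball of $\mathbb R^d$ centered at the origin; $\beta$ is a multi-index in the spatial variables. $N=N(\cdots)$ is a constant depending only on the listed quantities. For $\mathcal D\subset\mathbb R^k$, $C_0^\infty(\mathcal D)$ denotes infinitely differentiable functions on $\mathcal D$ with compact support contained in $\mathcal D$. $I_0^{1-\alpha}u(t,x)=\frac1{\Gamma(1-\alpha)}\int_0^t(t-s)^{-\alpha}u(s,x)\,ds$. For a domain $\Omega\subset\mathbb R^d$, $\mathbb H_p^{\alpha,1}((0,T)\times\Omega)$ is the set of $u\in L_p((0,T)\times\Omega)$ with $D_xu\in L_p$ and for which there is $g\in L_p((0,T)\times\Omega)$, denoted $\partial_tI_0^{1-\alpha}u$, such that $\int_0^T\!\int_\Omega g\varphi\,dx\,dt=-\int_0^T\!\int_\Omega I_0^{1-\alpha}u\,\partial_t\varphi\,dx\,dt$ for all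 $\varphi\in C_0^\infty([0,T)\times\Omega)$. Its norm is $\|\partial_tI_0^{1-\alpha}u\|_{L_p}+\|u\|_{L_p}+\|D_xu\|_{L_p}$. $\mathbb H_{p,0}^{\alpha,1}((0,T)\times\Omega)$ is the set of $u\in\mathbb H_p^{\alpha,1}((0,T)\times\Omega)$ that are limits in this norm of functions $u_n\in C^\infty([0,T]\times\Omega)$ which vanish for large $|x|$ and satisfy $u_n(0,x)=0$. For such $u$, $\partial_t^\alpha u=\partial_tI_0^{1-\alpha}u$. *)

theory Defs
  imports "HOL-Analysis.Analysis"
begin

text \<open>
  Points of space-time are pairs \<open>(t, x)\<close> of type \<open>real \<times> (real ^ 'd)\<close>, with
  \<open>d = CARD('d)\<close>. Elements of \<open>L\<^sub>p\<close> are represented by functions defined on the whole type, of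
  which only the values on the domain matter; Sobolev membership and the norms are
  insensitive to changes on null sets.
\<close>

definition Lp_space :: "real \<Rightarrow> 'a::euclidean_space set \<Rightarrow> ('a \<Rightarrow> 'b::euclidean_space) set" where
  "Lp_space p D = {f. f \<in> borel_measurable (lebesgue_on D) \<and>
                      integrable (lebesgue_on D) (\<lambda>z. norm (f z) powr p)}"

text \<open>
  Only meaningful for members of \<open>Lp_space p D\<close>: for other functions the Bochner integral
  takes the default value 0, not infinity.
\<close>

definition Lp_norm :: "real \<Rightarrow> 'a::euclidean_space set \<Rightarrow> ('a \<Rightarrow> 'b::euclidean_space) \<Rightarrow> real" where
  "Lp_norm p D f = (\<integral>z. norm (f z) powr p \<partial>lebesgue_on D) powr (1 / p)"

text \<open>
  Derivatives are taken within \<open>S\<close>, so at points of \<open>S\<close> on its boundary (such as \<open>t = 0\<close>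
  or \<open>t = T\<close>) they are one-sided, and all of them are continuous on \<open>S\<close>. Every set \<open>S\<close>
  occurring below is a product of a nondegenerate interval and an open set, hence
  the derivative within \<open>S\<close> is unique.
\<close>

primrec Ck_on :: "nat \<Rightarrow> 'a::euclidean_space set \<Rightarrow> ('a \<Rightarrow> real) \<Rightarrow> bool" where
  "Ck_on 0 S f \<longleftrightarrow> continuous_on S f"
| "Ck_on (Suc k) S f \<longleftrightarrow>
     (\<exists>f'. (\<forall>z\<in>S. (f has_derivative f' z) (at z within S)) \<and>
           (\<forall>b\<in>Basis. Ck_on k S (\<lambda>z. f' z b)))"

definition Cinf :: "'a::euclidean_space set \<Rightarrow> ('a \<Rightarrow> real) set" where
  "Cinf S = {f. \<forall>k. Ck_on k S f}"

text \<open>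
  For \<open>S = {0..<T} \<times> \<Omega>\<close> the functions below need not vanish at \<open>t = 0\<close>.
\<close>

definition Cinf_cpt :: "'a::euclidean_space set \<Rightarrow> ('a \<Rightarrow> real) set" where
  "Cinf_cpt S = {f \<in> Cinf S. compact (closure {z \<in> S. f z \<noteq> 0}) \<and>
                              closure {z \<in> S. f z \<noteq> 0} \<subseteq> S}"

definition partial_t :: "(real \<times> (real ^ 'd) \<Rightarrow> real) \<Rightarrow> real \<times> (real ^ 'd) \<Rightarrow> real" where
  "partial_t \<phi> z = deriv (\<lambda>s. \<phi> (s, snd z)) (fst z)"

definition partial_x :: "'d \<Rightarrow> (real \<times> (real ^ 'd) \<Rightarrow> real) \<Rightarrow> real \<times> (real ^ 'd) \<Rightarrow> real" where
  "partial_x i \<phi> z = deriv (\<lambda>h. \<phi> (fst z, snd z + h *\<^sub>R axis i 1)) 0"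

definition cylinder :: "real \<Rightarrow> (real ^ 'd) set \<Rightarrow> (real \<times> (real ^ 'd)) set" where
  "cylinder T \<Omega> = {0<..<T} \<times> \<Omega>"

definition weak_partial_x ::
  "real \<Rightarrow> (real ^ 'd) set \<Rightarrow> 'd \<Rightarrow> (real \<times> (real ^ 'd) \<Rightarrow> real) \<Rightarrow> (real \<times> (real ^ 'd) \<Rightarrow> real) \<Rightarrow> bool"
where
  "weak_partial_x T \<Omega> i u g \<longleftrightarrow>
     (\<forall>\<phi> \<in> Cinf_cpt (cylinder T \<Omega>).
        (\<integral>z. g z * \<phi> z \<partial>lebesgue_on (cylinder T \<Omega>)) =
        - (\<integral>z. u z * partial_x i \<phi> z \<partial>lebesgue_on (cylinder T \<Omega>)))"

text \<open>
  The Riemann-Liouville integral of order \<open>a\<close>; the order \<open>a = 1 - \<alpha>\<close> gives the kernel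
  \<open>(t - s) powr (- \<alpha>)\<close>.
\<close>

definition frac_int :: "real \<Rightarrow> (real \<times> (real ^ 'd) \<Rightarrow> real) \<Rightarrow> real \<times> (real ^ 'd) \<Rightarrow> real" where
  "frac_int a u z =
     1 / Gamma a * (\<integral>s. (fst z - s) powr (a - 1) * u (s, snd z) \<partial>lebesgue_on {0<..<fst z})"

definition weak_dt_frac ::
  "real \<Rightarrow> real \<Rightarrow> (real ^ 'd) set \<Rightarrow> (real \<times> (real ^ 'd) \<Rightarrow> real) \<Rightarrow> (real \<times> (real ^ 'd) \<Rightarrow> real) \<Rightarrow> bool"
where
  "weak_dt_frac \<alpha> T \<Omega> u g \<longleftrightarrow>
     (\<forall>\<phi> \<in> Cinf_cpt ({0..<T} \<times> \<Omega>).
        (\<integral>z. g z * \<phi> z \<partial>lebesgue_on (cylinder T \<Omega>)) =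
        - (\<integral>z. frac_int (1 - \<alpha>) u z * partial_t \<phi> z \<partial>lebesgue_on (cylinder T \<Omega>)))"

text \<open>
  The weak derivatives are unique up to null sets; the choice operator picks a
  representative. \<open>dt_frac\<close> is \<open>\<partial>\<^sub>t I\<^sub>0 u\<close> with the fractional integral of order \<open>1 - \<alpha>\<close>; on
  the space \<open>H_alpha_1_0\<close> it is the fractional time derivative of order \<open>\<alpha>\<close>.
\<close>

definition Dx ::
  "real \<Rightarrow> real \<Rightarrow> (real ^ 'd) set \<Rightarrow> 'd \<Rightarrow> (real \<times> (real ^ 'd) \<Rightarrow> real) \<Rightarrow> real \<times> (real ^ 'd) \<Rightarrow> real"
where
  "Dx p T \<Omega> i u = (SOME g. g \<in> Lp_space p (cylinder T \<Omega>) \<and> weak_partial_x T \<Omega> i u g)"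

definition grad_x ::
  "real \<Rightarrow> real \<Rightarrow> (real ^ 'd) set \<Rightarrow> (real \<times> (real ^ 'd) \<Rightarrow> real) \<Rightarrow> real \<times> (real ^ 'd) \<Rightarrow> real ^ 'd"
where
  "grad_x p T \<Omega> u z = (\<chi> i. Dx p T \<Omega> i u z)"

definition dt_frac ::
  "real \<Rightarrow> real \<Rightarrow> real \<Rightarrow> (real ^ 'd) set \<Rightarrow> (real \<times> (real ^ 'd) \<Rightarrow> real) \<Rightarrow> real \<times> (real ^ 'd) \<Rightarrow> real"
where
  "dt_frac \<alpha> p T \<Omega> u = (SOME g. g \<in> Lp_space p (cylinder T \<Omega>) \<and> weak_dt_frac \<alpha> T \<Omega> u g)"

definition H_alpha_1 ::
  "real \<Rightarrow> real \<Rightarrow> real \<Rightarrow> (real ^ 'd) set \<Rightarrow> (real \<times> (real ^ 'd) \<Rightarrow> real) set"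
where
  "H_alpha_1 \<alpha> p T \<Omega> =
     {u \<in> Lp_space p (cylinder T \<Omega>).
        (\<forall>i. \<exists>g \<in> Lp_space p (cylinder T \<Omega>). weak_partial_x T \<Omega> i u g) \<and>
        (\<exists>g \<in> Lp_space p (cylinder T \<Omega>). weak_dt_frac \<alpha> T \<Omega> u g)}"

definition H_alpha_1_norm ::
  "real \<Rightarrow> real \<Rightarrow> real \<Rightarrow> (real ^ 'd) set \<Rightarrow> (real \<times> (real ^ 'd) \<Rightarrow> real) \<Rightarrow> real"
where
  "H_alpha_1_norm \<alpha> p T \<Omega> u =
     Lp_norm p (cylinder T \<Omega>) (dt_frac \<alpha> p T \<Omega> u) +
     Lp_norm p (cylinder T \<Omega>) u +
     Lp_norm p (cylinder T \<Omega>) (grad_x p T \<Omega> u)"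

text \<open>
  A function smooth on \<open>{0..T} \<times> \<Omega>\<close> with \<open>\<Omega>\<close> open need not be \<open>p\<close>-integrable, so membership of
  the approximants in \<open>H_alpha_1\<close>, implicit in convergence in its norm, is explicit here.
\<close>

definition H_alpha_1_0 ::
  "real \<Rightarrow> real \<Rightarrow> real \<Rightarrow> (real ^ 'd) set \<Rightarrow> (real \<times> (real ^ 'd) \<Rightarrow> real) set"
where
  "H_alpha_1_0 \<alpha> p T \<Omega> =
     {u \<in> H_alpha_1 \<alpha> p T \<Omega>.
        \<exists>v :: nat \<Rightarrow> real \<times> (real ^ 'd) \<Rightarrow> real.
          (\<forall>n. v n \<in> H_alpha_1 \<alpha> p T \<Omega> \<and>
               v n \<in> Cinf ({0..T} \<times> \<Omega>) \<and>
               (\<exists>R. \<forall>t\<in>{0..T}. \<forall>x\<in>\<Omega>. norm x > R \<longrightarrow> v n (t, x) = 0) \<and>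
               (\<forall>x\<in>\<Omega>. v n (0, x) = 0)) \<and>
          (\<lambda>n. H_alpha_1_norm \<alpha> p T \<Omega> (\<lambda>z. v n z - u z)) \<longlonglongrightarrow> 0}"

text \<open>
  The sum over the spatial multi-indices \<open>\<beta>\<close> with \<open>\<bar>\<beta>\<bar> \<le> 1\<close>: these are \<open>0\<close> and the \<open>d\<close> unit
  multi-indices.
\<close>

definition sum_Dx_norms ::
  "real \<Rightarrow> real \<Rightarrow> (real ^ 'd) set \<Rightarrow> (real \<times> (real ^ 'd) \<Rightarrow> real) \<Rightarrow> real"
where
  "sum_Dx_norms p T \<Omega> u =
     Lp_norm p (cylinder T \<Omega>) u + (\<Sum>i\<in>UNIV. Lp_norm p (cylinder T \<Omega>) (Dx p T \<Omega> i u))"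

end

theory Submission
  imports Defs
begin

text \<open>
  Two embeddings into bounded functions, one in time and one in space, are multiplied together.
  Let \<open>g\<close> be the fractional derivative of \<open>\<psi>\<close> and \<open>\<sigma> = (q - p) / p\<close>, which lies in \<open>(0, 1]\<close>.

  In time, \<open>\<psi>\<close> is the Riemann-Liouville integral of order \<open>\<alpha>\<close> of \<open>g\<close>
  (\<open>weak_dt_frac_imp_representation\<close>). Since \<open>\<alpha> p > 1\<close>, the kernel belongs to the dual Lebesgue
  space, and Hoelder's inequality bounds \<open>\<bar>\<psi> (t, x)\<bar> powr p\<close>, uniformly in \<open>t\<close>, by a constant times
  \<open>T powr (\<alpha> p - 1)\<close> times \<open>A x\<close>, the integral of \<open>\<bar>g (s, x)\<bar> powr p\<close> over \<open>s\<close>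
  (\<open>fractional_sup_bound\<close>).

  In space, \<open>d < p\<close> and Morrey's inequality on the ball bound \<open>\<bar>\<psi> (t, x)\<bar> powr p\<close>, uniformly in \<open>x\<close>,
  by a constant times \<open>H t\<close>, the integral over the ball of \<open>\<bar>\<psi> (t, y)\<bar> powr p\<close> and of the \<open>p\<close>-th
  powers of the first spatial derivatives (\<open>Morrey_on_slices\<close>).

  The product of the first bound and the \<open>\<sigma>\<close>-th power of the second one bounds \<open>\<bar>\<psi>\<bar> powr q\<close> by a
  product of a function of \<open>x\<close> and a function of \<open>t\<close>, so the integral factors. The integral of \<open>A\<close>
  is the \<open>p\<close>-th power of the norm of \<open>g\<close>; the integral of \<open>H powr \<sigma>\<close> is at most
  \<open>T powr (1 - \<sigma>)\<close> times the \<open>\<sigma>\<close>-th power of the integral of \<open>H\<close>, by concavity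
  (\<open>mixed_norm_interpolation\<close>). Taking \<open>q\<close>-th roots gives the exponents of the theorem.

  Morrey's inequality is proved for differentiable functions and applied to the smooth
  approximations of \<open>\<psi>\<close>, whose classical derivatives agree with the weak ones
  (\<open>weak_partial_x_eq_classical\<close>); Fatou's lemma carries the estimate to \<open>\<psi>\<close> itself
  (\<open>mixed_norm_interpolation_limit\<close>). The representation in time holds for \<open>\<psi>\<close> directly.
\<close>

section \<open>Smooth bumps\<close>

lemma Ck_on_Suc_imp_Ck_on: "Ck_on (Suc k) S f \<Longrightarrow> Ck_on k S f"
proof (induction k arbitrary: f)
  case 0
  then show ?case
    by (auto intro: has_derivative_continuous_on)
next
  case (Suc k)
  from Suc.prems obtain f' where f': "\<forall>z\<in>S. (f has_derivative f' z) (at z within S)"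
    "\<forall>b\<in>Basis. Ck_on (Suc k) S (\<lambda>z. f' z b)" by auto
  then have "\<forall>b\<in>Basis. Ck_on k S (\<lambda>z. f' z b)" using Suc.IH by blast
  then show ?case using f'(1) by auto
qed

lemma Ck_on_const: "Ck_on k S (\<lambda>_. c)"
proof (induction k arbitrary: c)
  case (Suc k)
  have "\<forall>z\<in>S. ((\<lambda>_. c) has_derivative (\<lambda>_. 0)) (at z within S)" by simp
  then show ?case using Suc[of 0] unfolding Ck_on.simps
    by (intro exI[of _ "\<lambda>_ _. 0"]) simp
qed simp

lemma Ck_on_add: "Ck_on k S f \<Longrightarrow> Ck_on k S g \<Longrightarrow> Ck_on k S (\<lambda>z. f z + g z)"
proof (induction k arbitrary: f g)
  case 0 then show ?case by (simp add: continuous_on_add)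
next
  case (Suc k)
  obtain f' where f': "\<forall>z\<in>S. (f has_derivative f' z) (at z within S)"
    "\<forall>b\<in>Basis. Ck_on k S (\<lambda>z. f' z b)" using Suc.prems by auto
  obtain g' where g': "\<forall>z\<in>S. (g has_derivative g' z) (at z within S)"
    "\<forall>b\<in>Basis. Ck_on k S (\<lambda>z. g' z b)" using Suc.prems by auto
  show ?case unfolding Ck_on.simps
    by (intro exI[of _ "\<lambda>z h. f' z h + g' z h"])
       (use f' g' in \<open>auto intro!: has_derivative_add Suc.IH\<close>)
qed

lemma Ck_on_mult: "Ck_on k S f \<Longrightarrow> Ck_on k S g \<Longrightarrow> Ck_on k S (\<lambda>z. f z * g z)"
proof (induction k arbitrary: f g)
  case 0 then show ?case by (simp add: continuous_on_mult)
next
  case (Suc k)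
  obtain f' where f': "\<forall>z\<in>S. (f has_derivative f' z) (at z within S)"
    "\<forall>b\<in>Basis. Ck_on k S (\<lambda>z. f' z b)" using Suc.prems by auto
  obtain g' where g': "\<forall>z\<in>S. (g has_derivative g' z) (at z within S)"
    "\<forall>b\<in>Basis. Ck_on k S (\<lambda>z. g' z b)" using Suc.prems by auto
  have fg: "Ck_on k S f" "Ck_on k S g" using Suc.prems Ck_on_Suc_imp_Ck_on by blast+
  show ?case unfolding Ck_on.simps
    by (intro exI[of _ "\<lambda>z h. f z * g' z h + f' z h * g z"])
       (use f' g' fg in \<open>auto intro!: has_derivative_mult Ck_on_add Suc.IH\<close>)
qed

lemma Ck_on_prod:
  assumes "finite I" "\<And>i. i \<in> I \<Longrightarrow> Ck_on k S (f i)"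
  shows "Ck_on k S (\<lambda>z. \<Prod>i\<in>I. f i z)"
  using assms by (induction I rule: finite_induct) (auto intro: Ck_on_const Ck_on_mult)

text \<open>
  A whole sequence of successive derivatives is carried along because differentiating \<open>F n\<close>
  composed with \<open>L\<close> produces a constant multiple of \<open>F (Suc n)\<close> composed with \<open>L\<close>, so that the induction
  on the order closes.
\<close>

lemma Ck_on_compose_affine:
  fixes F :: "nat \<Rightarrow> real \<Rightarrow> real" and S :: "'a::euclidean_space set"
  assumes F: "\<And>n x. (F n has_real_derivative F (Suc n) x) (at x)"
    and L: "\<And>z. (L has_derivative M) (at z)"
  shows "Ck_on k S (\<lambda>z. F n (L z))"
proof (induction k arbitrary: n)
  case 0
  have "continuous_on UNIV (F n)" using F DERIV_continuous_on by blast
  moreover have "continuous_on S L"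
    by (rule has_derivative_continuous_on[OF has_derivative_at_withinI[OF L]])
  ultimately show ?case
    by (auto intro: continuous_on_compose2)
next
  case (Suc k)
  have "((\<lambda>z. F n (L z)) has_derivative (\<lambda>h. F (Suc n) (L z) * M h)) (at z within S)" for z
    using has_derivative_compose[OF has_derivative_at_withinI[OF L[of z]] F[of n "L z", unfolded has_field_derivative_def]]
    by (simp add: mult.commute)
  then show ?case unfolding Ck_on.simps
    by (intro exI[of _ "\<lambda>z h. F (Suc n) (L z) * M h"])
       (auto intro!: Ck_on_mult Suc.IH Ck_on_const)
qed

text \<open>
  On the whole line the derivative existentially bound in \<open>Ck_on\<close> is unique, so it is \<open>deriv f\<close>
  for every order \<open>k\<close> simultaneously.
\<close>

lemma Cinf_real_deriv:
  fixes f :: "real \<Rightarrow> real"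
  assumes "f \<in> Cinf UNIV"
  shows "(f has_real_derivative deriv f x) (at x)" "deriv f \<in> Cinf UNIV"
proof -
  have *: "\<And>x. (f has_real_derivative deriv f x) (at x) \<and> Ck_on k UNIV (deriv f)" for k
  proof -
    have "Ck_on (Suc k) UNIV f" using assms by (auto simp: Cinf_def simp del: Ck_on.simps)
    then obtain f' where f': "\<And>z. (f has_derivative f' z) (at z)" "Ck_on k UNIV (\<lambda>z. f' z 1)"
      by auto
    have "f' z = (*) (f' z 1)" for z
      using has_derivative_bounded_linear[OF f'(1)[of z]]
      by (metis (no_types, lifting) bounded_linear.linear ext linear_scale mult.commute
          mult.right_neutral real_scaleR_def)
    then have d: "(f has_real_derivative f' z 1) (at z)" for z
      using f'(1)[of z] by (simp add: has_field_derivative_def)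
    then have "deriv f = (\<lambda>z. f' z 1)" by (auto intro: DERIV_imp_deriv)
    with d f'(2) show "\<And>x. (f has_real_derivative deriv f x) (at x) \<and> Ck_on k UNIV (deriv f)"
      by simp
  qed
  show "(f has_real_derivative deriv f x) (at x)" "deriv f \<in> Cinf UNIV"
    using * by (auto simp: Cinf_def)
qed

text \<open>
  The family of all \<open>P (1 / x) exp (- 1 / x)\<close>, indexed by polynomials \<open>P\<close>, is closed under
  differentiation. Smoothness at \<open>0\<close> of its member with \<open>P = 1\<close> therefore needs only first derivatives.
\<close>

definition flat :: "real poly \<Rightarrow> real \<Rightarrow> real" where
  "flat P x = (if x > 0 then poly P (1 / x) * exp (- (1 / x)) else 0)"

lemma poly_exp_tendsto_0: "((\<lambda>y::real. poly P y * exp (- y)) \<longlongrightarrow> 0) at_top"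
proof -
  have "((\<lambda>y. \<Sum>i\<le>degree P. coeff P i * (y ^ i / exp y)) \<longlongrightarrow> (\<Sum>i\<le>degree P. coeff P i * 0)) at_top"
    by (intro tendsto_intros tendsto_power_div_exp_0)
  then show ?thesis
    by (simp add: poly_altdef exp_minus sum_distrib_right divide_inverse mult.assoc)
qed

text \<open>
  Away from \<open>0\<close> this is the product rule; at \<open>0\<close> the exponential beats every polynomial in \<open>1 / x\<close>.
\<close>

lemma flat_has_derivative:
  "(flat P has_real_derivative flat (monom 1 2 * (P - pderiv P)) x) (at x)"
proof -
  let ?Q = "monom 1 2 * (P - pderiv P)"
  consider "x > 0" | "x < 0" | "x = 0" by linarith
  then show ?thesis
  proof cases
    case 1
    have "((\<lambda>x. poly P (1 / x) * exp (- (1 / x))) has_real_derivative flat ?Q x) (at x)"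
      using 1 by (auto intro!: derivative_eq_intros poly_DERIV[THEN DERIV_chain2]
          simp: flat_def poly_monom field_simps power2_eq_square)
    moreover have "eventually (\<lambda>x. x \<in> {0<..}) (nhds x)"
      using 1 by (intro eventually_nhds_in_open) auto
    then have "\<forall>\<^sub>F x in nhds x. flat P x = poly P (1 / x) * exp (- (1 / x))"
      by eventually_elim (auto simp: flat_def)
    ultimately show ?thesis using DERIV_cong_ev[OF refl _ refl, of "flat P"] by simp
  next
    case 2
    have "((\<lambda>x. 0) has_real_derivative flat ?Q x) (at x)" using 2 by (simp add: flat_def)
    moreover have "eventually (\<lambda>x. x \<in> {..<0}) (nhds x)"
      using 2 by (intro eventually_nhds_in_open) auto
    then have "\<forall>\<^sub>F x in nhds x. flat P x = 0"
      by eventually_elim (auto simp: flat_def)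
    ultimately show ?thesis using DERIV_cong_ev[OF refl _ refl, of "flat P"] by simp
  next
    case 3
    have R: "((\<lambda>h. flat P h / h) \<longlongrightarrow> 0) (at_right 0)"
    proof -
      have "((\<lambda>h::real. poly (P * monom 1 1) (inverse h) * exp (- inverse h)) \<longlongrightarrow> 0) (at_right 0)"
        using poly_exp_tendsto_0 filterlim_inverse_at_top_right by (rule filterlim_compose)
      then show ?thesis
      proof (rule Lim_transform_eventually)
        show "\<forall>\<^sub>F h in at_right 0. poly (P * monom 1 1) (inverse h) * exp (- inverse h) = flat P h / h"
          by (auto simp: eventually_at_filter flat_def poly_monom inverse_eq_divide)
      qed
    qed
    have L: "((\<lambda>h. flat P h / h) \<longlongrightarrow> 0) (at_left 0)"
      by (rule tendsto_eventually) (auto simp: eventually_at_filter flat_def)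
    have "((\<lambda>h. (flat P (0 + h) - flat P 0) / h) \<longlongrightarrow> 0) (at 0)"
      using filterlim_split_at[OF L R] by (simp add: flat_def)
    then show ?thesis using 3 by (simp add: DERIV_def flat_def)
  qed
qed

primrec flat_poly :: "nat \<Rightarrow> real poly" where
  "flat_poly 0 = 1"
| "flat_poly (Suc n) = monom 1 2 * (flat_poly n - pderiv (flat_poly n))"

lemma Ck_on_flat:
  assumes "\<And>z. (L has_derivative M) (at z)"
  shows "Ck_on k S (\<lambda>z. flat 1 (L z))"
proof -
  have "(flat (flat_poly n) has_real_derivative flat (flat_poly (Suc n)) x) (at x)" for n x
    unfolding flat_poly.simps by (rule flat_has_derivative)
  from Ck_on_compose_affine[of "\<lambda>n. flat (flat_poly n)" L M k S 0, OF this assms]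
  show ?thesis by simp
qed

text \<open>
  The parameter \<open>k\<close> sharpens the bump: \<open>flat 1 (k * y)\<close> is the \<open>k\<close>-th root of \<open>flat 1 y\<close>, so for
  \<open>k\<close> tending to infinity the bumps stay between \<open>0\<close> and \<open>1\<close> and converge to the indicator of the
  open box. The product form makes bumps on a product space products of bumps.
\<close>

definition bump :: "real \<Rightarrow> 'a::euclidean_space \<Rightarrow> 'a \<Rightarrow> 'a \<Rightarrow> real" where
  "bump k c d z = (\<Prod>b\<in>Basis. flat 1 (k * (z \<bullet> b - c \<bullet> b)) * flat 1 (k * (d \<bullet> b - z \<bullet> b)))"

lemma Ck_on_bump_linear:
  assumes L: "bounded_linear L"
  shows "Ck_on n S (\<lambda>z. bump k c d (L z))"
  unfolding bump_def
proof (intro Ck_on_prod Ck_on_mult)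
  note L' = bounded_linear.has_derivative[OF L]
  fix b
  show "Ck_on n S (\<lambda>z. flat 1 (k * (L z \<bullet> b - c \<bullet> b)))"
    by (rule Ck_on_flat[where M="\<lambda>h. k * (L h \<bullet> b)"]) (auto intro!: derivative_eq_intros L')
  show "Ck_on n S (\<lambda>z. flat 1 (k * (d \<bullet> b - L z \<bullet> b)))"
    by (rule Ck_on_flat[where M="\<lambda>h. k * - (L h \<bullet> b)"]) (auto intro!: derivative_eq_intros L')
qed auto

lemma bump_Cinf: "bump k c d \<in> Cinf S"
  by (simp add: Cinf_def Ck_on_bump_linear[OF bounded_linear_ident])

lemma continuous_on_bump: "continuous_on S (bump k c d)"
  using bump_Cinf[of k c d S] unfolding Cinf_def by (auto dest: spec[of _ 0])

lemma bump_measurable [measurable]: "bump k c d \<in> borel_measurable borel"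
  by (intro borel_measurable_continuous_onI continuous_on_bump)

lemma flat_1_bounds: "0 \<le> flat 1 x" "flat 1 x \<le> 1"
  by (auto simp: flat_def)

lemma bump_bounds: "0 \<le> bump k c d z" "bump k c d z \<le> 1"
  unfolding bump_def by (auto intro!: prod_nonneg prod_le_1 mult_le_one simp: flat_1_bounds)

lemma bump_eq_0: "k > 0 \<Longrightarrow> z \<notin> box c d \<Longrightarrow> bump k c d z = 0"
  unfolding bump_def mem_box
  by (auto simp: flat_def zero_less_mult_iff)

lemma bump_tendsto_indicator:
  "(\<lambda>n. bump (real (Suc n)) c d z) \<longlonglongrightarrow> indicator (box c d) z"
proof (cases "z \<in> box c d")
  case True
  have pos: "(\<lambda>n. flat 1 (real (Suc n) * y)) \<longlonglongrightarrow> 1" if "y > 0" for y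
  proof -
    have "(\<lambda>n. exp (- (1 / (real (Suc n)) * (1/y)))) \<longlonglongrightarrow> exp (- (0 * (1/y)))"
      by (intro tendsto_intros LIMSEQ_Suc[OF lim_1_over_n])
    moreover have "flat 1 (real (Suc n) * y) = exp (- (1 / (real (Suc n)) * (1/y)))" for n
      using that by (simp add: flat_def del: of_nat_Suc)
    ultimately show ?thesis by (simp del: of_nat_Suc)
  qed
  have "(\<lambda>n. bump (real (Suc n)) c d z) \<longlonglongrightarrow> (\<Prod>b\<in>(Basis::'a set). 1 * 1)"
    unfolding bump_def using True
    by (intro tendsto_intros pos) (auto simp: mem_box)
  then show ?thesis using True by simp
next
  case False
  then show ?thesis using bump_eq_0[OF _ False] by simp
qed

lemma Cinf_cptI:
  assumes "f \<in> Cinf S" "compact K" "K \<subseteq> S" "\<And>z. z \<in> S \<Longrightarrow> z \<notin> K \<Longrightarrow> f z = 0"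
  shows "f \<in> Cinf_cpt S"
proof -
  have sub: "{z \<in> S. f z \<noteq> 0} \<subseteq> K" using assms(4) by auto
  have "closure {z \<in> S. f z \<noteq> 0} \<subseteq> K"
    using sub compact_imp_closed[OF assms(2)] by (simp add: closure_minimal)
  moreover have "compact (closure {z \<in> S. f z \<noteq> 0})"
    using sub assms(2) by (meson bounded_subset compact_closure compact_imp_bounded)
  ultimately show ?thesis using assms unfolding Cinf_cpt_def by auto
qed

section \<open>The fundamental lemma of the calculus of variations\<close>

text \<open>
  The measures with densities \<open>max 0 g\<close> and \<open>max 0 (- g)\<close> agree on boxes, which generate the Borel
  sets and are closed under intersection; hence they are equal, and so are the densities.
\<close>

lemma AE_zero_if_box_integrals_zero:
  fixes g :: "'a::euclidean_space \<Rightarrow> real"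
  assumes g: "integrable lborel g"
    and zero: "\<And>c d. (\<integral>z. indicator (box c d) z * g z \<partial>lborel) = 0"
  shows "AE z in lborel. g z = 0"
proof -
  have [measurable]: "g \<in> borel_measurable borel" using g by auto
  let ?P = "\<lambda>z. ennreal (max 0 (g z))" and ?N = "\<lambda>z. ennreal (max 0 (- g z))"
  have fin: "(\<integral>\<^sup>+z. ennreal (max 0 (s * g z)) * indicator A z \<partial>lborel) < \<infinity>"
    if "A \<in> sets borel" "\<bar>s\<bar> = 1" for A s
  proof -
    have "(\<integral>\<^sup>+z. ennreal (max 0 (s * g z)) * indicator A z \<partial>lborel) \<le> (\<integral>\<^sup>+z. ennreal (norm (g z)) \<partial>lborel)"
      using that(2) by (intro nn_integral_mono) (auto simp: indicator_def abs_if split: if_splits)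
    also have "\<dots> < \<infinity>" using g by (simp add: integrable_iff_bounded)
    finally show ?thesis .
  qed
  have "density lborel ?P = density lborel ?N"
  proof (rule measure_eqI_generator_eq)
    let ?E = "range (\<lambda>(a, b). box a b::'a set)"
    show "Int_stable ?E" by (auto simp: Int_stable_def box_Int_box)
    show "?E \<subseteq> Pow UNIV" "sets (density lborel ?P) = sigma_sets UNIV ?E"
      "sets (density lborel ?N) = sigma_sets UNIV ?E"
      by (simp_all add: borel_eq_box)
    let ?A = "\<lambda>n::nat. box (- (real n *\<^sub>R One)) (real n *\<^sub>R One) :: 'a set"
    show "range ?A \<subseteq> ?E" "(\<Union>i. ?A i) = UNIV"
      unfolding UN_box_eq_UNIV by auto
    show "emeasure (density lborel ?P) (?A i) \<noteq> \<infinity>" for i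
      using fin[of "?A i" 1] by (simp add: emeasure_density)
    fix X assume "X \<in> ?E"
    then obtain c d where X: "X = box c d" by auto
    have i: "integrable lborel (\<lambda>z. indicator X z * max 0 (s * g z))" if "\<bar>s\<bar> = 1" for s
      using integrable_mult_indicator[of X lborel "\<lambda>z. max 0 (s * g z)"] g X by simp
    have *: "emeasure (density lborel (\<lambda>z. ennreal (max 0 (s * g z)))) X
        = ennreal (\<integral>z. indicator X z * max 0 (s * g z) \<partial>lborel)" if "\<bar>s\<bar> = 1" for s
      using i[OF that] X
      by (subst nn_integral_eq_integral[symmetric])
         (auto simp: emeasure_density intro!: nn_integral_cong split: split_indicator)
    have "(\<integral>z. indicator X z * max 0 (1 * g z) \<partial>lborel) - (\<integral>z. indicator X z * max 0 (- 1 * g z) \<partial>lborel)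
       = (\<integral>z. indicator X z * max 0 (1 * g z) - indicator X z * max 0 (- 1 * g z) \<partial>lborel)"
      using i[of 1] i[of "-1"] by (intro Bochner_Integration.integral_diff[symmetric]) auto
    also have "\<dots> = (\<integral>z. indicator (box c d) z * g z \<partial>lborel)"
      using X by (intro Bochner_Integration.integral_cong) (auto simp: max_def)
    finally show "emeasure (density lborel ?P) X = emeasure (density lborel ?N) X"
      using *[of 1] *[of "-1"] zero[of c d] by simp
  qed
  then have "AE z in lborel. ?P z = ?N z"
    using fin[of UNIV 1] by (subst (asm) finite_density_unique) auto
  then show ?thesis
    by eventually_elim (auto simp: max_def split: if_splits)
qed

text \<open>
  The fundamental lemma of the calculus of variations. By dominated convergence the bump integrals
  tend to box integrals, and countably many closed boxes cover \<open>U\<close>. Integrability is asked on boxes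
  only, since a derivative that is continuous on \<open>U\<close> may be unbounded near the boundary.
\<close>

lemma AE_zero_if_bump_integrals_zero:
  fixes g :: "'a::euclidean_space \<Rightarrow> real"
  assumes U: "open U"
    and g: "\<And>a b. cbox a b \<subseteq> U \<Longrightarrow> integrable lborel (\<lambda>z. indicator (cbox a b) z * g z)"
    and zero: "\<And>k c d. k > 0 \<Longrightarrow> cbox c d \<subseteq> U \<Longrightarrow> (\<integral>z. bump k c d z * g z \<partial>lborel) = 0"
  shows "AE z in lborel. z \<in> U \<longrightarrow> g z = 0"
proof -
  have box0: "(\<integral>z. indicator (box c d) z * g z \<partial>lborel) = 0" if K: "cbox c d \<subseteq> U" for c d
  proof -
    have eq: "bump k c d z * g z = bump k c d z * (indicator (cbox c d) z * g z)"
      if "k > 0" for k z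
      using bump_eq_0[OF that, of z c d] box_subset_cbox[of c d] by (auto simp: indicator_def)
    note gK = g[OF K]
    have "(\<lambda>n. \<integral>z. bump (real (Suc n)) c d z * (indicator (cbox c d) z * g z) \<partial>lborel)
       \<longlonglongrightarrow> (\<integral>z. indicator (box c d) z * (indicator (cbox c d) z * g z) \<partial>lborel)"
    proof (rule integral_dominated_convergence[where w="\<lambda>z. norm (indicator (cbox c d) z * g z)"])
      show "integrable lborel (\<lambda>z. norm (indicator (cbox c d) z * g z))"
        using gK by (rule integrable_norm)
      show "AE z in lborel. (\<lambda>n. bump (real (Suc n)) c d z * (indicator (cbox c d) z * g z))
        \<longlonglongrightarrow> indicator (box c d) z * (indicator (cbox c d) z * g z)"
        by (intro AE_I2 tendsto_intros bump_tendsto_indicator)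
      show "AE z in lborel. norm (bump (real (Suc n)) c d z * (indicator (cbox c d) z * g z))
         \<le> norm (indicator (cbox c d) z * g z)" for n
        using bump_bounds[of "real (Suc n)" c d]
        by (intro AE_I2) (simp add: abs_mult mult_left_le_one_le del: of_nat_Suc)
    qed (use gK in measurable)
    moreover have "(\<integral>z. bump (real (Suc n)) c d z * (indicator (cbox c d) z * g z) \<partial>lborel) = 0" for n
      using zero[OF _ K, of "real (Suc n)"] eq[of "real (Suc n)"] by (simp del: of_nat_Suc)
    moreover have "indicator (box c d) z * (indicator (cbox c d) z * g z) = indicator (box c d) z * g z" for z
      using box_subset_cbox[of c d] by (auto simp: indicator_def)
    ultimately show ?thesis by (simp add: LIMSEQ_const_iff)
  qed
  have AE_cbox: "AE z in lborel. z \<in> cbox a b \<longrightarrow> g z = 0" if K: "cbox a b \<subseteq> U" for a b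
  proof -
    have "AE z in lborel. indicator (cbox a b) z * g z = 0"
    proof (rule AE_zero_if_box_integrals_zero[OF g[OF K]])
      fix c d :: 'a
      let ?c = "\<Sum>i\<in>Basis. max (a \<bullet> i) (c \<bullet> i) *\<^sub>R i" and ?d = "\<Sum>i\<in>Basis. min (b \<bullet> i) (d \<bullet> i) *\<^sub>R i"
      have "AE z in lborel. z \<notin> cbox a b - box a b"
        by (rule AE_not_in) (rule null_sets_cbox_Diff_box)
      then have "(\<integral>z. indicator (box c d) z * (indicator (cbox a b) z * g z) \<partial>lborel)
        = (\<integral>z. indicator (box ?c ?d) z * g z \<partial>lborel)"
      proof (intro integral_cong_AE)
        have m: "(\<lambda>z. indicator (cbox a b) z * g z) \<in> borel_measurable lborel" using g[OF K] by auto
        then show "(\<lambda>z. indicator (box c d) z * (indicator (cbox a b) z * g z)) \<in> borel_measurable lborel"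
          by measurable
        have "(\<lambda>z. indicator (box ?c ?d) z * (indicator (cbox a b) z * g z)) \<in> borel_measurable lborel"
          using m by measurable
        moreover have "indicator (box ?c ?d) z * (indicator (cbox a b) z * g z) = indicator (box ?c ?d) z * g z" for z
          unfolding box_Int_box[symmetric] using box_subset_cbox[of a b] by (auto simp: indicator_def)
        ultimately show "(\<lambda>z. indicator (box ?c ?d) z * g z) \<in> borel_measurable lborel" by simp
      qed (auto elim!: eventually_mono simp: box_Int_box[symmetric] indicator_def
            dest: subsetD[OF box_subset_cbox])
      also have "\<dots> = 0"
        using K by (intro box0) (auto simp: Int_interval[symmetric])
      finally show "(\<integral>z. indicator (box c d) z * (indicator (cbox a b) z * g z) \<partial>lborel) = 0" .
    qed
    then show ?thesis by eventually_elim (auto simp: indicator_def)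
  qed
  let ?a = "\<lambda>f. (\<Sum>(i::'a)\<in>Basis. fst (f i) *\<^sub>R i)" and ?b = "\<lambda>f. (\<Sum>(i::'a)\<in>Basis. snd (f i) *\<^sub>R i)"
  let ?I = "{f\<in>Basis \<rightarrow>\<^sub>E \<rat> \<times> \<rat>. cbox (?a f) (?b f) \<subseteq> U}"
  have "countable (Basis \<rightarrow>\<^sub>E (\<rat> \<times> \<rat>) :: ('a \<Rightarrow> real \<times> real) set)"
    by (rule countable_PiE) (auto simp: countable_rat)
  then have "countable ?I" by (rule countable_subset[rotated]) auto
  then have "AE z in lborel. \<forall>f\<in>?I. z \<in> cbox (?a f) (?b f) \<longrightarrow> g z = 0"
    using AE_cbox by (subst AE_ball_countable) auto
  then show ?thesis
  proof eventually_elim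
    case (elim z)
    show ?case using elim open_UNION_cbox[OF U] by blast
  qed
qed

section \<open>Borel representatives, weak and classical derivatives\<close>

text \<open>
  Fubini's theorem and translation invariance are at hand for \<open>lborel\<close>, but members of \<open>L\<^sub>p\<close> are only
  Lebesgue measurable, so that a single section may fail to be measurable. A Borel representative that
  vanishes off the domain turns integrals over the domain into integrals over the whole space.
\<close>

definition borel_rep :: "'a::euclidean_space set \<Rightarrow> ('a \<Rightarrow> real) \<Rightarrow> ('a \<Rightarrow> real) \<Rightarrow> bool" where
  "borel_rep S f f' \<longleftrightarrow> f' \<in> borel_measurable borel \<and> (\<forall>z. z \<notin> S \<longrightarrow> f' z = 0) \<and>
     (AE z in lborel. z \<in> S \<longrightarrow> f z = f' z)"

lemma borel_repD:
  assumes "borel_rep S f f'"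
  shows "f' \<in> borel_measurable borel" "z \<notin> S \<Longrightarrow> f' z = 0" "AE z in lborel. z \<in> S \<longrightarrow> f z = f' z"
  using assms by (auto simp: borel_rep_def)

lemma borel_rep_exists:
  assumes S: "S \<in> sets borel" and f: "f \<in> borel_measurable (lebesgue_on S)"
  obtains f' where "borel_rep S f f'"
proof -
  have "(\<lambda>x. if x \<in> S then f x else 0) \<in> borel_measurable lebesgue"
    using f S by (subst borel_measurable_if) (auto intro: lborelD)
  from completion_ex_borel_measurable_real[OF this] obtain g
    where g: "g \<in> borel_measurable lborel" "AE x in lborel. (if x \<in> S then f x else 0) = g x" by blast
  have "borel_rep S f (\<lambda>x. indicator S x * g x)"
    unfolding borel_rep_def using g S
    by (auto elim: eventually_mono split: if_splits)
  then show ?thesis by (rule that)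
qed

lemma borel_rep_compose:
  assumes "borel_rep S f f'" "(\<lambda>z. H z (f' z)) \<in> borel_measurable borel"
    and "\<And>z. z \<notin> S \<Longrightarrow> H z 0 = 0"
  shows "borel_rep S (\<lambda>z. H z (f z)) (\<lambda>z. H z (f' z))"
  using assms unfolding borel_rep_def by (auto elim!: eventually_mono)

lemma
  assumes S: "S \<in> sets borel" and r: "borel_rep S f f'"
  shows borel_rep_measurable: "f \<in> borel_measurable (lebesgue_on S)"
    and borel_rep_integrable: "integrable (lebesgue_on S) f \<longleftrightarrow> integrable lborel f'"
    and borel_rep_integral: "integral\<^sup>L (lebesgue_on S) f = integral\<^sup>L lborel f'"
proof -
  have SL: "S \<in> sets lebesgue" using S by simp
  let ?f = "\<lambda>x. if x \<in> S then f x else 0"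
  have f': "f' \<in> borel_measurable lebesgue" "f' \<in> borel_measurable lborel"
    using borel_repD(1)[OF r] by (simp_all add: measurable_completion)
  have ae: "AE x in lebesgue. f' x = ?f x"
    using borel_repD(3)[OF r] borel_repD(2)[OF r]
    by (intro AE_completion) (auto elim!: eventually_mono)
  have m: "?f \<in> borel_measurable lebesgue"
    using f'(1) ae by (rule borel_measurable_AE)
  then show "f \<in> borel_measurable (lebesgue_on S)"
    using SL by (simp add: borel_measurable_if)
  have "integrable (lebesgue_on S) f \<longleftrightarrow> integrable lebesgue ?f"
    using Lebesgue_Measure.integrable_restrict_UNIV[OF SL, of f] by simp
  also have "\<dots> \<longleftrightarrow> integrable lebesgue f'"
    using m f'(1) ae by (intro integrable_cong_AE) (auto elim: eventually_mono)
  also have "\<dots> \<longleftrightarrow> integrable lborel f'"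
    using f'(2) by (rule integrable_completion)
  finally show "integrable (lebesgue_on S) f \<longleftrightarrow> integrable lborel f'" .
  have "integral\<^sup>L (lebesgue_on S) f = integral\<^sup>L lebesgue ?f"
    using Lebesgue_Measure.integral_restrict_UNIV[OF SL, of f] by simp
  also have "\<dots> = integral\<^sup>L lebesgue f'"
    using m f'(1) ae by (intro integral_cong_AE) (auto elim: eventually_mono)
  also have "\<dots> = integral\<^sup>L lborel f'"
    using f'(2) by (rule integral_completion)
  finally show "integral\<^sup>L (lebesgue_on S) f = integral\<^sup>L lborel f'" .
qed

lemma borel_rep_Lp:
  assumes S: "S \<in> sets borel" and r: "borel_rep S f f'"
  shows "f \<in> Lp_space p S \<longleftrightarrow> integrable lborel (\<lambda>z. \<bar>f' z\<bar> powr p)"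
    and "Lp_norm p S f = (\<integral>z. \<bar>f' z\<bar> powr p \<partial>lborel) powr (1 / p)"
proof -
  have "borel_rep S (\<lambda>z. norm (f z) powr p) (\<lambda>z. norm (f' z) powr p)"
    by (rule borel_rep_compose[OF r]) (use borel_repD(1)[OF r] in \<open>auto intro!: measurable\<close>)
  then have p: "borel_rep S (\<lambda>z. norm (f z) powr p) (\<lambda>z. \<bar>f' z\<bar> powr p)" by simp
  show "f \<in> Lp_space p S \<longleftrightarrow> integrable lborel (\<lambda>z. \<bar>f' z\<bar> powr p)"
    unfolding Lp_space_def using borel_rep_measurable[OF S r] borel_rep_integrable[OF S p] by auto
  show "Lp_norm p S f = (\<integral>z. \<bar>f' z\<bar> powr p \<partial>lborel) powr (1 / p)"
    unfolding Lp_norm_def using borel_rep_integral[OF S p] by auto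
qed

lemma lborel_integral_translate:
  fixes f :: "'a::euclidean_space \<Rightarrow> real"
  assumes "f \<in> borel_measurable borel"
  shows "(\<integral>z. f (t + z) \<partial>lborel) = (\<integral>z. f z \<partial>lborel)"
proof -
  have "(\<integral>z. f z \<partial>lborel) = (\<integral>z. f z \<partial>distr lborel borel ((+) t))"
    by (simp add: lborel_distr_plus)
  also have "\<dots> = (\<integral>z. f (t + z) \<partial>lborel)"
    using assms by (subst integral_distr) auto
  finally show ?thesis by simp
qed

text \<open>
  The difference quotients of \<open>w\<close> have integral zero by translation invariance, are bounded by \<open>M\<close>
  through the mean value theorem, and vanish off a common ball; dominated convergence applies. This
  treats a coordinate direction without splitting the space into a product.
\<close>

lemma integral_directional_derivative_eq_0:
  fixes w :: "'a::euclidean_space \<Rightarrow> real"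
  assumes cont: "continuous_on UNIV w"
    and der: "\<And>z. ((\<lambda>h. w (z + h *\<^sub>R e)) has_real_derivative w' z) (at 0)"
    and bd: "\<And>z. \<bar>w' z\<bar> \<le> M"
    and supp: "\<And>z. z \<notin> cball 0 R \<Longrightarrow> w z = 0"
  shows "(\<integral>z. w' z \<partial>lborel) = 0"
proof -
  have [measurable]: "w \<in> borel_measurable borel"
    using cont by (rule borel_measurable_continuous_onI)
  define D where "D n z = (w (z + (1 / real (Suc n)) *\<^sub>R e) - w z) * real (Suc n)" for n z
  have [measurable]: "D n \<in> borel_measurable borel" for n unfolding D_def by measurable
  have lim: "(\<lambda>n. D n z) \<longlonglongrightarrow> w' z" for z
  proof -
    have "((\<lambda>h. (w (z + h *\<^sub>R e) - w z) / h) \<longlongrightarrow> w' z) (at 0)"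
      using der[of z] by (simp add: has_field_derivative_iff)
    moreover have "filterlim (\<lambda>n. 1 / real (Suc n)) (at 0) sequentially"
      unfolding filterlim_at using LIMSEQ_Suc[OF lim_1_over_n] by auto
    ultimately have "(\<lambda>n. (w (z + (1 / real (Suc n)) *\<^sub>R e) - w z) / (1 / real (Suc n))) \<longlonglongrightarrow> w' z"
      by (rule filterlim_compose)
    then show ?thesis by (simp add: D_def del: of_nat_Suc)
  qed
  have der': "((\<lambda>h. w (z + h *\<^sub>R e)) has_real_derivative w' (z + x *\<^sub>R e)) (at x)" for z x
  proof -
    have "((\<lambda>h. w ((z + x *\<^sub>R e) + h *\<^sub>R e)) has_real_derivative w' (z + x *\<^sub>R e)) (at 0)" by (rule der)
    then have "((\<lambda>h. w (z + (h + x) *\<^sub>R e)) has_real_derivative w' (z + x *\<^sub>R e)) (at 0)"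
      by (simp add: algebra_simps)
    then show ?thesis using DERIV_shift[of "\<lambda>h. w (z + h *\<^sub>R e)" "w' (z + x *\<^sub>R e)" 0 x] by simp
  qed
  have Dbd: "\<bar>D n z\<bar> \<le> M" for n z
  proof -
    let ?h = "1 / real (Suc n)"
    obtain \<xi> where \<xi>: "w (z + ?h *\<^sub>R e) - w (z + 0 *\<^sub>R e) = (?h - 0) * w' (z + \<xi> *\<^sub>R e)"
      using MVT2[of 0 ?h "\<lambda>h. w (z + h *\<^sub>R e)" "\<lambda>x. w' (z + x *\<^sub>R e)"] der' by auto
    then have "D n z = w' (z + \<xi> *\<^sub>R e)" by (simp add: D_def)
    then show ?thesis using bd by simp
  qed
  have Dsupp: "D n z = 0" if "z \<notin> cball 0 (R + norm e)" for n z
  proof -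
    have "norm ((1 / real (Suc n)) *\<^sub>R e) \<le> 1 * norm e"
      unfolding norm_scaleR by (intro mult_right_mono) auto
    then have "norm z - norm e \<le> norm (z + (1 / real (Suc n)) *\<^sub>R e)"
      using norm_diff_ineq[of z "(1 / real (Suc n)) *\<^sub>R e"] by linarith
    then have "z + (1 / real (Suc n)) *\<^sub>R e \<notin> cball 0 R" "z \<notin> cball 0 R"
      using that norm_ge_zero[of e] by (auto simp del: norm_ge_zero)
    then show ?thesis using supp unfolding D_def by simp
  qed
  have "(\<lambda>n. \<integral>z. D n z \<partial>lborel) \<longlonglongrightarrow> (\<integral>z. w' z \<partial>lborel)"
  proof (rule integral_dominated_convergence[where w="\<lambda>z. indicator (cball 0 (R + norm e)) z * M"])
    show "w' \<in> borel_measurable lborel"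
      by (rule borel_measurable_LIMSEQ_real[of _ D]) (use lim in auto)
    show "integrable lborel (\<lambda>z. indicator (cball 0 (R + norm e)) z * M)"
      by (intro integrable_mult_left) (auto intro: emeasure_lborel_cball_finite)
    show "AE z in lborel. norm (D n z) \<le> indicator (cball 0 (R + norm e)) z * M" for n
      using Dbd Dsupp by (auto simp: indicator_def)
  qed (use lim in auto)
  moreover have "(\<integral>z. D n z \<partial>lborel) = 0" for n
  proof -
    have "integrable lborel (\<lambda>z. indicator (cball 0 R) z *\<^sub>R w z)"
      by (rule borel_integrable_compact) (auto intro: continuous_on_subset[OF cont])
    moreover have "(\<lambda>z. indicator (cball 0 R) z *\<^sub>R w z) = w"
      using supp by (intro ext) (auto simp: indicator_def)
    ultimately have i: "integrable lborel w" by simp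
    let ?t = "(1 / real (Suc n)) *\<^sub>R e"
    have "integrable (distr lborel borel ((+) ?t)) w" using i by (simp add: lborel_distr_plus)
    then have i': "integrable lborel (\<lambda>z. w (z + ?t))"
      by (subst (asm) integrable_distr_eq) (auto simp: add.commute)
    have "(\<integral>z. D n z \<partial>lborel) = ((\<integral>z. w (z + ?t) \<partial>lborel) - (\<integral>z. w z \<partial>lborel)) * real (Suc n)"
      unfolding D_def using i i' by simp
    also have "\<dots> = 0" using lborel_integral_translate[of w ?t] by (simp add: add.commute)
    finally show ?thesis .
  qed
  ultimately show ?thesis by (simp add: LIMSEQ_const_iff)
qed

lemma bump_has_derivative:
  obtains \<eta>' where "\<And>z. (bump k c d has_derivative \<eta>' z) (at z)"
    "\<And>b. b \<in> Basis \<Longrightarrow> continuous_on UNIV (\<lambda>z. \<eta>' z b)"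
proof -
  have "Ck_on (Suc 0) UNIV (bump k c d)" using bump_Cinf[of k c d UNIV] unfolding Cinf_def by blast
  then show ?thesis using that by auto
qed

lemma has_derivative_zero_if_eventually_zero:
  fixes f :: "'a::real_normed_vector \<Rightarrow> real"
  assumes "eventually (\<lambda>x. f x = 0) (nhds z)"
  shows "(f has_derivative (\<lambda>h. 0)) (at z)"
  using has_derivative_transform_eventually[of "\<lambda>_. 0" "\<lambda>_. 0" z UNIV f] assms
    eventually_nhds_x_imp_x[OF assms]
  by (auto simp: eventually_nhds_conv_at elim!: eventually_mono)

lemma has_derivative_imp_directional:
  fixes f :: "'a::real_normed_vector \<Rightarrow> real"
  assumes "(f has_derivative f') (at z)"
  shows "((\<lambda>h. f (z + h *\<^sub>R e)) has_real_derivative f' e) (at 0)"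
proof -
  have "((\<lambda>h. z + h *\<^sub>R e) has_derivative (\<lambda>h. h *\<^sub>R e)) (at 0)"
    by (auto intro!: derivative_eq_intros)
  moreover have "(f has_derivative f') (at (z + 0 *\<^sub>R e))" using assms by simp
  ultimately have "((\<lambda>h. f (z + h *\<^sub>R e)) has_derivative (\<lambda>h. f' (h *\<^sub>R e))) (at 0)"
    by (rule has_derivative_compose)
  moreover have "f' (h *\<^sub>R e) = f' e * h" for h
    using linear_scale[OF has_derivative_linear[OF assms], of h e] by simp
  ultimately show ?thesis by (simp add: has_field_derivative_def)
qed

text \<open>
  The bump cuts \<open>v\<close> off: their product, extended by zero, is differentiable on the whole space, and
  the integral of its derivative vanishes.
\<close>

lemma integral_by_parts_bump:
  fixes v :: "'a::euclidean_space \<Rightarrow> real"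
  assumes U: "open U" and e: "e \<in> Basis"
    and v: "\<And>z. z \<in> U \<Longrightarrow> (v has_derivative v' z) (at z)" "continuous_on U (\<lambda>z. v' z e)"
    and k: "k > 0" and K: "cbox c d \<subseteq> U"
  defines "D \<equiv> \<lambda>z. deriv (\<lambda>h. bump k c d (z + h *\<^sub>R e)) 0"
  shows "(\<integral>z. bump k c d z * v' z e \<partial>lborel) = - (\<integral>z. indicator U z * v z * D z \<partial>lborel)"
proof -
  let ?\<eta> = "bump k c d"
  obtain \<eta>' where \<eta>': "\<And>z. (?\<eta> has_derivative \<eta>' z) (at z)"
    "\<And>b. b \<in> Basis \<Longrightarrow> continuous_on UNIV (\<lambda>z. \<eta>' z b)"
    using bump_has_derivative by blast
  have D: "D z = \<eta>' z e" for z
    unfolding D_def using has_derivative_imp_directional[OF \<eta>'(1)] by (rule DERIV_imp_deriv)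
  have contD: "continuous_on UNIV D" unfolding D using \<eta>'(2)[OF e] .
  have out: "eventually (\<lambda>x. ?\<eta> x = 0) (nhds z)" if "z \<notin> cbox c d" for z
  proof -
    have "eventually (\<lambda>x. x \<in> - cbox c d) (nhds z)"
      using that by (intro eventually_nhds_in_open) (auto simp: closed_cbox open_Compl)
    then show ?thesis
      by eventually_elim (use bump_eq_0[OF k, of _ c d] box_subset_cbox[of c d] in auto)
  qed
  have D0: "D z = 0" if "z \<notin> cbox c d" for z
  proof -
    have "(?\<eta> has_derivative (\<lambda>h. 0)) (at z)"
      using out[OF that] by (rule has_derivative_zero_if_eventually_zero)
    then have "\<eta>' z = (\<lambda>h. 0)" using \<eta>'(1) has_derivative_unique by blast
    then show ?thesis by (simp add: D)
  qed
  define w where "w z = ?\<eta> z * v z" for z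
  define w' where "w' z = (if z \<in> cbox c d then ?\<eta> z * v' z e + v z * D z else 0)" for z
  have w: "\<exists>L. (w has_derivative L) (at z) \<and> L e = w' z" for z
  proof (cases "z \<in> cbox c d")
    case True
    then have "(v has_derivative v' z) (at z)" using K v(1) by auto
    from has_derivative_mult[OF \<eta>'(1)[of z] this]
    show ?thesis unfolding w_def using True by (auto simp: w'_def D)
  next
    case False
    have "eventually (\<lambda>x. w x = 0) (nhds z)" using out[OF False] by eventually_elim (simp add: w_def)
    then have "(w has_derivative (\<lambda>h. 0)) (at z)"
      by (rule has_derivative_zero_if_eventually_zero)
    then show ?thesis using False by (auto simp: w'_def)
  qed
  have contv: "continuous_on (cbox c d) v"
    by (rule has_derivative_continuous_on, rule has_derivative_at_withinI, rule v(1)) (use K in auto)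
  have cont_pieces: "continuous_on (cbox c d) (\<lambda>z. ?\<eta> z * v' z e)" "continuous_on (cbox c d) (\<lambda>z. v z * D z)"
    by (intro continuous_on_mult continuous_on_bump contv continuous_on_subset[OF v(2) K]
        continuous_on_subset[OF contD subset_UNIV])+
  have "continuous_on (cbox c d) (\<lambda>z. ?\<eta> z * v' z e + v z * D z)"
    by (intro continuous_on_add cont_pieces)
  then have "bounded ((\<lambda>z. ?\<eta> z * v' z e + v z * D z) ` cbox c d)"
    by (intro compact_imp_bounded compact_continuous_image) auto
  then obtain M where M: "\<And>z. z \<in> cbox c d \<Longrightarrow> \<bar>?\<eta> z * v' z e + v z * D z\<bar> \<le> M" "M > 0"
    unfolding bounded_pos by auto
  obtain R where R: "cbox c d \<subseteq> cball 0 R"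
    using bounded_cbox[of c d] unfolding bounded_iff by (auto simp: subset_iff)
  have "(\<integral>z. w' z \<partial>lborel) = 0"
  proof (rule integral_directional_derivative_eq_0[where w=w and e=e and M=M and R=R])
    show "continuous_on UNIV w"
    proof (rule continuous_at_imp_continuous_on, rule)
      fix z show "isCont w z" using w[of z] has_derivative_continuous by auto
    qed
    show "((\<lambda>h. w (z + h *\<^sub>R e)) has_real_derivative w' z) (at 0)" for z
    proof -
      obtain L where L: "(w has_derivative L) (at z)" "L e = w' z" using w by blast
      show ?thesis using has_derivative_imp_directional[OF L(1), of e] L(2) by simp
    qed
    show "\<bar>w' z\<bar> \<le> M" for z using M by (auto simp: w'_def)
    show "w z = 0" if "z \<notin> cball 0 R" for z
      using that R bump_eq_0[OF k, of z c d] box_subset_cbox[of c d] unfolding w_def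
      by (metis mult_zero_left subsetD)
  qed
  moreover have i: "integrable lborel (\<lambda>z. indicator (cbox c d) z *\<^sub>R (?\<eta> z * v' z e))"
    "integrable lborel (\<lambda>z. indicator (cbox c d) z *\<^sub>R (v z * D z))"
    by (intro borel_integrable_compact cont_pieces compact_cbox)+
  have e1: "indicator (cbox c d) z *\<^sub>R (?\<eta> z * v' z e) = ?\<eta> z * v' z e" for z
    using bump_eq_0[OF k, of z c d] box_subset_cbox[of c d] by (auto simp: indicator_def)
  have e2: "indicator (cbox c d) z *\<^sub>R (v z * D z) = indicator U z * v z * D z" for z
    using D0[of z] K by (auto simp: indicator_def)
  have "w' z = ?\<eta> z * v' z e + indicator U z * v z * D z" for z
    using e1[of z] e2[of z] by (cases "z \<in> cbox c d") (auto simp: w'_def)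
  ultimately show ?thesis
    using Bochner_Integration.integral_add[OF i] unfolding e1 e2 by simp
qed

lemma open_cylinder: "open \<Omega> \<Longrightarrow> open (cylinder T \<Omega>)"
  unfolding cylinder_def by (intro open_Times) auto

lemma axis_Basis_prod: "(0, axis i 1) \<in> (Basis :: (real \<times> (real ^ 'd)) set)"
  by (auto simp: Basis_prod_def axis_in_Basis_iff)

lemma partial_x_eq_directional:
  "partial_x i \<phi> z = deriv (\<lambda>h. \<phi> (z + h *\<^sub>R (0, axis i 1))) 0"
  unfolding partial_x_def by (cases z) simp

lemma bump_Cinf_cpt:
  assumes "k > 0" "cbox c d \<subseteq> S"
  shows "bump k c d \<in> Cinf_cpt S"
  by (rule Cinf_cptI[of _ _ "cbox c d"])
     (use assms bump_eq_0[OF assms(1), of _ c d] box_subset_cbox[of c d] in \<open>auto intro: bump_Cinf\<close>)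

text \<open>
  Tested against a bump, both derivatives give minus the integral of \<open>v\<close> times the derivative of the
  bump, one by definition and one by partial integration.
\<close>

lemma weak_partial_x_eq_classical:
  fixes v :: "real \<times> (real ^ 'd) \<Rightarrow> real"
  defines "e i \<equiv> (0, axis i 1)"
  assumes \<Omega>: "open \<Omega>"
    and v: "\<And>z. z \<in> cylinder T \<Omega> \<Longrightarrow> (v has_derivative v' z) (at z)"
      "continuous_on (cylinder T \<Omega>) (\<lambda>z. v' z (e i))"
    and g: "borel_rep (cylinder T \<Omega>) g g'" "integrable lborel g'"
    and weak: "weak_partial_x T \<Omega> i v g"
  shows "AE z in lborel. z \<in> cylinder T \<Omega> \<longrightarrow> g' z = v' z (e i)"
proof -
  let ?U = "cylinder T \<Omega>" and ?e = "e i"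
  have U: "open ?U" using \<Omega> by (rule open_cylinder)
  then have UB: "?U \<in> sets borel" by simp
  have contv: "continuous_on ?U v"
    by (rule has_derivative_continuous_on, rule has_derivative_at_withinI, rule v(1))
  have "(\<lambda>z. indicator ?U z * v z) \<in> borel_measurable borel"
    using borel_measurable_continuous_on_indicator[OF UB contv] by simp
  then have rv: "borel_rep ?U v (\<lambda>z. indicator ?U z * v z)"
    unfolding borel_rep_def by auto
  have gK: "integrable lborel (\<lambda>z. indicator (cbox a b) z * g' z)" for a b
    using integrable_mult_indicator[OF _ g(2), of "cbox a b"] by simp
  have vK: "integrable lborel (\<lambda>z. indicator (cbox a b) z * v' z ?e)" if "cbox a b \<subseteq> ?U" for a b
    using borel_integrable_compact[OF compact_cbox continuous_on_subset[OF v(2) that]] by simp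
  have "AE z in lborel. z \<in> ?U \<longrightarrow> g' z - v' z ?e = 0"
  proof (rule AE_zero_if_bump_integrals_zero[OF U])
    fix a b assume "cbox a b \<subseteq> ?U"
    from Bochner_Integration.integrable_diff[OF gK vK[OF this]]
    show "integrable lborel (\<lambda>z. indicator (cbox a b) z * (g' z - v' z ?e))"
      by (simp add: right_diff_distrib)
  next
    fix k :: real and c d :: "real \<times> (real ^ 'd)" assume k: "k > 0" and K: "cbox c d \<subseteq> ?U"
    let ?\<eta> = "bump k c d" let ?D = "\<lambda>z. deriv (\<lambda>h. bump k c d (z + h *\<^sub>R ?e)) 0"
    obtain \<eta>' where \<eta>': "\<And>z. (?\<eta> has_derivative \<eta>' z) (at z)"
      "\<And>b. b \<in> Basis \<Longrightarrow> continuous_on UNIV (\<lambda>z. \<eta>' z b)"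
      using bump_has_derivative by blast
    have "?D z = \<eta>' z ?e" for z
      using has_derivative_imp_directional[OF \<eta>'(1)] by (rule DERIV_imp_deriv)
    then have mD: "?D \<in> borel_measurable borel"
      using \<eta>'(2)[of ?e] axis_Basis_prod[of i] by (auto simp: e_def intro: borel_measurable_continuous_onI)
    have "(\<integral>z. g' z * ?\<eta> z \<partial>lborel) = (\<integral>z. g z * ?\<eta> z \<partial>lebesgue_on ?U)"
      by (rule borel_rep_integral[OF UB, symmetric], rule borel_rep_compose[OF g(1)])
         (use borel_repD(1)[OF g(1)] in auto)
    also have "\<dots> = - (\<integral>z. v z * ?D z \<partial>lebesgue_on ?U)"
      using weak bump_Cinf_cpt[OF k K] unfolding weak_partial_x_def
      by (simp add: partial_x_eq_directional e_def)
    also have "(\<integral>z. v z * ?D z \<partial>lebesgue_on ?U) = (\<integral>z. indicator ?U z * v z * ?D z \<partial>lborel)"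
      by (rule borel_rep_integral[OF UB], rule borel_rep_compose[OF rv])
         (use borel_repD(1)[OF rv] mD in auto)
    also have "- \<dots> = (\<integral>z. ?\<eta> z * v' z ?e \<partial>lborel)"
      using integral_by_parts_bump[OF U _ v(1) v(2) k K] axis_Basis_prod[of i] by (simp add: e_def)
    finally have eq: "(\<integral>z. g' z * ?\<eta> z \<partial>lborel) = (\<integral>z. ?\<eta> z * v' z ?e \<partial>lborel)" .
    have loc: "?\<eta> z * f z = ?\<eta> z * (indicator (cbox c d) z * f z)" for f :: "_ \<Rightarrow> real" and z
      using bump_eq_0[OF k, of z c d] box_subset_cbox[of c d] by (auto simp: indicator_def)
    have i: "integrable lborel (\<lambda>z. ?\<eta> z * f z)" if "integrable lborel (\<lambda>z. indicator (cbox c d) z * f z)"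
      for f :: "_ \<Rightarrow> real"
    proof -
      have "integrable lborel (\<lambda>z. ?\<eta> z * (indicator (cbox c d) z * f z))"
        by (rule Bochner_Integration.integrable_bound[OF that])
           (use that bump_bounds[of k c d] in \<open>auto simp: abs_mult mult_left_le_one_le\<close>)
      then show ?thesis by (subst loc)
    qed
    show "(\<integral>z. ?\<eta> z * (g' z - v' z ?e) \<partial>lborel) = 0"
      using Bochner_Integration.integral_diff[OF i[OF gK] i[OF vK[OF K]]] eq
      by (simp add: right_diff_distrib mult.commute)
  qed
  then show ?thesis by simp
qed

section \<open>Hoelder's and Morrey's inequalities\<close>

text \<open>
  Hoelder's inequality raised to the power \<open>p\<close>, with \<open>p / (p - 1)\<close> the exponent dual to \<open>p\<close>. It is
  Young's inequality applied to the two factors after normalising their norms.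
\<close>

lemma Holder_powr:
  fixes k g :: "'a \<Rightarrow> real"
  assumes p: "p > 1"
    and k: "k \<in> borel_measurable M" "\<And>z. k z \<ge> 0" "integrable M (\<lambda>z. k z powr (p / (p - 1)))"
    and g: "g \<in> borel_measurable M" "integrable M (\<lambda>z. \<bar>g z\<bar> powr p)"
  shows "integrable M (\<lambda>z. k z * g z)"
    and "\<bar>\<integral>z. k z * g z \<partial>M\<bar> powr p
      \<le> (\<integral>z. k z powr (p / (p - 1)) \<partial>M) powr (p - 1) * (\<integral>z. \<bar>g z\<bar> powr p \<partial>M)"
proof -
  let ?p' = "p / (p - 1)"
  define K where "K = (\<integral>z. k z powr ?p' \<partial>M)"
  define G where "G = (\<integral>z. \<bar>g z\<bar> powr p \<partial>M)"
  have p': "?p' > 1" "1 / ?p' + 1 / p = 1" "p > 0" using p by (auto simp: field_simps)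
  note Young = Youngs_inequality[OF p'(1) p p'(2)]
  note [measurable] = k(1) g(1)
  show i: "integrable M (\<lambda>z. k z * g z)"
  proof (rule Bochner_Integration.integrable_bound)
    show "integrable M (\<lambda>z. k z powr ?p' / ?p' + \<bar>g z\<bar> powr p / p)"
      using k g by auto
    show "AE z in M. norm (k z * g z) \<le> norm (k z powr ?p' / ?p' + \<bar>g z\<bar> powr p / p)"
    proof (rule AE_I2)
      fix z
      have "norm (k z * g z) = k z * \<bar>g z\<bar>" using k(2)[of z] by (simp add: abs_mult)
      also have "\<dots> \<le> k z powr ?p' / ?p' + \<bar>g z\<bar> powr p / p" using Young k(2) by auto
      finally show "norm (k z * g z) \<le> norm (k z powr ?p' / ?p' + \<bar>g z\<bar> powr p / p)"
        by (rule order_trans) (simp only: real_norm_def abs_ge_self)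
    qed
  qed simp
  have K0: "K \<ge> 0" and G0: "G \<ge> 0" unfolding K_def G_def by auto
  have "\<bar>\<integral>z. k z * g z \<partial>M\<bar> powr p \<le> K powr (p - 1) * G"
  proof (cases "K = 0 \<or> G = 0")
    case True
    have "AE z in M. k z * g z = 0"
    proof (cases "K = 0")
      case True
      then have "AE z in M. k z powr ?p' = 0"
        using k(3) by (subst (asm) K_def, subst (asm) integral_nonneg_eq_0_iff_AE) auto
      then show ?thesis by eventually_elim auto
    next
      case False
      then have "AE z in M. \<bar>g z\<bar> powr p = 0"
        using True g(2) by (subst integral_nonneg_eq_0_iff_AE[symmetric]) (auto simp: G_def)
      then show ?thesis by eventually_elim auto
    qed
    then have "(\<integral>z. k z * g z \<partial>M) = (\<integral>z. 0 \<partial>M)" by (intro integral_cong_AE) auto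
    then show ?thesis using K0 G0 p by simp
  next
    case False
    then have KG: "K > 0" "G > 0" using K0 G0 by auto
    let ?a = "K powr (1 / ?p')" and ?b = "G powr (1 / p)"
    have ab: "?a > 0" "?b > 0" using KG by auto
    have ap: "?a powr ?p' = K" "?b powr p = G" using KG p' p by (simp_all add: powr_powr)
    have "\<bar>\<integral>z. k z * g z \<partial>M\<bar> \<le> (\<integral>z. \<bar>k z * g z\<bar> \<partial>M)" by (rule integral_abs_bound)
    also have "\<dots> \<le> (\<integral>z. ?a * ?b * ((k z powr ?p' / K) / ?p' + (\<bar>g z\<bar> powr p / G) / p) \<partial>M)"
    proof (rule integral_mono)
      show "integrable M (\<lambda>z. \<bar>k z * g z\<bar>)" using i by (rule integrable_abs)
      show "integrable M (\<lambda>z. ?a * ?b * ((k z powr ?p' / K) / ?p' + (\<bar>g z\<bar> powr p / G) / p))"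
        using k(3) g(2) by auto
      fix z
      have "\<bar>k z * g z\<bar> = ?a * ?b * ((k z / ?a) * (\<bar>g z\<bar> / ?b))"
        using k(2)[of z] ab by (simp add: abs_mult)
      also have "\<dots> \<le> ?a * ?b * ((k z / ?a) powr ?p' / ?p' + (\<bar>g z\<bar> / ?b) powr p / p)"
        using ab k(2)[of z] by (intro mult_left_mono Young) auto
      also have "(k z / ?a) powr ?p' = k z powr ?p' / K"
        using ap(1) k(2)[of z] ab by (subst powr_divide) auto
      also have "(\<bar>g z\<bar> / ?b) powr p = \<bar>g z\<bar> powr p / G"
        using ap(2) ab by (subst powr_divide) auto
      finally show "\<bar>k z * g z\<bar> \<le> ?a * ?b * ((k z powr ?p' / K) / ?p' + (\<bar>g z\<bar> powr p / G) / p)" .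
    qed
    also have "\<dots> = ?a * ?b * ((K / K) / ?p' + (G / G) / p)"
      using k(3) g(2) unfolding K_def G_def by simp
    also have "\<dots> = ?a * ?b" using KG p'(2) by simp
    finally have "\<bar>\<integral>z. k z * g z \<partial>M\<bar> powr p \<le> (?a * ?b) powr p"
      using p by (intro powr_mono2) auto
    also have "\<dots> = ?a powr p * G" using ab ap by (simp add: powr_mult)
    also have "?a powr p = K powr (p - 1)" using p by (simp add: powr_powr)
    finally show ?thesis .
  qed
  then show "\<bar>\<integral>z. k z * g z \<partial>M\<bar> powr p \<le> (\<integral>z. k z powr ?p' \<partial>M) powr (p - 1) * (\<integral>z. \<bar>g z\<bar> powr p \<partial>M)"
    unfolding K_def G_def .
qed

lemma abs_add_powr_le:
  fixes x y p :: real
  assumes "p \<ge> 0"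
  shows "\<bar>x + y\<bar> powr p \<le> 2 powr p * (\<bar>x\<bar> powr p + \<bar>y\<bar> powr p)"
proof -
  have "\<bar>x + y\<bar> powr p \<le> (2 * max \<bar>x\<bar> \<bar>y\<bar>) powr p"
    using assms by (intro powr_mono2) auto
  also have "\<dots> = 2 powr p * max \<bar>x\<bar> \<bar>y\<bar> powr p" by (simp add: powr_mult)
  also have "max \<bar>x\<bar> \<bar>y\<bar> powr p \<le> \<bar>x\<bar> powr p + \<bar>y\<bar> powr p" by (auto simp: max_def)
  finally show ?thesis by simp
qed

lemma has_bochner_integral_powr_0:
  fixes a c :: real
  assumes "a > -1" "c \<ge> 0"
  shows "has_bochner_integral lborel (\<lambda>r. indicator {0<..<c} r * r powr a) (c powr (a + 1) / (a + 1))"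
proof (rule has_bochner_integral_nn_integral)
  have "((\<lambda>r. indicator {0<..<c} r * r powr a) has_integral (c powr (a + 1) / (a + 1))) UNIV"
  proof -
    have "((\<lambda>r. if r \<in> {0..c} then r powr a else 0) has_integral (c powr (a + 1) / (a + 1))) UNIV"
      using has_integral_powr_from_0[OF assms] by (simp only: has_integral_restrict_UNIV)
    then show ?thesis
      by (rule has_integral_spike_finite[where S="{0, c}", rotated 2]) (auto simp: indicator_def)
  qed
  then show "(\<integral>\<^sup>+ r. ennreal (indicator {0<..<c} r * r powr a) \<partial>lborel) = ennreal (c powr (a + 1) / (a + 1))"
    by (intro nn_integral_has_integral_lborel) auto
qed (use assms in auto)

lemma nn_integral_lborel_affine:
  fixes t :: "'a::euclidean_space"
  assumes [measurable]: "f \<in> borel_measurable borel" and c: "c > 0"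
  shows "(\<integral>\<^sup>+y. f (t + c *\<^sub>R y) \<partial>lborel) = ennreal (c powr (- real DIM('a))) * (\<integral>\<^sup>+y. f y \<partial>lborel)"
proof -
  have "(\<integral>\<^sup>+y. f y \<partial>lborel)
      = (\<integral>\<^sup>+y. f y \<partial>density (distr lborel borel (\<lambda>x. t + c *\<^sub>R x)) (\<lambda>_. \<bar>c\<bar> ^ DIM('a)))"
    using lborel_affine[of c t] c by simp
  also have "\<dots> = ennreal (c ^ DIM('a)) * (\<integral>\<^sup>+y. f (t + c *\<^sub>R y) \<partial>lborel)"
    using c by (subst nn_integral_density)
      (auto simp: nn_integral_distr nn_integral_cmult)
  finally have "ennreal (c powr (- real DIM('a))) * (\<integral>\<^sup>+y. f y \<partial>lborel)
     = (ennreal (c powr (- real DIM('a))) * ennreal (c ^ DIM('a))) * (\<integral>\<^sup>+y. f (t + c *\<^sub>R y) \<partial>lborel)"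
    by (simp add: mult.assoc)
  also have "ennreal (c powr (- real DIM('a))) * ennreal (c ^ DIM('a)) = 1"
    using c by (simp add: ennreal_mult[symmetric] powr_minus powr_realpow)
  finally show ?thesis by simp
qed

text \<open>
  Hoelder's inequality for the splitting \<open>F r = r powr (- s) * (r powr s * F r)\<close>. The weight
  \<open>r powr (s * p)\<close> gained on the right is what later compensates a singular Jacobian at \<open>r = 0\<close>.
\<close>

lemma segment_estimate:
  fixes \<phi> F :: "real \<Rightarrow> real"
  assumes p: "p > 1" and s: "s \<ge> 0" "s * (p / (p - 1)) < 1"
    and \<phi>: "\<And>r. r \<in> {0..1} \<Longrightarrow> (\<phi> has_real_derivative \<phi>' r) (at r within {0..1})"
    and F: "continuous_on {0..1} F" "\<And>r. r \<in> {0..1} \<Longrightarrow> \<bar>\<phi>' r\<bar> \<le> F r"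
  shows "ennreal (\<bar>\<phi> 1 - \<phi> 0\<bar> powr p) \<le> ennreal ((1 / (1 - s * (p / (p - 1)))) powr (p - 1)) *
     (\<integral>\<^sup>+r. ennreal (indicator {0<..<1} r * r powr (s * p)) * ennreal (F r powr p) \<partial>lborel)"
proof -
  let ?p' = "p / (p - 1)"
  have F0: "F r \<ge> 0" if "r \<in> {0..1}" for r using F(2)[OF that] by linarith
  have D: "(\<phi>' has_integral (\<phi> 1 - \<phi> 0)) {0..1}"
    using \<phi> by (intro fundamental_theorem_of_calculus) (auto simp: has_real_derivative_iff_has_vector_derivative)
  have "\<bar>\<phi> 1 - \<phi> 0\<bar> \<le> integral {0..1} F"
    using D F integrable_continuous_real[OF F(1)]
      integral_norm_bound_integral[of \<phi>' "{0..1}" F] by (auto simp: has_integral_iff)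
  also have "integral {0..1} F = (\<integral>r. indicator {0..1} r * F r \<partial>lborel)"
    using set_borel_integral_eq_integral(2)[of "{0..1}" F] borel_integrable_compact[OF _ F(1)]
    by (simp add: set_integrable_def set_lebesgue_integral_def)
  also have "\<dots> = (\<integral>r. (indicator {0<..<1} r * r powr (- s)) * (indicator {0..1} r * (r powr s * F r)) \<partial>lborel)"
  proof (rule integral_cong_AE)
    have m: "(\<lambda>r. indicator {0..1} r *\<^sub>R F r) \<in> borel_measurable borel"
      using F(1) by (intro borel_measurable_continuous_on_indicator) auto
    then show "(\<lambda>r. indicator {0..1} r * F r) \<in> borel_measurable lborel" by simp
    have "(\<lambda>r. (indicator {0<..<1} r * r powr (- s)) * (r powr s * (indicator {0..1} r *\<^sub>R F r))) \<in> borel_measurable lborel"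
      using m by measurable
    then show "(\<lambda>r. (indicator {0<..<1} r * r powr (- s)) * (indicator {0..1} r * (r powr s * F r))) \<in> borel_measurable lborel"
      by (simp add: mult_ac)
    have "AE r in lborel. r \<noteq> (0::real)" "AE r in lborel. r \<noteq> (1::real)"
      by (rule AE_lborel_singleton)+
    then show "AE r in lborel. indicator {0..1} r * F r = (indicator {0<..<1} r * r powr (- s)) * (indicator {0..1} r * (r powr s * F r))"
      by eventually_elim (auto simp: indicator_def powr_minus)
  qed
  finally have le: "\<bar>\<phi> 1 - \<phi> 0\<bar> \<le> \<bar>\<integral>r. (indicator {0<..<1} r * r powr (- s)) * (indicator {0..1} r * (r powr s * F r)) \<partial>lborel\<bar>"
    by linarith
  have K: "has_bochner_integral lborel (\<lambda>r. (indicator {0<..<1} r * r powr (- s)) powr ?p') (1 / (1 - s * ?p'))"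
  proof -
    have "(indicator {0<..<1} r * r powr (- s)) powr ?p' = indicator {0<..<1} r * r powr (- (s * ?p'))" for r :: real
      using p by (auto simp: indicator_def powr_powr)
    then show ?thesis using has_bochner_integral_powr_0[of "- (s * ?p')" 1] s by (simp add: add.commute)
  qed
  have cF: "continuous_on {0..1} (\<lambda>r. F r powr p)"
    using F p F0 by (intro continuous_on_powr' continuous_intros) auto
  have mF: "(\<lambda>r. indicator {0..1} r *\<^sub>R F r) \<in> borel_measurable borel"
    using F(1) by (intro borel_measurable_continuous_on_indicator) auto
  have mG: "(\<lambda>r. indicator {0..1} r * (r powr s * F r)) \<in> borel_measurable lborel"
  proof -
    have "(\<lambda>r. r powr s * (indicator {0..1} r *\<^sub>R F r)) \<in> borel_measurable lborel" using mF by measurable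
    then show ?thesis by (simp add: mult_ac)
  qed
  have iG: "integrable lborel (\<lambda>r. \<bar>indicator {0..1} r * (r powr s * F r)\<bar> powr p)"
  proof (rule Bochner_Integration.integrable_bound)
    show "integrable lborel (\<lambda>r. indicator {0..1} r *\<^sub>R (F r powr p))"
      by (rule borel_integrable_compact[OF _ cF]) auto
    have "\<bar>r powr s * F r\<bar> powr p \<le> F r powr p" if "r \<in> {0..1}" for r
    proof (rule powr_mono2)
      have "r powr s \<le> 1" using that s by (simp add: powr_le1)
      then show "\<bar>r powr s * F r\<bar> \<le> F r" using F0[OF that]
        by (simp add: abs_mult mult_left_le_one_le)
    qed (use p in auto)
    then show "AE r in lborel. norm (\<bar>indicator {0..1} r * (r powr s * F r)\<bar> powr p) \<le> norm (indicator {0..1} r *\<^sub>R (F r powr p))"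
      by (auto simp: indicator_def)
  qed (use mG in measurable)
  have "\<bar>\<phi> 1 - \<phi> 0\<bar> powr p \<le> \<bar>\<integral>r. (indicator {0<..<1} r * r powr (- s)) * (indicator {0..1} r * (r powr s * F r)) \<partial>lborel\<bar> powr p"
    using le p by (intro powr_mono2) auto
  also have "\<dots> \<le> (\<integral>r. (indicator {0<..<1} r * r powr (- s)) powr ?p' \<partial>lborel) powr (p - 1) *
      (\<integral>r. \<bar>indicator {0..1} r * (r powr s * F r)\<bar> powr p \<partial>lborel)"
    by (rule Holder_powr(2)[OF p]) (use K iG mG in \<open>auto simp: has_bochner_integral_iff\<close>)
  also have "(\<integral>r. (indicator {0<..<1} r * r powr (- s)) powr ?p' \<partial>lborel) = 1 / (1 - s * ?p')"
    using K by (simp add: has_bochner_integral_iff)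
  finally have "ennreal (\<bar>\<phi> 1 - \<phi> 0\<bar> powr p) \<le> ennreal ((1 / (1 - s * ?p')) powr (p - 1)) *
      ennreal (\<integral>r. \<bar>indicator {0..1} r * (r powr s * F r)\<bar> powr p \<partial>lborel)"
    by (subst ennreal_mult[symmetric]) (auto intro!: ennreal_leI)
  also have "ennreal (\<integral>r. \<bar>indicator {0..1} r * (r powr s * F r)\<bar> powr p \<partial>lborel)
     = (\<integral>\<^sup>+r. ennreal (\<bar>indicator {0..1} r * (r powr s * F r)\<bar> powr p) \<partial>lborel)"
    using iG by (intro nn_integral_eq_integral[symmetric]) auto
  also have "\<dots> = (\<integral>\<^sup>+r. ennreal (indicator {0<..<1} r * r powr (s * p)) * ennreal (F r powr p) \<partial>lborel)"
  proof (rule nn_integral_cong_AE)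
    have "AE r in lborel. r \<noteq> (0::real)" "AE r in lborel. r \<noteq> (1::real)"
      by (rule AE_lborel_singleton)+
    then show "AE r in lborel. ennreal (\<bar>indicator {0..1} r * (r powr s * F r)\<bar> powr p)
       = ennreal (indicator {0<..<1} r * r powr (s * p)) * ennreal (F r powr p)"
    proof eventually_elim
      case (elim r)
      show ?case
      proof (cases "r \<in> {0..1}")
        case True
        then have "\<bar>r powr s * F r\<bar> powr p = r powr (s * p) * F r powr p"
          using F0[OF True] by (simp add: powr_mult powr_powr abs_mult)
        then show ?thesis using True elim by (simp add: indicator_def ennreal_mult)
      qed (use p in \<open>auto simp: indicator_def\<close>)
    qed
  qed
  finally show ?thesis .
qed

text \<open>
  Morrey's inequality without singular kernels: \<open>f x\<close> is compared with \<open>f y\<close> along the segment from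
  \<open>x\<close> to \<open>y\<close>, and the \<open>p\<close>-th power of the comparison is averaged over all \<open>y\<close> in the ball. After
  exchanging the integrals, the substitution of \<open>x + r (y - x)\<close> for \<open>y\<close> costs the factor \<open>r powr (- d)\<close>
  and keeps the points inside the ball, by convexity. What remains is the integral of
  \<open>r powr (s * p - d)\<close> over the unit interval.
\<close>

lemma Morrey_ball:
  assumes p: "real DIM('a::euclidean_space) < p"
  obtains C where "C \<ge> 0" and
    "\<And>(f::'a \<Rightarrow> real) f' G x. \<lbrakk>\<And>y. y \<in> ball 0 1 \<Longrightarrow> (f has_derivative f' y) (at y);
       continuous_on (ball 0 1) G; \<And>y h. y \<in> ball 0 1 \<Longrightarrow> \<bar>f' y h\<bar> \<le> norm h * G y; x \<in> ball 0 1\<rbrakk> \<Longrightarrow>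
     ennreal (\<bar>f x\<bar> powr p) \<le>
       ennreal C * (\<integral>\<^sup>+y. ennreal (indicator (ball 0 1) y * (\<bar>f y\<bar> powr p + G y powr p)) \<partial>lborel)"
proof -
  let ?d = "real DIM('a)" and ?B = "ball (0::'a) 1"
  have d1: "?d \<ge> 1" using DIM_positive[where 'a='a] by linarith
  then have p1: "p > 1" using p by linarith
  \<comment> \<open>The midpoint of \<open>(d - 1) / p\<close> and \<open>(p - 1) / p\<close>: above the former, \<open>r powr (s * p - d)\<close> is integrable at \<open>0\<close>; below the latter, so is the dual power of \<open>r powr (- s)\<close>.\<close>
  define s where "s = (?d + p - 2) / (2 * p)"
  have sp: "s * p = (?d + p - 2) / 2" unfolding s_def using p1 by (simp add: field_simps)
  have s: "s \<ge> 0" "s * (p / (p - 1)) < 1" "s * p - ?d > -1"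
  proof -
    show "s \<ge> 0" unfolding s_def using d1 p1 by (intro divide_nonneg_pos) linarith+
    have "s * (p / (p - 1)) = (s * p) / (p - 1)" by simp
    also have "\<dots> < 1" unfolding sp using p p1 by (simp add: divide_less_eq)
    finally show "s * (p / (p - 1)) < 1" .
    have "2 * (s * p) = ?d + p - 2" using sp by simp
    then show "s * p - ?d > -1" using p by linarith
  qed
  define K where "K = (1 / (1 - s * (p / (p - 1)))) powr (p - 1)"
  define C2 where "C2 = 1 / (s * p - ?d + 1)"
  have K0: "K \<ge> 0" and C20: "C2 \<ge> 0" using s by (auto simp: K_def C2_def)
  define b where "b = measure lborel ?B"
  have b: "b > 0" unfolding b_def by (rule content_ball_pos) simp
  have eb: "emeasure lborel ?B = ennreal b"
    unfolding b_def using emeasure_lborel_ball_finite[of "0::'a" 1] by (simp add: emeasure_eq_ennreal_measure)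
  define C where "C = (2 powr p + 2 powr p * (2 powr p * K * C2)) / b"
  show thesis
  proof
    show C0: "C \<ge> 0" unfolding C_def using K0 C20 b by simp
    fix f G :: "'a \<Rightarrow> real" and f' :: "'a \<Rightarrow> 'a \<Rightarrow> real" and x :: 'a
    assume f: "\<And>y. y \<in> ball 0 1 \<Longrightarrow> (f has_derivative f' y) (at y)"
      and G: "continuous_on (ball 0 1) G" and bd: "\<And>y h. y \<in> ball 0 1 \<Longrightarrow> \<bar>f' y h\<bar> \<le> norm h * G y"
      and x: "x \<in> ball 0 1"
    have G0: "G y \<ge> 0" if y: "y \<in> ?B" for y
    proof -
      obtain e where "e \<in> (Basis::'a set)" using nonempty_Basis by blast
      then show ?thesis using bd[OF y, of e] by (simp add: order_trans[OF abs_ge_zero])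
    qed
    have contf: "continuous_on ?B f"
      by (rule has_derivative_continuous_on, rule has_derivative_at_withinI, rule f)
    define Gp where "Gp y = indicator ?B y * (indicator ?B y *\<^sub>R G y) powr p" for y
    define fp where "fp y = indicator ?B y * (\<bar>indicator ?B y *\<^sub>R f y\<bar>) powr p" for y
    have [measurable]: "Gp \<in> borel_measurable borel" "fp \<in> borel_measurable borel"
    proof -
      have gf: "(\<lambda>y. indicator ?B y *\<^sub>R G y) \<in> borel_measurable borel"
        "(\<lambda>y. indicator ?B y *\<^sub>R f y) \<in> borel_measurable borel"
        by (rule borel_measurable_continuous_on_indicator[OF _ G], simp)
          (rule borel_measurable_continuous_on_indicator[OF _ contf], simp)
      have [measurable]: "?B \<in> sets borel" by simp
      have "(\<lambda>y. indicator ?B y * h y powr p) \<in> borel_measurable borel"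
        "(\<lambda>y. indicator ?B y * \<bar>h y\<bar> powr p) \<in> borel_measurable borel"
        if [measurable]: "h \<in> borel_measurable borel" for h :: "'a \<Rightarrow> real"
        by measurable
      then show "Gp \<in> borel_measurable borel" "fp \<in> borel_measurable borel"
        unfolding Gp_def [abs_def] fp_def [abs_def] using gf by blast+
    qed
    have Gp: "y \<in> ?B \<Longrightarrow> Gp y = G y powr p" "Gp y \<ge> 0" and fp: "y \<in> ?B \<Longrightarrow> fp y = \<bar>f y\<bar> powr p" "fp y \<ge> 0" for y
      by (auto simp: Gp_def fp_def)
    let ?w = "\<lambda>r::real. ennreal (indicator {0<..<1} r * r powr (s * p))"
    let ?I = "\<lambda>y. \<integral>\<^sup>+r. ?w r * ennreal (Gp (x + r *\<^sub>R (y - x))) \<partial>lborel"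
    have seg: "ennreal (\<bar>f y - f x\<bar> powr p) \<le> ennreal (2 powr p * K) * ?I y" if y: "y \<in> ?B" for y
    proof -
      have in_B: "x + r *\<^sub>R (y - x) \<in> ?B" if "r \<in> {0..1}" for r
        using convex_ball[of "0::'a" 1] x y that
        by (auto simp: convex_alt algebra_simps simp del: mem_ball)
      define \<phi> where "\<phi> r = f (x + r *\<^sub>R (y - x))" for r
      define F where "F r = 2 * G (x + r *\<^sub>R (y - x))" for r
      have "norm x < 1" "norm y < 1" using x y by auto
      then have nyx: "norm (y - x) \<le> 2" using norm_triangle_ineq4[of y x] by linarith
      have "(\<phi> has_real_derivative f' (x + r *\<^sub>R (y - x)) (y - x)) (at r within {0..1})" if "r \<in> {0..1}" for r
      proof -
        have "((\<lambda>h. f ((x + r *\<^sub>R (y - x)) + h *\<^sub>R (y - x))) has_real_derivative f' (x + r *\<^sub>R (y - x)) (y - x)) (at 0)"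
          by (rule has_derivative_imp_directional[OF f[OF in_B[OF that]]])
        then have "((\<lambda>h. \<phi> (h + r)) has_real_derivative f' (x + r *\<^sub>R (y - x)) (y - x)) (at 0)"
          by (simp add: \<phi>_def algebra_simps)
        then show ?thesis
          using DERIV_shift[of \<phi> _ 0 r] has_field_derivative_at_within by fastforce
      qed
      moreover have "continuous_on {0..1} F"
        unfolding F_def
        by (intro continuous_intros continuous_on_compose2[OF G]) (use in_B in auto)
      moreover have "\<bar>f' (x + r *\<^sub>R (y - x)) (y - x)\<bar> \<le> F r" if "r \<in> {0..1}" for r
        using bd[OF in_B[OF that], of "y - x"] mult_right_mono[OF nyx G0[OF in_B[OF that]]]
        unfolding F_def by linarith
      ultimately have "ennreal (\<bar>\<phi> 1 - \<phi> 0\<bar> powr p) \<le> ennreal K * (\<integral>\<^sup>+r. ?w r * ennreal (F r powr p) \<partial>lborel)"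
        unfolding K_def by (rule segment_estimate[OF p1 s(1,2)])
      also have "(\<integral>\<^sup>+r. ?w r * ennreal (F r powr p) \<partial>lborel)
        = (\<integral>\<^sup>+r. ennreal (2 powr p) * (?w r * ennreal (Gp (x + r *\<^sub>R (y - x)))) \<partial>lborel)"
      proof (rule nn_integral_cong)
        fix r :: real
        show "?w r * ennreal (F r powr p) = ennreal (2 powr p) * (?w r * ennreal (Gp (x + r *\<^sub>R (y - x))))"
        proof (cases "r \<in> {0<..<1}")
          case True
          then have "F r powr p = 2 powr p * Gp (x + r *\<^sub>R (y - x))"
            using in_B[of r] G0[of "x + r *\<^sub>R (y - x)"] Gp(1)[of "x + r *\<^sub>R (y - x)"]
            by (simp add: F_def powr_mult)
          then show ?thesis using Gp(2) by (simp add: ennreal_mult mult_ac)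
        qed auto
      qed
      also have "\<dots> = ennreal (2 powr p) * ?I y"
        by (rule nn_integral_cmult) measurable
      finally show ?thesis using K0 by (simp add: \<phi>_def ennreal_mult mult_ac)
    qed
    have pt: "ennreal (\<bar>f x\<bar> powr p) \<le> ennreal (2 powr p) * ennreal (fp y) + ennreal (2 powr p * (2 powr p * K)) * ?I y"
      if y: "y \<in> ?B" for y
    proof -
      have "\<bar>f x\<bar> powr p \<le> 2 powr p * (\<bar>f y\<bar> powr p + \<bar>f y - f x\<bar> powr p)"
        using abs_add_powr_le[of p "f y" "f x - f y"] p1 by (simp add: abs_minus_commute)
      then have "ennreal (\<bar>f x\<bar> powr p) \<le> ennreal (2 powr p * (\<bar>f y\<bar> powr p + \<bar>f y - f x\<bar> powr p))"
        by (rule ennreal_leI)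
      also have "\<dots> = ennreal (2 powr p) * ennreal (fp y) + ennreal (2 powr p) * ennreal (\<bar>f y - f x\<bar> powr p)"
        using y fp by (simp add: ennreal_mult ennreal_plus distrib_left)
      also have "\<dots> \<le> ennreal (2 powr p) * ennreal (fp y) + ennreal (2 powr p) * (ennreal (2 powr p * K) * ?I y)"
        by (intro add_left_mono mult_left_mono seg y) auto
      finally show ?thesis using K0 by (simp add: ennreal_mult mult.assoc)
    qed
    have mI: "?I \<in> borel_measurable borel" by measurable
    have "ennreal (\<bar>f x\<bar> powr p) * ennreal b = (\<integral>\<^sup>+y. ennreal (\<bar>f x\<bar> powr p) * indicator ?B y \<partial>lborel)"
      by (simp add: nn_integral_cmult_indicator eb)
    also have "\<dots> \<le> (\<integral>\<^sup>+y. ennreal (2 powr p) * ennreal (fp y) + ennreal (2 powr p * (2 powr p * K)) * ?I y \<partial>lborel)"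
      using pt by (intro nn_integral_mono) (auto simp: indicator_def)
    also have "\<dots> = ennreal (2 powr p) * (\<integral>\<^sup>+y. ennreal (fp y) \<partial>lborel)
        + ennreal (2 powr p * (2 powr p * K)) * (\<integral>\<^sup>+y. ?I y \<partial>lborel)"
      using mI by (simp add: nn_integral_add nn_integral_cmult)
    also have "(\<integral>\<^sup>+y. ?I y \<partial>lborel) = (\<integral>\<^sup>+r. (\<integral>\<^sup>+y. ?w r * ennreal (Gp (x + r *\<^sub>R (y - x))) \<partial>lborel) \<partial>lborel)"
      by (rule lborel_pair.Fubini') measurable
    also have "\<dots> = (\<integral>\<^sup>+r. ennreal (indicator {0<..<1} r * r powr (s * p - ?d)) * (\<integral>\<^sup>+y. ennreal (Gp y) \<partial>lborel) \<partial>lborel)"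
    proof (rule nn_integral_cong)
      fix r :: real
      show "(\<integral>\<^sup>+y. ?w r * ennreal (Gp (x + r *\<^sub>R (y - x))) \<partial>lborel)
        = ennreal (indicator {0<..<1} r * r powr (s * p - ?d)) * (\<integral>\<^sup>+y. ennreal (Gp y) \<partial>lborel)"
      proof (cases "r \<in> {0<..<1}")
        case True
        have "(\<integral>\<^sup>+y. ?w r * ennreal (Gp (x + r *\<^sub>R (y - x))) \<partial>lborel)
          = ?w r * (\<integral>\<^sup>+y. ennreal (Gp ((x - r *\<^sub>R x) + r *\<^sub>R y)) \<partial>lborel)"
          by (subst nn_integral_cmult) (auto simp: algebra_simps)
        also have "\<dots> = ?w r * (ennreal (r powr (- ?d)) * (\<integral>\<^sup>+y. ennreal (Gp y) \<partial>lborel))"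
          using True by (subst nn_integral_lborel_affine[where f="\<lambda>y. ennreal (Gp y)"]) auto
        also have "\<dots> = ennreal (r powr (s * p) * r powr (- ?d)) * (\<integral>\<^sup>+y. ennreal (Gp y) \<partial>lborel)"
          using True by (simp add: ennreal_mult mult.assoc)
        also have "r powr (s * p) * r powr (- ?d) = r powr (s * p - ?d)"
          by (simp add: powr_add[symmetric])
        finally show ?thesis using True by simp
      qed auto
    qed
    also have "\<dots> = (\<integral>\<^sup>+r. ennreal (indicator {0<..<1} r * r powr (s * p - ?d)) \<partial>lborel) * (\<integral>\<^sup>+y. ennreal (Gp y) \<partial>lborel)"
      by (rule nn_integral_multc) measurable
    also have "(\<integral>\<^sup>+r. ennreal (indicator {0<..<1} r * r powr (s * p - ?d)) \<partial>lborel) = ennreal C2"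
      using has_bochner_integral_powr_0[OF s(3), of 1] unfolding C2_def
      by (subst nn_integral_eq_integral) (auto simp: has_bochner_integral_iff)
    also have "ennreal (2 powr p) * (\<integral>\<^sup>+y. ennreal (fp y) \<partial>lborel) +
        ennreal (2 powr p * (2 powr p * K)) * (ennreal C2 * (\<integral>\<^sup>+y. ennreal (Gp y) \<partial>lborel))
      \<le> ennreal (C * b) * (\<integral>\<^sup>+y. ennreal (fp y) \<partial>lborel) + ennreal (C * b) * (\<integral>\<^sup>+y. ennreal (Gp y) \<partial>lborel)"
    proof (rule add_mono)
      show "ennreal (2 powr p) * (\<integral>\<^sup>+y. ennreal (fp y) \<partial>lborel) \<le> ennreal (C * b) * (\<integral>\<^sup>+y. ennreal (fp y) \<partial>lborel)"
        using K0 C20 b by (intro mult_right_mono ennreal_leI) (auto simp: C_def)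
      have "ennreal (2 powr p * (2 powr p * K)) * (ennreal C2 * (\<integral>\<^sup>+y. ennreal (Gp y) \<partial>lborel))
          = ennreal (2 powr p * (2 powr p * K * C2)) * (\<integral>\<^sup>+y. ennreal (Gp y) \<partial>lborel)"
        using K0 C20 by (simp add: ennreal_mult mult_ac)
      also have "\<dots> \<le> ennreal (C * b) * (\<integral>\<^sup>+y. ennreal (Gp y) \<partial>lborel)"
        using K0 C20 b by (intro mult_right_mono ennreal_leI) (auto simp: C_def)
      finally show "ennreal (2 powr p * (2 powr p * K)) * (ennreal C2 * (\<integral>\<^sup>+y. ennreal (Gp y) \<partial>lborel))
        \<le> ennreal (C * b) * (\<integral>\<^sup>+y. ennreal (Gp y) \<partial>lborel)" .
    qed
    also have "\<dots> = ennreal (C * b) * (\<integral>\<^sup>+y. ennreal (fp y) + ennreal (Gp y) \<partial>lborel)"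
      by (simp add: nn_integral_add distrib_left)
    also have "(\<integral>\<^sup>+y. ennreal (fp y) + ennreal (Gp y) \<partial>lborel)
      = (\<integral>\<^sup>+y. ennreal (indicator ?B y * (\<bar>f y\<bar> powr p + G y powr p)) \<partial>lborel)"
      by (intro nn_integral_cong) (auto simp: fp_def Gp_def indicator_def ennreal_plus)
    finally have "ennreal (1 / b) * (ennreal (\<bar>f x\<bar> powr p) * ennreal b)
      \<le> ennreal (1 / b) * (ennreal (C * b) * (\<integral>\<^sup>+y. ennreal (indicator ?B y * (\<bar>f y\<bar> powr p + G y powr p)) \<partial>lborel))"
      by (rule mult_left_mono) simp
    moreover have "ennreal (1 / b) * (ennreal (\<bar>f x\<bar> powr p) * ennreal b) = ennreal (\<bar>f x\<bar> powr p)"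
      using b by (simp add: ennreal_mult[symmetric])
    moreover have "ennreal (1 / b) * ennreal (C * b) = ennreal C"
      using b C0 by (simp add: ennreal_mult[symmetric])
    ultimately show "ennreal (\<bar>f x\<bar> powr p)
       \<le> ennreal C * (\<integral>\<^sup>+y. ennreal (indicator ?B y * (\<bar>f y\<bar> powr p + G y powr p)) \<partial>lborel)"
      by (simp add: mult.assoc[symmetric])
  qed
qed

section \<open>Convolution with fractional kernels\<close>

text \<open>
  Both sides are double integrals that differ by the translation of \<open>z\<close> by \<open>r *\<^sub>R e\<close>. With \<open>e\<close> the
  time direction this moves a fractional integral from one factor of a product to its adjoint on the
  other factor, and Fubini's theorem is needed for two variables only.
\<close>

lemma
  fixes g \<eta> :: "'a::euclidean_space \<Rightarrow> real" and k :: "real \<Rightarrow> real"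
  assumes k: "integrable lborel k" and g: "integrable lborel g"
    and \<eta>: "\<eta> \<in> borel_measurable borel" "\<And>z. \<bar>\<eta> z\<bar> \<le> M"
  shows convolution_duality: "(\<integral>z. (\<integral>r. k r * g (z - r *\<^sub>R e) \<partial>lborel) * \<eta> z \<partial>lborel)
      = (\<integral>z. g z * (\<integral>r. k r * \<eta> (z + r *\<^sub>R e) \<partial>lborel) \<partial>lborel)"
    and integrable_convolution_mult: "integrable lborel (\<lambda>z. (\<integral>r. k r * g (z - r *\<^sub>R e) \<partial>lborel) * \<eta> z)"
proof -
  have [measurable]: "k \<in> borel_measurable borel" "g \<in> borel_measurable borel" "\<eta> \<in> borel_measurable borel"
    using k g \<eta> by auto
  define H where "H r z = k r * (g z * \<eta> (z + r *\<^sub>R e))" for r z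
  define H2 where "H2 r z = k r * (g (z - r *\<^sub>R e) * \<eta> z)" for r z
  have [measurable]: "case_prod H \<in> borel_measurable (lborel \<Otimes>\<^sub>M lborel)"
    "case_prod H2 \<in> borel_measurable (lborel \<Otimes>\<^sub>M lborel)"
    unfolding H_def [abs_def] H2_def [abs_def] by measurable
  have M: "M \<ge> 0" using \<eta>(2)[of 0] by linarith
  have shift: "(\<integral>z. f (z + t) \<partial>lborel) = (\<integral>z. f z \<partial>lborel)"
    if "f \<in> borel_measurable borel" for f :: "'a \<Rightarrow> real" and t
    using lborel_integral_translate[OF that, of t] by (simp add: add.commute)
  have H2_shift: "H2 r (z + r *\<^sub>R e) = H r z" for r z by (simp add: H_def H2_def)
  have [measurable]: "H2 r \<in> borel_measurable borel" "H r \<in> borel_measurable borel" for r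
    unfolding H_def [abs_def] H2_def [abs_def] by measurable
  have eq: "(\<integral>z. H2 r z \<partial>lborel) = (\<integral>z. H r z \<partial>lborel)" for r
    using shift[of "H2 r" "r *\<^sub>R e"] unfolding H2_shift by simp
  have eqn: "(\<integral>z. norm (H2 r z) \<partial>lborel) = (\<integral>z. norm (H r z) \<partial>lborel)" for r
    using shift[of "\<lambda>z. norm (H2 r z)" "r *\<^sub>R e"] unfolding H2_shift by simp
  have Hb: "norm (H r z) \<le> \<bar>k r\<bar> * (M * \<bar>g z\<bar>)" for r z
  proof -
    have "\<bar>g z\<bar> * \<bar>\<eta> (z + r *\<^sub>R e)\<bar> \<le> \<bar>g z\<bar> * M" using \<eta>(2) by (intro mult_left_mono) auto
    then have "\<bar>k r\<bar> * (\<bar>g z\<bar> * \<bar>\<eta> (z + r *\<^sub>R e)\<bar>) \<le> \<bar>k r\<bar> * (\<bar>g z\<bar> * M)" by (rule mult_left_mono) simp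
    then show ?thesis by (simp only: H_def abs_mult real_norm_def mult.commute[of M])
  qed
  have iH: "integrable lborel (\<lambda>z. H r z)" for r
  proof (rule Bochner_Integration.integrable_bound)
    show "integrable lborel (\<lambda>z. \<bar>k r\<bar> * (M * \<bar>g z\<bar>))" using g by auto
    show "AE z in lborel. norm (H r z) \<le> norm (\<bar>k r\<bar> * (M * \<bar>g z\<bar>))"
      by (intro AE_I2 order_trans[OF Hb]) simp
  qed (simp add: H_def)
  have iH2: "integrable lborel (\<lambda>z. H2 r z)" for r
  proof -
    have "integrable (distr lborel borel ((+) (- (r *\<^sub>R e)))) (H r)" using iH by (simp add: lborel_distr_plus)
    then show ?thesis
      by (subst (asm) integrable_distr_eq) (auto simp: H_def H2_def)
  qed
  have bound: "integrable lborel (\<lambda>r. \<integral>z. norm (H r z) \<partial>lborel)"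
  proof (rule Bochner_Integration.integrable_bound)
    show "integrable lborel (\<lambda>r. \<bar>k r\<bar> * (M * (\<integral>z. \<bar>g z\<bar> \<partial>lborel)))" using k by auto
    show "AE r in lborel. norm (\<integral>z. norm (H r z) \<partial>lborel) \<le> norm (\<bar>k r\<bar> * (M * (\<integral>z. \<bar>g z\<bar> \<partial>lborel)))"
    proof (rule AE_I2)
      fix r
      have "norm (\<integral>z. norm (H r z) \<partial>lborel) = (\<integral>z. norm (H r z) \<partial>lborel)" by simp
      also have "\<dots> \<le> (\<integral>z. \<bar>k r\<bar> * (M * \<bar>g z\<bar>) \<partial>lborel)"
        using g iH Hb by (intro integral_mono integrable_norm) auto
      also have "\<dots> = \<bar>k r\<bar> * (M * (\<integral>z. \<bar>g z\<bar> \<partial>lborel))" by simp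
      finally show "norm (\<integral>z. norm (H r z) \<partial>lborel) \<le> norm (\<bar>k r\<bar> * (M * (\<integral>z. \<bar>g z\<bar> \<partial>lborel)))" by simp
    qed
  qed measurable
  have pH: "integrable (lborel \<Otimes>\<^sub>M lborel) (case_prod H)"
    by (rule lborel_pair.Fubini_integrable) (use bound iH in auto)
  have pH2: "integrable (lborel \<Otimes>\<^sub>M lborel) (case_prod H2)"
    by (rule lborel_pair.Fubini_integrable) (use bound iH2 eqn in auto)
  have a: "(\<integral>r. H2 r z \<partial>lborel) = (\<integral>r. k r * g (z - r *\<^sub>R e) \<partial>lborel) * \<eta> z" for z
    unfolding H2_def by (subst integral_mult_left_zero[symmetric]) (simp add: mult.assoc)
  have b: "(\<integral>r. H r z \<partial>lborel) = g z * (\<integral>r. k r * \<eta> (z + r *\<^sub>R e) \<partial>lborel)" for z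
    unfolding H_def by (subst integral_mult_right_zero[symmetric]) (simp add: mult_ac)
  have "(\<integral>z. (\<integral>r. H2 r z \<partial>lborel) \<partial>lborel) = (\<integral>z. (\<integral>r. H r z \<partial>lborel) \<partial>lborel)"
    using lborel_pair.Fubini_integral[OF pH] lborel_pair.Fubini_integral[OF pH2] eq by simp
  then show "(\<integral>z. (\<integral>r. k r * g (z - r *\<^sub>R e) \<partial>lborel) * \<eta> z \<partial>lborel)
      = (\<integral>z. g z * (\<integral>r. k r * \<eta> (z + r *\<^sub>R e) \<partial>lborel) \<partial>lborel)"
    unfolding a b .
  show "integrable lborel (\<lambda>z. (\<integral>r. k r * g (z - r *\<^sub>R e) \<partial>lborel) * \<eta> z)"
    using lborel_pair.integrable_snd[OF pH2] unfolding a .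
qed

text \<open>
  The Riemann-Liouville kernel is cut off at \<open>T\<close> to make it integrable on the line. On functions that
  vanish for negative time the cut-off does not change the convolution at times below \<open>T\<close>.
\<close>

definition frac_kernel :: "real \<Rightarrow> real \<Rightarrow> real \<Rightarrow> real" where
  "frac_kernel \<beta> T r = indicator {0<..<T} r * r powr (\<beta> - 1) / Gamma \<beta>"

lemma frac_kernel_measurable [measurable]: "frac_kernel \<beta> T \<in> borel_measurable borel"
  unfolding frac_kernel_def by measurable

lemma integrable_frac_kernel: "\<beta> > 0 \<Longrightarrow> T \<ge> 0 \<Longrightarrow> integrable lborel (frac_kernel \<beta> T)"
  using has_bochner_integral_powr_0[of "\<beta> - 1" T]
  unfolding frac_kernel_def [abs_def] by (auto simp: has_bochner_integral_iff)

text \<open>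
  The semigroup law: fractional integrals of orders \<open>\<alpha>\<close> and \<open>1 - \<alpha>\<close> compose to the plain integral.
  Scaling to the unit interval leaves Euler's Beta integral, and the Gamma factors cancel.
\<close>

lemma frac_kernel_convolution:
  assumes \<alpha>: "0 < \<alpha>" "\<alpha> < 1" and w: "0 < w" "w < T"
  shows "(\<integral>r. frac_kernel \<alpha> T r * frac_kernel (1 - \<alpha>) T (w - r) \<partial>lborel) = 1"
proof -
  define B where "B v = indicator {0<..<1} v * (v powr (\<alpha> - 1) * (1 - v) powr ((1 - \<alpha>) - 1))" for v :: real
  have "((\<lambda>v. if v \<in> {0..1} then v powr (\<alpha> - 1) * (1 - v) powr ((1 - \<alpha>) - 1) else 0) has_integral Beta \<alpha> (1 - \<alpha>)) UNIV"
    using has_integral_Beta_real[of \<alpha> "1 - \<alpha>"] \<alpha> by (simp only: has_integral_restrict_UNIV)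
  then have "(B has_integral Beta \<alpha> (1 - \<alpha>)) UNIV"
    by (rule has_integral_spike_finite[where S="{0, 1}", rotated 2]) (auto simp: indicator_def B_def)
  moreover have Bm: "B \<in> borel_measurable borel" unfolding B_def [abs_def] by measurable
  moreover have B0: "B v \<ge> 0" for v by (simp add: B_def)
  ultimately have "(\<integral>\<^sup>+v. ennreal (B v) \<partial>lborel) = ennreal (Beta \<alpha> (1 - \<alpha>))"
    by (intro nn_integral_has_integral_lborel)
  then have B: "(\<integral>v. B v \<partial>lborel) = Beta \<alpha> (1 - \<alpha>)"
    using \<alpha> by (intro has_bochner_integral_integral_eq has_bochner_integral_nn_integral)
      (use Bm B0 in \<open>auto simp: Beta_def intro!: Gamma_real_pos less_imp_le\<close>)
  have G: "Gamma \<alpha> > 0" "Gamma (1 - \<alpha>) > 0" using \<alpha> by (auto intro: Gamma_real_pos)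
  have "frac_kernel \<alpha> T (0 + w * v) * frac_kernel (1 - \<alpha>) T (w - (0 + w * v))
     = (1 / w) * (B v / (Gamma \<alpha> * Gamma (1 - \<alpha>)))" for v
  proof (cases "v \<in> {0<..<1}")
    case True
    then have v: "0 < v" "v < 1" by auto
    have wv: "0 < w * v" "w * v < w" "w - w * v = w * (1 - v)" using v w by (auto simp: algebra_simps)
    then have "w * v < T" "0 < w * (1 - v)" "w * (1 - v) < T" using w by linarith+
    moreover have "(w * v) powr (\<alpha> - 1) * (w * (1 - v)) powr (1 - \<alpha> - 1)
       = w powr (\<alpha> - 1) * w powr (1 - \<alpha> - 1) * (v powr (\<alpha> - 1) * (1 - v) powr ((1 - \<alpha>) - 1))"
      using v w by (simp add: powr_mult)
    moreover have "w powr (\<alpha> - 1) * w powr (1 - \<alpha> - 1) = 1 / w"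
    proof -
      have "w powr (\<alpha> - 1) * w powr (1 - \<alpha> - 1) = w powr ((\<alpha> - 1) + (1 - \<alpha> - 1))" by (simp only: powr_add)
      also have "(\<alpha> - 1) + (1 - \<alpha> - 1) = - 1" by simp
      finally show ?thesis using w by (simp add: powr_minus_divide)
    qed
    ultimately show ?thesis using wv True
      by (simp add: frac_kernel_def B_def)
  next
    case False
    then have "v \<le> 0 \<or> v \<ge> 1" by auto
    then have "w * v \<le> 0 \<or> w - w * v \<le> 0" using w by (auto simp: mult_le_0_iff)
    then have "frac_kernel \<alpha> T (0 + w * v) * frac_kernel (1 - \<alpha>) T (w - (0 + w * v)) = 0"
      by (auto simp: frac_kernel_def indicator_def)
    moreover have "B v = 0" using False by (simp add: B_def)
    ultimately show ?thesis by simp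
  qed
  then have "(\<integral>r. frac_kernel \<alpha> T r * frac_kernel (1 - \<alpha>) T (w - r) \<partial>lborel)
     = w * ((1 / w) * ((\<integral>v. B v \<partial>lborel) / (Gamma \<alpha> * Gamma (1 - \<alpha>))))"
    using w by (subst lborel_integral_real_affine[where c=w and t=0]) simp_all
  also have "\<dots> = 1"
    using w G unfolding B Beta_def by simp
  finally show ?thesis .
qed

text \<open>
  Integrated backwards from \<open>T\<close>, the orders \<open>\<alpha>\<close> and \<open>1 - \<alpha>\<close> together undo one derivative, up to the sign. Hence the
  backward integral of order \<open>\<alpha>\<close> of \<open>a\<close> solves the equation adjoint to the fractional derivative.
\<close>

lemma frac_kernel_twice_derivative:
  fixes a a' :: "real \<Rightarrow> real"
  assumes \<alpha>: "0 < \<alpha>" "\<alpha> < 1"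
    and a: "\<And>t. (a has_real_derivative a' t) (at t)" "continuous_on UNIV a'" "\<And>t. \<bar>a' t\<bar> \<le> M"
    and supp: "\<And>t. t \<ge> T \<Longrightarrow> a t = 0" "\<And>t. t \<ge> T \<Longrightarrow> a' t = 0" and s: "0 < s" "s < T"
  shows "(\<integral>r. frac_kernel (1 - \<alpha>) T r * (\<integral>q. frac_kernel \<alpha> T q * a' (s + r + q) \<partial>lborel) \<partial>lborel) = - a s"
proof -
  have [measurable]: "a' \<in> borel_measurable borel" using a(2) by (rule borel_measurable_continuous_onI)
  have T: "T \<ge> 0" using s by simp
  have "(\<integral>r. frac_kernel (1 - \<alpha>) T r * (\<integral>q. frac_kernel \<alpha> T q * a' (s + r + q) \<partial>lborel) \<partial>lborel)
    = (\<integral>w. (\<integral>r. frac_kernel \<alpha> T r * frac_kernel (1 - \<alpha>) T (w - r) \<partial>lborel) * a' (s + w) \<partial>lborel)"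
    using convolution_duality[of "frac_kernel \<alpha> T" "frac_kernel (1 - \<alpha>) T" "\<lambda>w. a' (s + w)" M 1]
      integrable_frac_kernel[of \<alpha> T] integrable_frac_kernel[of "1 - \<alpha>" T] \<alpha> T a(3)
    by (simp add: add.assoc)
  also have "\<dots> = (\<integral>w. indicator {0..T} w *\<^sub>R a' (s + w) \<partial>lborel)"
  proof (rule integral_cong_AE)
    have "AE w in lborel. w \<noteq> (0::real)" by (rule AE_lborel_singleton)
    then show "AE w in lborel. (\<integral>r. frac_kernel \<alpha> T r * frac_kernel (1 - \<alpha>) T (w - r) \<partial>lborel) * a' (s + w)
        = indicator {0..T} w *\<^sub>R a' (s + w)"
    proof eventually_elim
      case (elim w)
      consider "w < 0" | "0 < w \<and> w < T" | "w \<ge> T" using elim by linarith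
      then show ?case
      proof cases
        case 1
        then have "frac_kernel \<alpha> T r * frac_kernel (1 - \<alpha>) T (w - r) = 0" for r
          by (auto simp: frac_kernel_def indicator_def)
        then have "(\<integral>r. frac_kernel \<alpha> T r * frac_kernel (1 - \<alpha>) T (w - r) \<partial>lborel) = 0"
          by (simp only: Bochner_Integration.integral_zero)
        then show ?thesis using 1 by simp
      next
        case 2
        then show ?thesis using frac_kernel_convolution[OF \<alpha>, of w T] by simp
      next
        case 3
        then show ?thesis using supp(2)[of "s + w"] s by simp
      qed
    qed
  qed measurable
  also have "\<dots> = a (s + T) - a (s + 0)"
  proof (rule has_bochner_integral_integral_eq, rule has_bochner_integral_FTC_Icc)
    show "((\<lambda>w. a (s + w)) has_vector_derivative a' (s + x)) (at x within {0..T})" for x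
    proof -
      have "((\<lambda>w. a (s + w)) has_real_derivative a' (s + x)) (at x)"
        using DERIV_shift[of a "a' (s + x)" x s] a(1) by (simp add: add.commute)
      then show ?thesis
        unfolding has_real_derivative_iff_has_vector_derivative by (rule has_vector_derivative_at_within)
    qed
    show "continuous_on {0..T} (\<lambda>w. a' (s + w))"
      by (intro continuous_on_compose2[OF a(2)] continuous_intros) auto
  qed (rule T)
  also have "\<dots> = - a s" using supp(1)[of "s + T"] s by simp
  finally show ?thesis .
qed

lemma frac_kernel_average_has_derivative:
  fixes a a' :: "real \<Rightarrow> real"
  assumes k: "integrable lborel k"
    and a: "\<And>t. (a has_real_derivative a' t) (at t)" "\<And>t. \<bar>a t\<bar> \<le> M" "\<And>t. \<bar>a' t\<bar> \<le> M'"
  shows "((\<lambda>t. \<integral>r. k r * a (t + r) \<partial>lborel) has_real_derivative (\<integral>r. k r * a' (t + r) \<partial>lborel)) (at t)"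
  unfolding has_field_derivative_iff tendsto_at_iff_sequentially
proof (intro allI impI)
  fix h :: "nat \<Rightarrow> real" assume h: "\<forall>i. h i \<in> UNIV - {t}" "h \<longlonglongrightarrow> t"
  have [measurable]: "a \<in> borel_measurable borel" "k \<in> borel_measurable borel"
    using a(1) DERIV_continuous_on[of UNIV a a'] k by (auto intro: borel_measurable_continuous_onI)
  have i: "integrable lborel (\<lambda>r. k r * a (y + r))" for y
  proof (rule Bochner_Integration.integrable_bound)
    show "integrable lborel (\<lambda>r. k r * M)" using k by auto
    have "\<bar>a y\<bar> \<le> \<bar>M\<bar>" for y using a(2)[of y] by linarith
    then show "AE r in lborel. norm (k r * a (y + r)) \<le> norm (k r * M)"
      by (intro AE_I2) (simp add: abs_mult mult_left_mono)
  qed measurable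
  have q: "\<bar>(a (h n + r) - a (t + r)) / (h n - t)\<bar> \<le> M'" for n r
  proof -
    have "\<bar>a x - a y\<bar> \<le> M' * \<bar>x - y\<bar>" for x y
      using field_differentiable_bound[of UNIV a a' M' x y] a by auto
    from this[of "h n + r" "t + r"] h(1) show ?thesis
      by (simp add: divide_le_eq)
  qed
  have "(\<lambda>n. \<integral>r. k r * ((a (h n + r) - a (t + r)) / (h n - t)) \<partial>lborel) \<longlonglongrightarrow> (\<integral>r. k r * a' (t + r) \<partial>lborel)"
  proof (rule integral_dominated_convergence[where w="\<lambda>r. \<bar>k r\<bar> * M'"])
    have lim: "(\<lambda>n. (a (h n + r) - a (t + r)) / (h n - t)) \<longlonglongrightarrow> a' (t + r)" for r
    proof -
      have "((\<lambda>y. (a y - a (t + r)) / (y - (t + r))) \<longlongrightarrow> a' (t + r)) (at (t + r))"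
        using a(1)[of "t + r"] by (simp add: has_field_derivative_iff)
      moreover have "filterlim (\<lambda>n. h n + r) (at (t + r)) sequentially"
        using h by (auto simp: filterlim_at intro!: tendsto_intros)
      ultimately have "(\<lambda>n. (a (h n + r) - a (t + r)) / (h n + r - (t + r))) \<longlonglongrightarrow> a' (t + r)"
        by (rule filterlim_compose)
      then show ?thesis by simp
    qed
    then show "AE r in lborel. (\<lambda>n. k r * ((a (h n + r) - a (t + r)) / (h n - t))) \<longlonglongrightarrow> k r * a' (t + r)"
      by (intro AE_I2 tendsto_intros)
    have "(\<lambda>r. a' (t + r)) \<in> borel_measurable borel"
      by (rule borel_measurable_LIMSEQ_real[OF lim]) measurable
    then show "(\<lambda>r. k r * a' (t + r)) \<in> borel_measurable lborel" by measurable
    show "integrable lborel (\<lambda>r. \<bar>k r\<bar> * M')" using k by auto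
    show "AE r in lborel. norm (k r * ((a (h n + r) - a (t + r)) / (h n - t))) \<le> \<bar>k r\<bar> * M'" for n
      unfolding real_norm_def abs_mult [of "k _"] by (intro AE_I2 mult_left_mono q) simp
  qed measurable
  moreover have "(\<integral>r. k r * ((a (h n + r) - a (t + r)) / (h n - t)) \<partial>lborel)
     = ((\<integral>r. k r * a (h n + r) \<partial>lborel) - (\<integral>r. k r * a (t + r) \<partial>lborel)) / (h n - t)" for n
  proof -
    have "k r * ((a (h n + r) - a (t + r)) / (h n - t)) = (k r * a (h n + r) - k r * a (t + r)) / (h n - t)" for r
      by (simp add: right_diff_distrib)
    then show ?thesis
      using Bochner_Integration.integral_diff[OF i[of "h n"] i[of t]]
      by (simp only: integral_divide_zero)
  qed
  ultimately show "((\<lambda>y. ((\<integral>r. k r * a (y + r) \<partial>lborel) - (\<integral>r. k r * a (t + r) \<partial>lborel)) / (y - t)) \<circ> h)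
     \<longlonglongrightarrow> (\<integral>r. k r * a' (t + r) \<partial>lborel)"
    by (simp only: o_def)
qed

section \<open>Representation by the fractional derivative\<close>

lemma AE_lborel_Pair_swap:
  fixes P :: "real \<times> 'b::euclidean_space \<Rightarrow> bool"
  assumes "AE z in lborel. P z"
  shows "AE x in lborel. AE t in lborel. P (t, x)"
proof -
  obtain N where N: "N \<in> null_sets lborel" "{z \<in> space lborel. \<not> P z} \<subseteq> N"
    using assms by (auto simp: eventually_ae_filter)
  have "N \<in> sets (lborel \<Otimes>\<^sub>M lborel)" using N(1) unfolding lborel_prod by (rule null_setsD2)
  then have "space (lborel \<Otimes>\<^sub>M lborel) - N \<in> sets (lborel \<Otimes>\<^sub>M lborel)" by (rule sets.compl_sets)
  moreover have "{z \<in> space (lborel \<Otimes>\<^sub>M lborel). (fst z, snd z) \<notin> N} = space (lborel \<Otimes>\<^sub>M lborel) - N"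
    by auto
  ultimately have m: "{z \<in> space (lborel \<Otimes>\<^sub>M lborel). (fst z, snd z) \<notin> N} \<in> sets (lborel \<Otimes>\<^sub>M lborel)"
    by simp
  have "AE z in lborel \<Otimes>\<^sub>M lborel. z \<notin> N"
    using N(1) by (intro AE_not_in) (simp add: lborel_prod)
  then have "AE t in lborel. AE x in lborel. (t, x) \<notin> N"
    by (rule lborel_pair.AE_pair)
  then have "AE x in lborel. AE t in lborel. (t, x) \<notin> N"
    using lborel_pair.AE_commute[OF m] by simp
  then show ?thesis
    using N(2) by (auto elim!: eventually_mono)
qed

lemma AE_lborel_snd:
  fixes P :: "'b::euclidean_space \<Rightarrow> bool"
  assumes "AE x in lborel. P x"
  shows "AE z in (lborel :: (real \<times> 'b) measure). P (snd z)"
proof -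
  obtain N where N: "N \<in> null_sets lborel" "{x \<in> space lborel. \<not> P x} \<subseteq> N"
    using assms by (auto simp: eventually_ae_filter)
  have [measurable]: "N \<in> sets borel" using N by auto
  have "{z \<in> space ((lborel :: real measure) \<Otimes>\<^sub>M lborel). snd z \<notin> N} \<in> sets (lborel \<Otimes>\<^sub>M lborel)"
    by measurable
  then have "AE z in (lborel :: real measure) \<Otimes>\<^sub>M lborel. snd z \<notin> N"
    by (rule lborel_pair.AE_pair_measure) (use AE_not_in[OF N(1)] in auto)
  then show ?thesis
    unfolding lborel_prod using N(2) by (auto elim!: eventually_mono)
qed

lemma AE_lborel_fst:
  fixes P :: "real \<Rightarrow> bool"
  assumes "AE x in lborel. P x"
  shows "AE z in (lborel :: (real \<times> 'b::euclidean_space) measure). P (fst z)"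
proof -
  obtain N where N: "N \<in> null_sets lborel" "{x \<in> space lborel. \<not> P x} \<subseteq> N"
    using assms by (auto simp: eventually_ae_filter)
  have [measurable]: "N \<in> sets borel" using N by auto
  have "{z \<in> space (lborel \<Otimes>\<^sub>M (lborel :: 'b measure)). fst z \<notin> N} \<in> sets (lborel \<Otimes>\<^sub>M lborel)"
    by measurable
  then have "AE z in lborel \<Otimes>\<^sub>M (lborel :: 'b measure). fst z \<notin> N"
    by (rule lborel_pair.AE_pair_measure) (use AE_not_in[OF N(1)] in auto)
  then show ?thesis
    unfolding lborel_prod using N(2) by (auto elim!: eventually_mono)
qed

lemma bump_Pair: "bump k c d z = bump k (fst c) (fst d) (fst z) * bump k (snd c) (snd d) (snd z)"
proof -
  let ?f = "\<lambda>b. flat 1 (k * (z \<bullet> b - c \<bullet> b)) * flat 1 (k * (d \<bullet> b - z \<bullet> b))"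
  have "bump k c d z = prod ?f ((\<lambda>u. (u, 0)) ` Basis) * prod ?f ((\<lambda>v. (0, v)) ` Basis)"
    unfolding bump_def Basis_prod_def by (rule prod.union_disjoint) auto
  also have "prod ?f ((\<lambda>u. (u, 0)) ` Basis) = bump k (fst c) (fst d) (fst z)"
    unfolding bump_def by (subst prod.reindex) (auto simp: inj_on_def inner_prod_def)
  also have "prod ?f ((\<lambda>v. (0, v)) ` Basis) = bump k (snd c) (snd d) (snd z)"
    unfolding bump_def by (subst prod.reindex) (auto simp: inj_on_def inner_prod_def)
  finally show ?thesis .
qed

lemma Cinf_real_iterated_deriv:
  fixes f :: "real \<Rightarrow> real"
  assumes "f \<in> Cinf UNIV"
  shows "(deriv ^^ n) f \<in> Cinf UNIV"
  by (induction n) (auto intro: assms Cinf_real_deriv)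

lemma iterated_deriv_eq_0:
  fixes f :: "real \<Rightarrow> real"
  assumes "\<And>t. t \<notin> {c..d} \<Longrightarrow> f t = 0" "t \<notin> {c..d}"
  shows "(deriv ^^ n) f t = 0"
  using assms(2)
proof (induction n arbitrary: t)
  case (Suc n)
  have "eventually (\<lambda>x. x \<in> - {c..d}) (nhds t)"
    using Suc.prems by (intro eventually_nhds_in_open) auto
  then have "\<forall>\<^sub>F x in nhds t. (deriv ^^ n) f x = 0"
    by eventually_elim (use Suc.IH in auto)
  then have "deriv ((deriv ^^ n) f) t = deriv (\<lambda>_. 0) t"
    by (intro deriv_cong_ev) auto
  then show ?case by simp
qed (use assms(1) in simp)

text \<open>
  Changing \<open>u\<close> on a null set changes, for almost every \<open>x\<close>, the section \<open>u (_, x)\<close> on a null set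
  only; for these \<open>x\<close> the fractional integral is unchanged at every time.
\<close>

lemma frac_int_borel_rep:
  fixes u u' :: "real \<times> (real ^ 'd) \<Rightarrow> real"
  assumes \<Omega>: "\<Omega> \<in> sets borel" and r: "borel_rep (cylinder T \<Omega>) u u'"
  shows "borel_rep (cylinder T \<Omega>) (frac_int a u)
     (\<lambda>z. indicator (cylinder T \<Omega>) z * (\<integral>r. frac_kernel a T r * u' (z - r *\<^sub>R (1, 0)) \<partial>lborel))"
  unfolding borel_rep_def
proof (intro conjI allI impI)
  have [measurable]: "u' \<in> borel_measurable borel" using borel_repD(1)[OF r] .
  have [measurable]: "cylinder T \<Omega> \<in> sets borel"
    unfolding cylinder_def borel_prod[symmetric] using \<Omega> by (intro pair_measureI) auto
  show "(\<lambda>z. indicator (cylinder T \<Omega>) z * (\<integral>r. frac_kernel a T r * u' (z - r *\<^sub>R (1, 0)) \<partial>lborel)) \<in> borel_measurable borel"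
    by measurable
  have "AE x in lborel. AE t in lborel. (t, x) \<in> cylinder T \<Omega> \<longrightarrow> u (t, x) = u' (t, x)"
    using AE_lborel_Pair_swap[OF borel_repD(3)[OF r]] .
  then have "AE z in (lborel :: (real \<times> (real ^ 'd)) measure). AE t in lborel. (t, snd z) \<in> cylinder T \<Omega> \<longrightarrow> u (t, snd z) = u' (t, snd z)"
    by (rule AE_lborel_snd)
  then show "AE z in lborel. z \<in> cylinder T \<Omega> \<longrightarrow> frac_int a u z =
     indicator (cylinder T \<Omega>) z * (\<integral>r. frac_kernel a T r * u' (z - r *\<^sub>R (1, 0)) \<partial>lborel)"
  proof eventually_elim
    case (elim z)
    show ?case
    proof
      assume z: "z \<in> cylinder T \<Omega>"
      define t x where "t = fst z" and "x = snd z"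
      have tx: "0 < t" "t < T" "x \<in> \<Omega>" "z = (t, x)" using z by (auto simp: cylinder_def t_def x_def)
      define F where "F s = indicator {0<..<t} s * ((t - s) powr (a - 1) * u' (s, x))" for s
      have "borel_rep {0<..<t} (\<lambda>s. (t - s) powr (a - 1) * u (s, x)) F"
        unfolding borel_rep_def
      proof (intro conjI allI impI)
        show "F \<in> borel_measurable borel" unfolding F_def [abs_def] by measurable
        show "AE s in lborel. s \<in> {0<..<t} \<longrightarrow> (t - s) powr (a - 1) * u (s, x) = F s"
          using elim unfolding x_def[symmetric]
          by eventually_elim (use tx in \<open>auto simp: cylinder_def F_def\<close>)
      qed (simp add: F_def)
      then have "frac_int a u z = 1 / Gamma a * (\<integral>s. F s \<partial>lborel)"
        unfolding frac_int_def t_def[symmetric] x_def[symmetric]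
        by (subst borel_rep_integral[of "{0<..<t}"]) auto
      also have "(\<integral>s. F s \<partial>lborel) = (\<integral>r. F (t + (-1) * r) \<partial>lborel)"
        by (subst lborel_integral_real_affine[of "-1" F t]) auto
      also have "1 / Gamma a * \<dots> = (\<integral>r. 1 / Gamma a * F (t + (-1) * r) \<partial>lborel)"
        by (rule integral_mult_right_zero[symmetric])
      also have "\<dots> = (\<integral>r. frac_kernel a T r * u' (z - r *\<^sub>R (1, 0)) \<partial>lborel)"
      proof (intro Bochner_Integration.integral_cong refl)
        fix r :: real
        show "1 / Gamma a * F (t + (-1) * r) = frac_kernel a T r * u' (z - r *\<^sub>R (1, 0))"
        proof (cases "0 < r \<and> r < t")
          case True
          then show ?thesis using tx by (simp add: F_def frac_kernel_def)
        next
          case False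
          then have "r \<le> 0 \<or> (t - r, x) \<notin> cylinder T \<Omega>" by (auto simp: cylinder_def)
          then have "frac_kernel a T r = 0 \<or> u' (t - r, x) = 0"
            using borel_repD(2)[OF r] by (auto simp: frac_kernel_def)
          then show ?thesis using False tx by (auto simp: F_def)
        qed
      qed
      finally show "frac_int a u z = indicator (cylinder T \<Omega>) z * (\<integral>r. frac_kernel a T r * u' (z - r *\<^sub>R (1, 0)) \<partial>lborel)"
        using z by simp
    qed
  qed
qed simp

text \<open>
  Duality: to show that \<open>u\<close> and the fractional integral \<open>J\<close> of \<open>g\<close> agree when tested against a bump
  \<open>a t * b x\<close>, the weak equation is tested with \<open>\<phi> = A 0 t * b x\<close>, where \<open>A 0\<close> is the backward
  fractional integral of order \<open>\<alpha>\<close> of \<open>a\<close>. The left side of the weak equation then becomes the integral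
  of \<open>J\<close> against the bump, the right side that of \<open>u\<close>. The function \<open>\<phi>\<close> vanishes near \<open>T\<close> but in
  general not at \<open>t = 0\<close>; that such test functions are admitted is how the weak derivative encodes the
  zero initial value.
\<close>

lemma weak_dt_frac_imp_representation:
  fixes u g u' g' :: "real \<times> (real ^ 'd) \<Rightarrow> real"
  assumes \<alpha>: "0 < \<alpha>" "\<alpha> < 1" and T: "T > 0" and \<Omega>: "open \<Omega>"
    and u: "borel_rep (cylinder T \<Omega>) u u'" "integrable lborel u'"
    and g: "borel_rep (cylinder T \<Omega>) g g'" "integrable lborel g'"
    and weak: "weak_dt_frac \<alpha> T \<Omega> u g"
  shows "AE z in lborel. z \<in> cylinder T \<Omega> \<longrightarrow>
     u' z = (\<integral>r. frac_kernel \<alpha> T r * g' (z - r *\<^sub>R (1, 0)) \<partial>lborel)"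
proof -
  let ?U = "cylinder T \<Omega>"
  define J where "J z = (\<integral>r. frac_kernel \<alpha> T r * g' (z - r *\<^sub>R (1, 0)) \<partial>lborel)" for z
  define Ju where "Ju z = (\<integral>r. frac_kernel (1 - \<alpha>) T r * u' (z - r *\<^sub>R (1, 0)) \<partial>lborel)" for z
  have U: "open ?U" using \<Omega> by (rule open_cylinder)
  then have UB: "?U \<in> sets borel" by simp
  have [measurable]: "u' \<in> borel_measurable borel" "g' \<in> borel_measurable borel"
    using borel_repD(1) u(1) g(1) by auto
  have iK: "integrable lborel (frac_kernel \<alpha> T)" "integrable lborel (frac_kernel (1 - \<alpha>) T)"
    using \<alpha> T by (auto intro!: integrable_frac_kernel)
  have rep: "borel_rep ?U (frac_int (1 - \<alpha>) u) (\<lambda>z. indicator ?U z * Ju z)"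
    unfolding Ju_def using \<Omega> by (intro frac_int_borel_rep u(1)) simp
  have iJ: "integrable lborel J"
    unfolding J_def [abs_def] using integrable_convolution_mult[OF iK(1) g(2), where \<eta>="\<lambda>_. 1" and M=1 and e="(1, 0)"] by simp
  have "AE z in lborel. z \<in> ?U \<longrightarrow> u' z - J z = 0"
  proof (rule AE_zero_if_bump_integrals_zero[OF U])
    fix c d :: "real \<times> (real ^ 'd)"
    show "integrable lborel (\<lambda>z. indicator (cbox c d) z * (u' z - J z))"
      using integrable_mult_indicator[of "cbox c d" lborel "\<lambda>z. u' z - J z"] u(2) iJ by simp
  next
    fix k :: real and c d :: "real \<times> (real ^ 'd)" assume k: "k > 0" and K: "cbox c d \<subseteq> ?U"
    define \<eta> where "\<eta> = bump k c d"
    have \<eta>b: "\<bar>\<eta> z\<bar> \<le> 1" for z using bump_bounds[of k c d z] by (simp add: \<eta>_def)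
    have [measurable]: "\<eta> \<in> borel_measurable borel" by (simp add: \<eta>_def)
    have "(\<integral>z. J z * \<eta> z \<partial>lborel) = (\<integral>z. u' z * \<eta> z \<partial>lborel)"
    proof (cases "box c d = {}")
      case True
      then have "\<eta> z = 0" for z using bump_eq_0[OF k, of z c d] by (simp add: \<eta>_def)
      then show ?thesis by simp
    next
      case False
      then have ne: "cbox c d \<noteq> {}" using box_subset_cbox[of c d] by auto
      obtain c1 c2 d1 d2 where cd: "c = (c1, c2)" "d = (d1, d2)" by (cases c, cases d) auto
      have cbox: "cbox c d = {c1..d1} \<times> cbox c2 d2" unfolding cd cbox_Pair_eq by (simp add: cbox_interval)
      have "c \<in> cbox c d" "d \<in> cbox c d" using ne by (auto simp: box_ne_empty mem_box)
      then have c1: "0 < c1" "d1 < T" "c1 \<le> d1"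
        using K ne unfolding cbox by (auto simp: cylinder_def cd subset_iff)
      have K2: "cbox c2 d2 \<subseteq> \<Omega>"
      proof
        fix x assume "x \<in> cbox c2 d2"
        then have "(c1, x) \<in> cbox c d" using c1 unfolding cbox by simp
        then show "x \<in> \<Omega>" using K by (auto simp: cylinder_def)
      qed
      define a where "a n = (deriv ^^ n) (bump k c1 d1 :: real \<Rightarrow> real)" for n
      define b where "b = bump k c2 d2"
      have \<eta>: "\<eta> z = a 0 (fst z) * b (snd z)" for z
        unfolding \<eta>_def bump_Pair[of k c d] by (simp add: cd a_def b_def)
      have aC: "a n \<in> Cinf UNIV" for n
        unfolding a_def by (intro Cinf_real_iterated_deriv bump_Cinf)
      have a_der: "(a n has_real_derivative a (Suc n) t) (at t)" for n t
        using Cinf_real_deriv(1)[OF aC] by (simp add: a_def)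
      have a_cont: "continuous_on S (a n)" for n S
        using aC[of n] a_der DERIV_continuous_on[of S "a n" "a (Suc n)"] has_field_derivative_at_within by blast
      have [measurable]: "a n \<in> borel_measurable borel" for n
        by (rule borel_measurable_continuous_onI[OF a_cont])
      have a0: "a n t = 0" if "t \<notin> {c1..d1}" for n t
        unfolding a_def
        by (rule iterated_deriv_eq_0[of c1 d1]) (use that bump_eq_0[OF k, of _ c1 d1] in \<open>auto simp: box_real\<close>)
      have "\<exists>M. \<forall>t. \<bar>a n t\<bar> \<le> M" for n
      proof -
        have "bounded (a n ` {c1..d1})"
          by (intro compact_imp_bounded compact_continuous_image a_cont) auto
        then obtain M where M: "\<forall>t\<in>{c1..d1}. \<bar>a n t\<bar> \<le> M" "M > 0"
          unfolding bounded_pos by auto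
        have "\<bar>a n t\<bar> \<le> M" for t using M a0[of t n] by (cases "t \<in> {c1..d1}") auto
        then show ?thesis by blast
      qed
      then obtain M where M: "\<And>n t. \<bar>a n t\<bar> \<le> M n" by metis
      have b0: "b x = 0" if "x \<notin> cbox c2 d2" for x
        using bump_eq_0[OF k, of x c2 d2] that box_subset_cbox[of c2 d2] by (auto simp: b_def)
      have bb: "\<bar>b x\<bar> \<le> 1" for x using bump_bounds[of k c2 d2 x] by (simp add: b_def)
      have [measurable]: "b \<in> borel_measurable borel" by (simp add: b_def)
      \<comment> \<open>The backward fractional integrals of all derivatives of \<open>a\<close>; each \<open>A (Suc n)\<close> is the derivative of \<open>A n\<close>.\<close>
      define A where "A n t = (\<integral>r. frac_kernel \<alpha> T r * a n (t + r) \<partial>lborel)" for n t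
      have A_der: "(A n has_real_derivative A (Suc n) t) (at t)" for n t
        unfolding A_def by (rule frac_kernel_average_has_derivative[OF iK(1) a_der M M])
      have A0: "A n t = 0" if "t > d1" for n t
      proof -
        have "frac_kernel \<alpha> T r * a n (t + r) = 0" for r
          using that a0[of "t + r" n] by (cases "r > 0") (auto simp: frac_kernel_def)
        then show ?thesis unfolding A_def by (simp only: Bochner_Integration.integral_zero)
      qed
      have A_bound: "\<bar>A n t\<bar> \<le> (\<integral>r. \<bar>frac_kernel \<alpha> T r\<bar> * M n \<partial>lborel)" for n t
        unfolding A_def
      proof (rule integral_abs_bound_integral)
        show "integrable lborel (\<lambda>r. frac_kernel \<alpha> T r * a n (t + r))"
        proof (rule Bochner_Integration.integrable_bound)
          show "integrable lborel (\<lambda>r. \<bar>frac_kernel \<alpha> T r\<bar> * M n)" using iK(1) by auto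
          show "AE r in lborel. norm (frac_kernel \<alpha> T r * a n (t + r)) \<le> norm (\<bar>frac_kernel \<alpha> T r\<bar> * M n)"
          proof (rule AE_I2)
            fix r
            have "\<bar>frac_kernel \<alpha> T r\<bar> * \<bar>a n (t + r)\<bar> \<le> \<bar>frac_kernel \<alpha> T r\<bar> * M n"
              by (intro mult_left_mono M) simp
            then show "norm (frac_kernel \<alpha> T r * a n (t + r)) \<le> norm (\<bar>frac_kernel \<alpha> T r\<bar> * M n)"
              unfolding real_norm_def abs_mult[of "frac_kernel _ _ _"] by linarith
          qed
        qed measurable
        show "integrable lborel (\<lambda>r. \<bar>frac_kernel \<alpha> T r\<bar> * M n)" using iK(1) by auto
        fix r show "\<bar>frac_kernel \<alpha> T r * a n (t + r)\<bar> \<le> \<bar>frac_kernel \<alpha> T r\<bar> * M n"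
          unfolding abs_mult by (intro mult_left_mono M) simp
      qed
      have A_meas [measurable]: "A n \<in> borel_measurable borel" for n
        using A_der by (intro borel_measurable_continuous_onI DERIV_continuous_on[of UNIV "A n" "A (Suc n)"]) auto
      define \<phi> where "\<phi> z = A 0 (fst z) * b (snd z)" for z
      have \<phi>_cpt: "\<phi> \<in> Cinf_cpt ({0..<T} \<times> \<Omega>)"
      proof (rule Cinf_cptI)
        show "\<phi> \<in> Cinf ({0..<T} \<times> \<Omega>)"
          unfolding Cinf_def \<phi>_def [abs_def] b_def mem_Collect_eq
          by (intro allI Ck_on_mult Ck_on_compose_affine[where M=fst] Ck_on_bump_linear bounded_linear_snd A_der)
             (auto intro!: derivative_eq_intros)
        show "compact ({0..d1} \<times> cbox c2 d2)" by (intro compact_Times) auto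
        show "{0..d1} \<times> cbox c2 d2 \<subseteq> {0..<T} \<times> \<Omega>" using c1 K2 by auto
        fix z :: "real \<times> (real ^ 'd)" assume "z \<in> {0..<T} \<times> \<Omega>" "z \<notin> {0..d1} \<times> cbox c2 d2"
        then show "\<phi> z = 0" using A0[of "fst z" 0] b0[of "snd z"] by (cases z) (auto simp: \<phi>_def)
      qed
      define \<phi>t where "\<phi>t z = A 1 (fst z) * b (snd z)" for z
      have pt: "partial_t \<phi> z = \<phi>t z" for z
      proof -
        have "((\<lambda>s. A 0 s * b (snd z)) has_real_derivative A 1 (fst z) * b (snd z)) (at (fst z))"
          using A_der[of 0 "fst z"] by (auto intro!: derivative_eq_intros)
        then show ?thesis unfolding partial_t_def \<phi>t_def \<phi>_def by (simp add: DERIV_imp_deriv)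
      qed
      have [measurable]: "fst \<in> borel_measurable (borel :: (real \<times> (real ^ 'd)) measure)"
        "snd \<in> borel_measurable (borel :: (real \<times> (real ^ 'd)) measure)"
        by (auto intro!: borel_measurable_continuous_onI continuous_intros)
      have [measurable]: "\<phi> \<in> borel_measurable borel" "\<phi>t \<in> borel_measurable borel"
        unfolding \<phi>_def [abs_def] \<phi>t_def [abs_def] by measurable
      have "(\<integral>z. J z * \<eta> z \<partial>lborel) = (\<integral>z. g' z * (\<integral>r. frac_kernel \<alpha> T r * \<eta> (z + r *\<^sub>R (1, 0)) \<partial>lborel) \<partial>lborel)"
        unfolding J_def by (rule convolution_duality[OF iK(1) g(2) _ \<eta>b]) measurable
      also have "\<dots> = (\<integral>z. g' z * \<phi> z \<partial>lborel)"
        unfolding \<phi>_def A_def \<eta> by (simp add: mult.assoc[symmetric])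
      also have "\<dots> = (\<integral>z. g z * \<phi> z \<partial>lebesgue_on ?U)"
        by (rule borel_rep_integral[OF UB, symmetric], rule borel_rep_compose[OF g(1)]) auto
      also have "\<dots> = - (\<integral>z. frac_int (1 - \<alpha>) u z * \<phi>t z \<partial>lebesgue_on ?U)"
        using weak \<phi>_cpt unfolding weak_dt_frac_def pt[symmetric] by blast
      also have "(\<integral>z. frac_int (1 - \<alpha>) u z * \<phi>t z \<partial>lebesgue_on ?U) = (\<integral>z. indicator ?U z * Ju z * \<phi>t z \<partial>lborel)"
        by (rule borel_rep_integral[OF UB], rule borel_rep_compose[OF rep])
           (use borel_repD(1)[OF rep] in auto)
      \<comment> \<open>The cut-off to the cylinder may be dropped: \<open>Ju\<close> vanishes for \<open>t \<le> 0\<close>, and \<open>\<phi>t\<close> for \<open>t \<ge> T\<close> and for \<open>x\<close> outside \<open>\<Omega>\<close>.\<close>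
      also have "\<dots> = (\<integral>z. Ju z * \<phi>t z \<partial>lborel)"
      proof (intro Bochner_Integration.integral_cong refl)
        fix z :: "real \<times> (real ^ 'd)"
        show "indicator ?U z * Ju z * \<phi>t z = Ju z * \<phi>t z"
        proof (cases "z \<in> ?U")
          case False
          then consider "fst z \<le> 0" | "fst z \<ge> T" | "snd z \<notin> \<Omega>" by (cases z) (auto simp: cylinder_def not_less)
          then have "Ju z * \<phi>t z = 0"
          proof cases
            case 1
            have "frac_kernel (1 - \<alpha>) T r * u' (z - r *\<^sub>R (1, 0)) = 0" for r
            proof (cases "r > 0")
              case True
              then have "z - r *\<^sub>R (1, 0) \<notin> ?U" using 1 by (cases z) (auto simp: cylinder_def)
              then show ?thesis using borel_repD(2)[OF u(1)] by simp
            qed (simp add: frac_kernel_def)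
            then have "Ju z = 0" unfolding Ju_def by (simp only: Bochner_Integration.integral_zero)
            then show ?thesis by simp
          next
            case 2
            then show ?thesis using A0[of "fst z" 1] c1 by (simp add: \<phi>t_def)
          next
            case 3
            then show ?thesis using b0[of "snd z"] K2 by (auto simp: \<phi>t_def)
          qed
          then show ?thesis using False by simp
        qed simp
      qed
      also have "\<dots> = (\<integral>z. u' z * (\<integral>r. frac_kernel (1 - \<alpha>) T r * \<phi>t (z + r *\<^sub>R (1, 0)) \<partial>lborel) \<partial>lborel)"
        unfolding Ju_def
      proof (rule convolution_duality[OF iK(2) u(2)])
        show "\<bar>\<phi>t z\<bar> \<le> (\<integral>r. \<bar>frac_kernel \<alpha> T r\<bar> * M 1 \<partial>lborel) * 1" for z
          unfolding \<phi>t_def abs_mult using A_bound[of 1 "fst z"] bb[of "snd z"]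
          by (intro mult_mono) (auto intro: order_trans[OF abs_ge_zero])
      qed measurable
      also have "\<dots> = (\<integral>z. u' z * (- \<eta> z) \<partial>lborel)"
      proof (intro Bochner_Integration.integral_cong refl)
        fix z :: "real \<times> (real ^ 'd)"
        show "u' z * (\<integral>r. frac_kernel (1 - \<alpha>) T r * \<phi>t (z + r *\<^sub>R (1, 0)) \<partial>lborel) = u' z * (- \<eta> z)"
        proof (cases "z \<in> ?U")
          case True
          then have z: "0 < fst z" "fst z < T" by (auto simp: cylinder_def)
          have "(\<integral>r. frac_kernel (1 - \<alpha>) T r * \<phi>t (z + r *\<^sub>R (1, 0)) \<partial>lborel)
             = (\<integral>r. frac_kernel (1 - \<alpha>) T r * A 1 (fst z + r) \<partial>lborel) * b (snd z)"
            unfolding \<phi>t_def by (simp add: mult.assoc[symmetric])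
          also have "(\<integral>r. frac_kernel (1 - \<alpha>) T r * A 1 (fst z + r) \<partial>lborel) = - a 0 (fst z)"
            unfolding A_def
            by (rule frac_kernel_twice_derivative[OF \<alpha> _ a_cont _ _ _ z])
               (use a_der[of 0] M[of 1] a0 c1 in auto)
          finally show ?thesis by (simp add: \<eta>)
        qed (use borel_repD(2)[OF u(1)] in simp)
      qed
      finally show ?thesis by simp
    qed
    moreover have "integrable lborel (\<lambda>z. \<eta> z * u' z)" "integrable lborel (\<lambda>z. \<eta> z * J z)"
      by (rule Bochner_Integration.integrable_bound[OF u(2)], simp,
          use \<eta>b in \<open>auto simp: abs_mult mult_left_le_one_le\<close>,
          rule Bochner_Integration.integrable_bound[OF iJ], use iJ in simp,
          use \<eta>b in \<open>auto simp: abs_mult mult_left_le_one_le\<close>)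
    ultimately show "(\<integral>z. bump k c d z * (u' z - J z) \<partial>lborel) = 0"
      unfolding \<eta>_def[symmetric] by (simp add: right_diff_distrib mult.commute)
  qed
  then show ?thesis by (simp add: J_def)
qed

text \<open>
  The kernel has a finite dual norm because \<open>\<alpha> p > 1\<close> means \<open>(\<alpha> - 1) * (p / (p - 1)) > - 1\<close>; its
  size in terms of \<open>T\<close> is the stated power.
\<close>

lemma frac_kernel_Holder:
  assumes \<alpha>: "0 < \<alpha>" and p: "1 < p" "1 / \<alpha> < p"
  obtains C where "C \<ge> 0"
    "\<And>T h t. \<lbrakk>T > 0; h \<in> borel_measurable borel; integrable lborel (\<lambda>s. \<bar>h s\<bar> powr p)\<rbrakk> \<Longrightarrow>
      \<bar>\<integral>r. frac_kernel \<alpha> T r * h (t - r) \<partial>lborel\<bar> powr p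
        \<le> C * T powr (\<alpha> * p - 1) * (\<integral>s. \<bar>h s\<bar> powr p \<partial>lborel)"
proof -
  let ?p' = "p / (p - 1)"
  let ?e = "(\<alpha> - 1) * ?p'"
  have G: "Gamma \<alpha> > 0" using \<alpha> by (rule Gamma_real_pos)
  have \<alpha>p: "\<alpha> * p > 1" using \<alpha> p(2) by (simp add: field_simps)
  have e: "?e > -1"
  proof -
    have "?e + 1 = (\<alpha> * p - 1) / (p - 1)" using p(1) by (simp add: field_simps)
    moreover have "\<dots> > 0" using \<alpha>p p(1) by simp
    ultimately show ?thesis by linarith
  qed
  define c0 where "c0 = 1 / (?e + 1) / Gamma \<alpha> powr ?p'"
  have c0: "c0 \<ge> 0" unfolding c0_def using e by simp
  show thesis
  proof (rule that[of "c0 powr (p - 1)"])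
    fix T :: real and h :: "real \<Rightarrow> real" and t :: real
    assume T: "T > 0" and h: "h \<in> borel_measurable borel" "integrable lborel (\<lambda>s. \<bar>h s\<bar> powr p)"
    have "frac_kernel \<alpha> T r powr ?p' = (indicator {0<..<T} r * r powr ?e) / Gamma \<alpha> powr ?p'" for r
      using G p(1) by (auto simp: frac_kernel_def indicator_def powr_divide powr_powr)
    then have K: "has_bochner_integral lborel (\<lambda>r. frac_kernel \<alpha> T r powr ?p') (T powr (?e + 1) * c0)"
      using has_bochner_integral_divide_zero[OF has_bochner_integral_powr_0[OF e, of T], of "Gamma \<alpha> powr ?p'"] T
      by (simp add: c0_def)
    have sub: "(\<integral>r. \<bar>h (t - r)\<bar> powr p \<partial>lborel) = (\<integral>s. \<bar>h s\<bar> powr p \<partial>lborel)"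
      by (subst lborel_integral_real_affine[of "-1" _ t]) auto
    have isub: "integrable lborel (\<lambda>r. \<bar>h (t - r)\<bar> powr p)"
      using lborel_integrable_real_affine[OF h(2), of "-1" t] by simp
    have "\<bar>\<integral>r. frac_kernel \<alpha> T r * h (t - r) \<partial>lborel\<bar> powr p
       \<le> (\<integral>r. frac_kernel \<alpha> T r powr ?p' \<partial>lborel) powr (p - 1) * (\<integral>r. \<bar>h (t - r)\<bar> powr p \<partial>lborel)"
    proof (rule Holder_powr(2)[OF p(1)])
      show "0 \<le> frac_kernel \<alpha> T r" for r using G by (simp add: frac_kernel_def)
      show "integrable lborel (\<lambda>r. frac_kernel \<alpha> T r powr ?p')" using K by (simp add: has_bochner_integral_iff)
    qed (use h isub in measurable)
    also have "(\<integral>r. frac_kernel \<alpha> T r powr ?p' \<partial>lborel) powr (p - 1) = (T powr (?e + 1) * c0) powr (p - 1)"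
      using K by (simp add: has_bochner_integral_iff)
    also have "\<dots> = c0 powr (p - 1) * T powr ((?e + 1) * (p - 1))"
      using c0 by (simp add: powr_mult powr_powr)
    also have "(?e + 1) * (p - 1) = \<alpha> * p - 1" using p(1) by (simp add: field_simps)
    finally show "\<bar>\<integral>r. frac_kernel \<alpha> T r * h (t - r) \<partial>lborel\<bar> powr p
        \<le> c0 powr (p - 1) * T powr (\<alpha> * p - 1) * (\<integral>s. \<bar>h s\<bar> powr p \<partial>lborel)"
      unfolding sub .
  qed simp
qed

section \<open>Interpolation between time and space\<close>

text \<open>
  Jensen's inequality for the concave power \<open>\<sigma>\<close> on an interval of length \<open>T\<close>: the power lies below
  its tangent at the mean value \<open>m / T\<close>.
\<close>

lemma nn_integral_powr_le_concave:
  fixes H :: "real \<Rightarrow> real"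
  assumes H: "H \<in> borel_measurable borel" "\<And>t. H t \<ge> 0" "\<And>t. t \<notin> {0<..<T} \<Longrightarrow> H t = 0"
    and T: "T > 0" and m: "m > 0" "(\<integral>\<^sup>+t. ennreal (H t) \<partial>lborel) \<le> ennreal m"
    and \<sigma>: "0 < \<sigma>" "\<sigma> \<le> 1"
  shows "(\<integral>\<^sup>+t. ennreal (H t powr \<sigma>) \<partial>lborel) \<le> ennreal (T powr (1 - \<sigma>) * m powr \<sigma>)"
proof -
  define c where "c = m / T"
  have c: "c > 0" and m_eq: "m = c * T" using m T by (simp_all add: c_def)
  have tangent: "h powr \<sigma> \<le> (1 - \<sigma>) * c powr \<sigma> + \<sigma> * c powr (\<sigma> - 1) * h" if "h \<ge> 0" for h
  proof (cases "h = 0")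
    case False
    then have h: "h > 0" using that by simp
    have "h powr \<sigma> = (h powr \<sigma> * c powr (1 - \<sigma>)) * c powr (\<sigma> - 1)"
      using c by (simp add: mult.assoc powr_add[symmetric])
    also have "\<dots> \<le> (\<sigma> * h + (1 - \<sigma>) * c) * c powr (\<sigma> - 1)"
      using Youngs_inequality_0[of \<sigma> "1 - \<sigma>" h c] \<sigma> h c by (intro mult_right_mono) auto
    also have "\<dots> = (1 - \<sigma>) * (c powr 1 * c powr (\<sigma> - 1)) + \<sigma> * c powr (\<sigma> - 1) * h"
      using c by (simp add: algebra_simps)
    also have "c powr 1 * c powr (\<sigma> - 1) = c powr \<sigma>" by (simp only: powr_add[symmetric]) simp
    finally show ?thesis .
  qed (use \<sigma> c in simp)
  have "(\<integral>\<^sup>+t. ennreal (H t powr \<sigma>) \<partial>lborel)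
     \<le> (\<integral>\<^sup>+t. ennreal ((1 - \<sigma>) * c powr \<sigma>) * indicator {0<..<T} t + ennreal (\<sigma> * c powr (\<sigma> - 1)) * ennreal (H t) \<partial>lborel)"
  proof (rule nn_integral_mono)
    fix t :: real
    show "ennreal (H t powr \<sigma>) \<le> ennreal ((1 - \<sigma>) * c powr \<sigma>) * indicator {0<..<T} t + ennreal (\<sigma> * c powr (\<sigma> - 1)) * ennreal (H t)"
    proof (cases "t \<in> {0<..<T}")
      case True
      then show ?thesis
        using tangent[OF H(2)[of t]] \<sigma> c H(2)[of t]
        by (simp add: ennreal_mult[symmetric] ennreal_plus[symmetric] ennreal_leI del: ennreal_plus)
    qed (use H(3) \<sigma> in simp)
  qed
  also have "\<dots> = ennreal ((1 - \<sigma>) * c powr \<sigma>) * ennreal T + ennreal (\<sigma> * c powr (\<sigma> - 1)) * (\<integral>\<^sup>+t. ennreal (H t) \<partial>lborel)"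
    using H(1) T by (simp add: nn_integral_add nn_integral_cmult nn_integral_cmult_indicator)
  also have "\<dots> \<le> ennreal ((1 - \<sigma>) * c powr \<sigma>) * ennreal T + ennreal (\<sigma> * c powr (\<sigma> - 1)) * ennreal m"
    by (intro add_left_mono mult_left_mono m(2)) auto
  also have "\<dots> = ennreal ((1 - \<sigma>) * c powr \<sigma> * T + \<sigma> * c powr (\<sigma> - 1) * m)"
    using \<sigma> T m by (simp add: ennreal_mult ennreal_plus)
  also have "(1 - \<sigma>) * c powr \<sigma> * T + \<sigma> * c powr (\<sigma> - 1) * m = c powr \<sigma> * T"
  proof -
    have "c powr (\<sigma> - 1) * m = (c powr (\<sigma> - 1) * c powr 1) * T" using c by (simp add: m_eq)
    also have "c powr (\<sigma> - 1) * c powr 1 = c powr \<sigma>" by (simp only: powr_add[symmetric]) simp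
    finally show ?thesis by (simp add: algebra_simps)
  qed
  also have "c powr \<sigma> * T = T powr (1 - \<sigma>) * m powr \<sigma>"
    using T m by (simp add: c_def powr_divide powr_diff)
  finally show ?thesis .
qed

text \<open>
  If the \<open>p\<close>-th power of one factor is controlled by a function of \<open>x\<close> and that of the other by a
  function of \<open>t\<close>, the mixed product is dominated by a function of separated variables, and its
  integral by the product of two integrals. The two factors are kept apart because the first bound is
  known for the limit function, the second for its approximations. The constant \<open>C + 1\<close> keeps the bound
  positive even for \<open>C = 0\<close>.
\<close>

lemma mixed_norm_interpolation:
  fixes u g w W :: "real \<times> 'b::euclidean_space \<Rightarrow> real"
  assumes [measurable]: "u \<in> borel_measurable borel" "g \<in> borel_measurable borel"
      "w \<in> borel_measurable borel" "W \<in> borel_measurable borel"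
    and pq: "0 < p" "p < q" "q \<le> 2 * p" and T: "T > 0" and K: "K \<ge> 0" "C \<ge> 0"
    and u: "AE z in lborel. ennreal (\<bar>u z\<bar> powr p) \<le> ennreal K * (\<integral>\<^sup>+s. ennreal (\<bar>g (s, snd z)\<bar> powr p) \<partial>lborel)"
    and w: "\<And>z. ennreal (\<bar>w z\<bar> powr p) \<le> ennreal C * (\<integral>\<^sup>+y. ennreal (W (fst z, y)) \<partial>lborel)"
    and W: "\<And>t y. t \<notin> {0<..<T} \<Longrightarrow> W (t, y) = 0"
    and g: "(\<integral>\<^sup>+z. ennreal (\<bar>g z\<bar> powr p) \<partial>lborel) = ennreal \<Gamma>" "\<Gamma> \<ge> 0"
    and S: "(\<integral>\<^sup>+z. ennreal (W z) \<partial>lborel) \<le> ennreal S" "S > 0"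
  defines "\<sigma> \<equiv> (q - p) / p"
  shows "(\<integral>\<^sup>+z. ennreal (\<bar>u z\<bar> powr p * \<bar>w z\<bar> powr (q - p)) \<partial>lborel)
     \<le> ennreal (K * \<Gamma> * (T powr (1 - \<sigma>) * ((C + 1) * S) powr \<sigma>))"
proof -
  have \<sigma>: "0 < \<sigma>" "\<sigma> \<le> 1" and p\<sigma>: "p * \<sigma> = q - p" using pq by (auto simp: \<sigma>_def divide_le_eq)
  have [measurable]: "W \<in> borel_measurable (lborel \<Otimes>\<^sub>M lborel)" "g \<in> borel_measurable (lborel \<Otimes>\<^sub>M lborel)"
    unfolding lborel_prod by simp_all
  let ?I = "\<lambda>t. ennreal C * (\<integral>\<^sup>+y. ennreal (W (t, y)) \<partial>lborel)"
  define H where "H t = enn2real (?I t)" for t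
  have [measurable]: "?I \<in> borel_measurable borel" by measurable
  then have mH [measurable]: "H \<in> borel_measurable borel" unfolding H_def [abs_def] by measurable
  have int_I: "(\<integral>\<^sup>+t. ?I t \<partial>lborel) \<le> ennreal ((C + 1) * S)"
  proof -
    have "(\<integral>\<^sup>+t. ?I t \<partial>lborel) = ennreal C * (\<integral>\<^sup>+t. (\<integral>\<^sup>+y. ennreal (W (t, y)) \<partial>lborel) \<partial>lborel)"
      by (rule nn_integral_cmult) measurable
    also have "(\<integral>\<^sup>+t. (\<integral>\<^sup>+y. ennreal (W (t, y)) \<partial>lborel) \<partial>lborel) = (\<integral>\<^sup>+z. ennreal (W z) \<partial>(lborel \<Otimes>\<^sub>M lborel))"
      by (rule lborel.nn_integral_fst) measurable
    also have "ennreal C * \<dots> \<le> ennreal (C + 1) * ennreal S"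
      using S(1) K unfolding lborel_prod by (intro mult_mono ennreal_leI) auto
    finally show ?thesis using K S by (simp add: ennreal_mult)
  qed
  then have "AE t in lborel. ?I t \<noteq> \<infinity>"
    by (intro nn_integral_PInf_AE) (auto simp: top_unique)
  then have fin: "AE t in lborel. ennreal (H t) = ?I t"
    by eventually_elim (simp add: H_def less_top)
  have H0: "H t = 0" if "t \<notin> {0<..<T}" for t using W[OF that] by (simp add: H_def)
  have int_H: "(\<integral>\<^sup>+t. ennreal (H t powr \<sigma>) \<partial>lborel) \<le> ennreal (T powr (1 - \<sigma>) * ((C + 1) * S) powr \<sigma>)"
  proof (rule nn_integral_powr_le_concave[OF mH _ H0 T _ _ \<sigma>])
    show "(C + 1) * S > 0" using K S by simp
    show "(\<integral>\<^sup>+t. ennreal (H t) \<partial>lborel) \<le> ennreal ((C + 1) * S)"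
      using int_I nn_integral_cong_AE[OF fin] by simp
  qed (auto simp: H_def)
  let ?G = "\<lambda>x. \<integral>\<^sup>+s. ennreal (\<bar>g (s, x)\<bar> powr p) \<partial>lborel"
  have mG [measurable]: "?G \<in> borel_measurable borel" by measurable
  have int_G: "(\<integral>\<^sup>+x. ?G x \<partial>lborel) = ennreal \<Gamma>"
  proof -
    have "(\<integral>\<^sup>+x. ?G x \<partial>lborel) = (\<integral>\<^sup>+z. ennreal (\<bar>g z\<bar> powr p) \<partial>(lborel \<Otimes>\<^sub>M lborel))"
      by (rule lborel_pair.nn_integral_snd) measurable
    then show ?thesis using g by (simp add: lborel_prod)
  qed
  have "AE z in (lborel :: (real \<times> 'b) measure). ennreal (H (fst z)) = ?I (fst z)"
    using fin by (rule AE_lborel_fst)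
  with u have "AE z in lborel. ennreal (\<bar>u z\<bar> powr p * \<bar>w z\<bar> powr (q - p))
     \<le> ennreal K * (ennreal (H (fst z) powr \<sigma>) * ?G (snd z))"
  proof eventually_elim
    case (elim z)
    have "ennreal (\<bar>w z\<bar> powr p) \<le> ennreal (H (fst z))" using w[of z] elim(2) by simp
    then have "\<bar>w z\<bar> powr p \<le> H (fst z)" by (subst (asm) ennreal_le_iff) (simp_all add: H_def)
    then have "(\<bar>w z\<bar> powr p) powr \<sigma> \<le> H (fst z) powr \<sigma>" using \<sigma> by (intro powr_mono2) auto
    then have "\<bar>w z\<bar> powr (q - p) \<le> H (fst z) powr \<sigma>" by (simp add: powr_powr p\<sigma>)
    then have "ennreal (\<bar>u z\<bar> powr p) * ennreal (\<bar>w z\<bar> powr (q - p)) \<le> (ennreal K * ?G (snd z)) * ennreal (H (fst z) powr \<sigma>)"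
      using elim(1) by (intro mult_mono ennreal_leI) auto
    then show ?case by (simp add: ennreal_mult mult_ac)
  qed
  then have "(\<integral>\<^sup>+z. ennreal (\<bar>u z\<bar> powr p * \<bar>w z\<bar> powr (q - p)) \<partial>lborel)
     \<le> (\<integral>\<^sup>+z. ennreal K * (ennreal (H (fst z) powr \<sigma>) * ?G (snd z)) \<partial>lborel)"
    by (rule nn_integral_mono_AE)
  also have "\<dots> = (\<integral>\<^sup>+z. ennreal K * (ennreal (H (fst z) powr \<sigma>) * ?G (snd z)) \<partial>(lborel \<Otimes>\<^sub>M lborel))"
    by (simp only: lborel_prod)
  also have "\<dots> = (\<integral>\<^sup>+t. \<integral>\<^sup>+x. ennreal K * (ennreal (H t powr \<sigma>) * ?G x) \<partial>lborel \<partial>lborel)"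
    by (subst lborel.nn_integral_fst[symmetric]) simp_all
  also have "\<dots> = ennreal K * ((\<integral>\<^sup>+t. ennreal (H t powr \<sigma>) \<partial>lborel) * (\<integral>\<^sup>+x. ?G x \<partial>lborel))"
    by (simp add: nn_integral_cmult nn_integral_multc)
  also have "\<dots> \<le> ennreal K * (ennreal (T powr (1 - \<sigma>) * ((C + 1) * S) powr \<sigma>) * ennreal \<Gamma>)"
    unfolding int_G by (intro mult_left_mono mult_right_mono int_H) auto
  also have "\<dots> = ennreal (K * \<Gamma> * (T powr (1 - \<sigma>) * ((C + 1) * S) powr \<sigma>))"
    using K g by (simp add: ennreal_mult mult_ac)
  finally show ?thesis .
qed

text \<open>
  Fatou's lemma along the approximating sequence. Only the factor bounded in space is approximated.
\<close>

lemma mixed_norm_interpolation_limit: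
  fixes u g :: "real \<times> 'b::euclidean_space \<Rightarrow> real" and w W :: "nat \<Rightarrow> real \<times> 'b \<Rightarrow> real"
  assumes [measurable]: "u \<in> borel_measurable borel" "g \<in> borel_measurable borel"
      "\<And>n. w n \<in> borel_measurable borel" "\<And>n. W n \<in> borel_measurable borel"
    and pq: "0 < p" "p < q" "q \<le> 2 * p" and T: "T > 0" and K: "K \<ge> 0" "C \<ge> 0"
    and u: "AE z in lborel. ennreal (\<bar>u z\<bar> powr p) \<le> ennreal K * (\<integral>\<^sup>+s. ennreal (\<bar>g (s, snd z)\<bar> powr p) \<partial>lborel)"
    and w: "\<And>n z. ennreal (\<bar>w n z\<bar> powr p) \<le> ennreal C * (\<integral>\<^sup>+y. ennreal (W n (fst z, y)) \<partial>lborel)"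
    and W: "\<And>n t y. t \<notin> {0<..<T} \<Longrightarrow> W n (t, y) = 0"
    and g: "(\<integral>\<^sup>+z. ennreal (\<bar>g z\<bar> powr p) \<partial>lborel) = ennreal \<Gamma>" "\<Gamma> \<ge> 0"
    and S: "\<And>n. (\<integral>\<^sup>+z. ennreal (W n z) \<partial>lborel) \<le> ennreal (S n)" "\<And>n. S n > 0" "S \<longlonglongrightarrow> S'"
    and lim: "AE z in lborel. (\<lambda>n. w n z) \<longlonglongrightarrow> u z"
  defines "\<sigma> \<equiv> (q - p) / p"
  shows "(\<integral>\<^sup>+z. ennreal (\<bar>u z\<bar> powr q) \<partial>lborel)
     \<le> ennreal (K * \<Gamma> * (T powr (1 - \<sigma>) * ((C + 1) * S') powr \<sigma>))"
proof -
  let ?R = "\<lambda>s. K * \<Gamma> * (T powr (1 - \<sigma>) * ((C + 1) * s) powr \<sigma>)"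
  let ?f = "\<lambda>n z. ennreal (\<bar>u z\<bar> powr p * \<bar>w n z\<bar> powr (q - p))"
  have \<sigma>: "\<sigma> > 0" using pq by (simp add: \<sigma>_def)
  have "(\<integral>\<^sup>+z. ennreal (\<bar>u z\<bar> powr q) \<partial>lborel) = (\<integral>\<^sup>+z. liminf (\<lambda>n. ?f n z) \<partial>lborel)"
  proof (rule nn_integral_cong_AE)
    show "AE z in lborel. ennreal (\<bar>u z\<bar> powr q) = liminf (\<lambda>n. ?f n z)"
      using lim
    proof eventually_elim
      case (elim z)
      have "(\<lambda>n. \<bar>u z\<bar> powr p * \<bar>w n z\<bar> powr (q - p)) \<longlonglongrightarrow> \<bar>u z\<bar> powr p * \<bar>u z\<bar> powr (q - p)"
        using elim pq by (intro tendsto_intros tendsto_powr' tendsto_rabs) auto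
      also have "\<bar>u z\<bar> powr p * \<bar>u z\<bar> powr (q - p) = \<bar>u z\<bar> powr q" by (simp add: powr_add[symmetric])
      finally have "(\<lambda>n. ?f n z) \<longlonglongrightarrow> ennreal (\<bar>u z\<bar> powr q)" by (rule tendsto_ennrealI)
      then show ?case by (intro lim_imp_Liminf[symmetric]) auto
    qed
  qed
  also have "\<dots> \<le> liminf (\<lambda>n. \<integral>\<^sup>+z. ?f n z \<partial>lborel)"
    by (rule nn_integral_liminf) measurable
  also have "\<dots> \<le> liminf (\<lambda>n. ennreal (?R (S n)))"
    unfolding \<sigma>_def
    by (intro Liminf_mono always_eventually allI mixed_norm_interpolation[OF _ _ _ _ pq T K u w W g S(1,2)]) measurable
  also have "\<dots> = ennreal (?R S')"
  proof (rule lim_imp_Liminf)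
    have "\<forall>\<^sub>F n in sequentially. 0 \<le> (C + 1) * S n" using K S(2) by (auto intro!: always_eventually less_imp_le)
    then show "(\<lambda>n. ennreal (?R (S n))) \<longlonglongrightarrow> ennreal (?R S')"
      using S(3) \<sigma> by (intro tendsto_ennrealI tendsto_intros tendsto_powr') auto
  qed simp
  finally show ?thesis .
qed

section \<open>Weak derivatives and approximation\<close>

lemma powr_sum_le:
  fixes a :: "'i \<Rightarrow> real"
  assumes "finite I" "p > 0" "\<And>i. i \<in> I \<Longrightarrow> a i \<ge> 0"
  shows "(\<Sum>i\<in>I. a i) powr p \<le> real (card I) powr p * (\<Sum>i\<in>I. a i powr p)"
proof (cases "I = {}")
  case False
  let ?m = "Max (a ` I)"
  have "?m \<in> a ` I" using assms(1) False by (intro Max_in) auto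
  then obtain j where j: "j \<in> I" "?m = a j" by auto
  have "(\<Sum>i\<in>I. a i) \<le> real (card I) * a j"
    using sum_bounded_above[of I a "a j"] assms(1) j(2) by (metis Max_ge finite_imageI imageI)
  then have "(\<Sum>i\<in>I. a i) powr p \<le> (real (card I) * a j) powr p"
    using assms by (intro powr_mono2) (auto intro: sum_nonneg)
  also have "\<dots> = real (card I) powr p * a j powr p" using assms(3)[OF j(1)] by (simp add: powr_mult)
  also have "\<dots> \<le> real (card I) powr p * (\<Sum>i\<in>I. a i powr p)"
    using assms(1) j(1) by (intro mult_left_mono member_le_sum) auto
  finally show ?thesis .
qed simp

lemma Lp_space_lincomb:
  fixes u v :: "'a::euclidean_space \<Rightarrow> real"
  assumes p: "p > 0" and u: "u \<in> Lp_space p S" and v: "v \<in> Lp_space p S"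
  shows "(\<lambda>z. u z + s * v z) \<in> Lp_space p S"
proof -
  have [measurable]: "u \<in> borel_measurable (lebesgue_on S)" "v \<in> borel_measurable (lebesgue_on S)"
    and i: "integrable (lebesgue_on S) (\<lambda>z. \<bar>u z\<bar> powr p)" "integrable (lebesgue_on S) (\<lambda>z. \<bar>v z\<bar> powr p)"
    using u v by (auto simp: Lp_space_def)
  have "integrable (lebesgue_on S) (\<lambda>z. \<bar>u z + s * v z\<bar> powr p)"
  proof (rule Bochner_Integration.integrable_bound)
    show "integrable (lebesgue_on S) (\<lambda>z. 2 powr p * (\<bar>u z\<bar> powr p + \<bar>s\<bar> powr p * \<bar>v z\<bar> powr p))" using i by auto
    show "AE z in lebesgue_on S. norm (\<bar>u z + s * v z\<bar> powr p) \<le> norm (2 powr p * (\<bar>u z\<bar> powr p + \<bar>s\<bar> powr p * \<bar>v z\<bar> powr p))"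
    proof (rule AE_I2)
      fix z
      show "norm (\<bar>u z + s * v z\<bar> powr p) \<le> norm (2 powr p * (\<bar>u z\<bar> powr p + \<bar>s\<bar> powr p * \<bar>v z\<bar> powr p))"
        using abs_add_powr_le[of p "u z" "s * v z"] p by (simp add: abs_mult powr_mult)
    qed
  qed measurable
  then show ?thesis by (simp add: Lp_space_def)
qed

lemma Lp_space_imp_integrable:
  fixes u :: "'a::euclidean_space \<Rightarrow> real"
  assumes p: "p \<ge> 1" and u: "u \<in> Lp_space p S" and S: "S \<in> lmeasurable"
  shows "integrable (lebesgue_on S) u"
proof (rule Bochner_Integration.integrable_bound)
  interpret finite_measure "lebesgue_on S" using S by (rule finite_measure_lebesgue_on)
  show "integrable (lebesgue_on S) (\<lambda>z. 1 + \<bar>u z\<bar> powr p)" using u by (auto simp: Lp_space_def)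
  show "u \<in> borel_measurable (lebesgue_on S)" using u by (simp add: Lp_space_def)
  have "\<bar>x\<bar> \<le> 1 + \<bar>x\<bar> powr p" for x :: real
  proof (cases "\<bar>x\<bar> \<le> 1")
    case False
    then have "\<bar>x\<bar> powr 1 \<le> \<bar>x\<bar> powr p" using p by (intro powr_mono) auto
    then show ?thesis by simp
  qed (simp add: add_increasing2)
  then show "AE z in lebesgue_on S. norm (u z) \<le> norm (1 + \<bar>u z\<bar> powr p)" by simp
qed

text \<open>
  Off the closed set on which the function is supported, it vanishes together with its derivative;
  on this compact set both are bounded by continuity.
\<close>

lemma Cinf_cpt_bounds:
  fixes \<phi> :: "'a::euclidean_space \<Rightarrow> real"
  assumes U: "open U" and \<phi>: "\<phi> \<in> Cinf_cpt U" and e: "e \<in> Basis"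
  obtains \<phi>' M where "\<And>z. z \<in> U \<Longrightarrow> (\<phi> has_derivative \<phi>' z) (at z)"
    "continuous_on U \<phi>" "continuous_on U (\<lambda>z. \<phi>' z e)"
    "\<And>z. z \<in> U \<Longrightarrow> \<bar>\<phi> z\<bar> \<le> M" "\<And>z. z \<in> U \<Longrightarrow> \<bar>\<phi>' z e\<bar> \<le> M"
proof -
  let ?K = "closure {z \<in> U. \<phi> z \<noteq> 0}"
  have K: "compact ?K" "?K \<subseteq> U" using \<phi> by (auto simp: Cinf_cpt_def)
  have "Ck_on (Suc 0) U \<phi>" using \<phi> by (auto simp: Cinf_cpt_def Cinf_def simp del: Ck_on.simps)
  then obtain \<phi>' where "\<And>z. z \<in> U \<Longrightarrow> (\<phi> has_derivative \<phi>' z) (at z within U)"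
    and c': "continuous_on U (\<lambda>z. \<phi>' z e)" using e by auto
  then have d: "(\<phi> has_derivative \<phi>' z) (at z)" if "z \<in> U" for z
    using that at_within_open[OF that U] by metis
  have c: "continuous_on U \<phi>"
    by (rule has_derivative_continuous_on, rule has_derivative_at_withinI, rule d)
  have off: "\<phi> z = 0 \<and> \<phi>' z e = 0" if z: "z \<in> U" "z \<notin> ?K" for z
  proof -
    have "eventually (\<lambda>x. x \<in> U - ?K) (nhds z)"
      using z U by (intro eventually_nhds_in_open open_Diff) auto
    then have ev: "eventually (\<lambda>x. \<phi> x = 0) (nhds z)"
      by eventually_elim (use closure_subset[of "{z \<in> U. \<phi> z \<noteq> 0}"] in auto)
    then have "\<phi> z = 0" by (rule eventually_nhds_x_imp_x)
    moreover have "(\<phi> has_derivative (\<lambda>h. 0)) (at z)"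
      using ev by (rule has_derivative_zero_if_eventually_zero)
    then have "\<phi>' z = (\<lambda>h. 0)" using d[OF z(1)] has_derivative_unique by blast
    ultimately show ?thesis by simp
  qed
  have "bounded (\<phi> ` ?K)" "bounded ((\<lambda>z. \<phi>' z e) ` ?K)"
    by (intro compact_imp_bounded compact_continuous_image K continuous_on_subset[OF c] continuous_on_subset[OF c'])+
  then obtain M1 M2 where M: "M1 > 0" "\<forall>z\<in>?K. \<bar>\<phi> z\<bar> \<le> M1" "M2 > 0" "\<forall>z\<in>?K. \<bar>\<phi>' z e\<bar> \<le> M2"
    unfolding bounded_pos by auto
  show thesis
  proof (rule that[OF d c c', of "M1 + M2"])
    fix z assume z: "z \<in> U"
    show "\<bar>\<phi> z\<bar> \<le> M1 + M2" "\<bar>\<phi>' z e\<bar> \<le> M1 + M2"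
      using M off[OF z] by (cases "z \<in> ?K"; force)+
  qed
qed

lemma weak_partial_x_lincomb:
  fixes u v g h :: "real \<times> (real ^ 'd) \<Rightarrow> real"
  assumes \<Omega>: "open \<Omega>"
    and i: "integrable (lebesgue_on (cylinder T \<Omega>)) u" "integrable (lebesgue_on (cylinder T \<Omega>)) v"
      "integrable (lebesgue_on (cylinder T \<Omega>)) g" "integrable (lebesgue_on (cylinder T \<Omega>)) h"
    and w: "weak_partial_x T \<Omega> i u g" "weak_partial_x T \<Omega> i v h"
  shows "weak_partial_x T \<Omega> i (\<lambda>z. u z + s * v z) (\<lambda>z. g z + s * h z)"
  unfolding weak_partial_x_def
proof
  let ?U = "cylinder T \<Omega>"
  have U: "open ?U" using \<Omega> by (rule open_cylinder)
  fix \<phi> assume \<phi>: "\<phi> \<in> Cinf_cpt ?U"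
  obtain \<phi>' M where d: "\<And>z. z \<in> ?U \<Longrightarrow> (\<phi> has_derivative \<phi>' z) (at z)"
    and c: "continuous_on ?U \<phi>" "continuous_on ?U (\<lambda>z. \<phi>' z (0, axis i 1))"
    and M: "\<And>z. z \<in> ?U \<Longrightarrow> \<bar>\<phi> z\<bar> \<le> M" "\<And>z. z \<in> ?U \<Longrightarrow> \<bar>\<phi>' z (0, axis i 1)\<bar> \<le> M"
    using Cinf_cpt_bounds[OF U \<phi> axis_Basis_prod[of i]] by blast
  have px: "partial_x i \<phi> z = \<phi>' z (0, axis i 1)" if "z \<in> ?U" for z
    unfolding partial_x_eq_directional using has_derivative_imp_directional[OF d[OF that]] by (rule DERIV_imp_deriv)
  have c2: "continuous_on ?U (partial_x i \<phi>)"
    using c(2) px by (simp cong: continuous_on_cong)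
  have int: "integrable (lebesgue_on ?U) (\<lambda>z. f z * \<psi> z)"
    if f: "integrable (lebesgue_on ?U) f" and \<psi>: "continuous_on ?U \<psi>" "\<And>z. z \<in> ?U \<Longrightarrow> \<bar>\<psi> z\<bar> \<le> M"
    for f \<psi> :: "real \<times> (real ^ 'd) \<Rightarrow> real"
  proof (rule Bochner_Integration.integrable_bound)
    show "integrable (lebesgue_on ?U) (\<lambda>z. f z * M)" using f by auto
    have "\<psi> \<in> borel_measurable (lebesgue_on ?U)"
      using \<psi>(1) U by (intro continuous_imp_measurable_on_sets_lebesgue) auto
    then show "(\<lambda>z. f z * \<psi> z) \<in> borel_measurable (lebesgue_on ?U)" using f by measurable
    show "AE z in lebesgue_on ?U. norm (f z * \<psi> z) \<le> norm (f z * M)"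
    proof (rule AE_I2)
      fix z assume "z \<in> space (lebesgue_on ?U)"
      then have "\<bar>\<psi> z\<bar> \<le> \<bar>M\<bar>" using \<psi>(2)[of z] by auto
      then show "norm (f z * \<psi> z) \<le> norm (f z * M)" by (simp add: abs_mult mult_left_mono)
    qed
  qed
  have M': "\<And>z. z \<in> ?U \<Longrightarrow> \<bar>partial_x i \<phi> z\<bar> \<le> M" using M(2) px by simp
  have "(\<integral>z. (g z + s * h z) * \<phi> z \<partial>lebesgue_on ?U) = (\<integral>z. g z * \<phi> z + s * (h z * \<phi> z) \<partial>lebesgue_on ?U)"
    by (simp add: algebra_simps)
  also have "\<dots> = (\<integral>z. g z * \<phi> z \<partial>lebesgue_on ?U) + s * (\<integral>z. h z * \<phi> z \<partial>lebesgue_on ?U)"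
    using int[OF i(3) c(1) M(1)] int[OF i(4) c(1) M(1)] by simp
  also have "\<dots> = - ((\<integral>z. u z * partial_x i \<phi> z \<partial>lebesgue_on ?U) + s * (\<integral>z. v z * partial_x i \<phi> z \<partial>lebesgue_on ?U))"
    using w \<phi> by (simp add: weak_partial_x_def)
  also have "\<dots> = - (\<integral>z. u z * partial_x i \<phi> z + s * (v z * partial_x i \<phi> z) \<partial>lebesgue_on ?U)"
    using int[OF i(1) c2 M'] int[OF i(2) c2 M'] by simp
  also have "\<dots> = - (\<integral>z. (u z + s * v z) * partial_x i \<phi> z \<partial>lebesgue_on ?U)"
    by (simp add: algebra_simps)
  finally show "(\<integral>z. (g z + s * h z) * \<phi> z \<partial>lebesgue_on ?U) = - (\<integral>z. (u z + s * v z) * partial_x i \<phi> z \<partial>lebesgue_on ?U)" .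
qed

lemma Cinf_imp_derivative_on_cylinder:
  fixes v :: "real \<times> (real ^ 'd) \<Rightarrow> real"
  assumes \<Omega>: "open \<Omega>" and v: "v \<in> Cinf ({0..T} \<times> \<Omega>)"
  obtains v' where "\<And>z. z \<in> cylinder T \<Omega> \<Longrightarrow> (v has_derivative v' z) (at z)"
    "\<And>b. b \<in> Basis \<Longrightarrow> continuous_on (cylinder T \<Omega>) (\<lambda>z. v' z b)"
proof -
  have "Ck_on (Suc 0) ({0..T} \<times> \<Omega>) v" using v unfolding Cinf_def by blast
  then obtain v' where v': "\<And>z. z \<in> {0..T} \<times> \<Omega> \<Longrightarrow> (v has_derivative v' z) (at z within {0..T} \<times> \<Omega>)"
    "\<And>b. b \<in> Basis \<Longrightarrow> continuous_on ({0..T} \<times> \<Omega>) (\<lambda>z. v' z b)" by auto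
  have sub: "cylinder T \<Omega> \<subseteq> {0..T} \<times> \<Omega>" by (auto simp: cylinder_def)
  show thesis
  proof (rule that)
    fix z assume z: "z \<in> cylinder T \<Omega>"
    then have "(v has_derivative v' z) (at z within cylinder T \<Omega>)"
      using v'(1) sub has_derivative_subset by blast
    then show "(v has_derivative v' z) (at z)"
      using at_within_open[OF z open_cylinder[OF \<Omega>]] by simp
  qed (rule continuous_on_subset[OF v'(2) sub])
qed

text \<open>
  Monotonicity of the integral needs the gradient norm to be integrable, which follows from its bound
  by the sum of the components.
\<close>

lemma Lp_norm_Dx_le_grad_x:
  fixes u :: "real \<times> (real ^ 'd) \<Rightarrow> real"
  assumes p: "p > 0" and D: "\<And>i. Dx p T \<Omega> i u \<in> Lp_space p (cylinder T \<Omega>)"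
  shows "Lp_norm p (cylinder T \<Omega>) (Dx p T \<Omega> i u) \<le> Lp_norm p (cylinder T \<Omega>) (grad_x p T \<Omega> u)"
proof -
  let ?M = "lebesgue_on (cylinder T \<Omega>)"
  have [measurable]: "Dx p T \<Omega> i u \<in> borel_measurable ?M" for i using D[of i] by (simp add: Lp_space_def)
  have i: "integrable ?M (\<lambda>z. \<bar>Dx p T \<Omega> i u z\<bar> powr p)" for i using D[of i] by (simp add: Lp_space_def)
  have n: "norm (grad_x p T \<Omega> u z) = sqrt (\<Sum>i\<in>UNIV. (Dx p T \<Omega> i u z)\<^sup>2)" for z
    by (simp add: norm_vec_def L2_set_def grad_x_def)
  have "integrable ?M (\<lambda>z. norm (grad_x p T \<Omega> u z) powr p)"
  proof (rule Bochner_Integration.integrable_bound)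
    show "integrable ?M (\<lambda>z. real (card (UNIV :: 'd set)) powr p * (\<Sum>i\<in>UNIV. \<bar>Dx p T \<Omega> i u z\<bar> powr p))" using i by auto
    show "(\<lambda>z. norm (grad_x p T \<Omega> u z) powr p) \<in> borel_measurable ?M" unfolding n by measurable
    show "AE z in ?M. norm (norm (grad_x p T \<Omega> u z) powr p)
      \<le> norm (real (card (UNIV :: 'd set)) powr p * (\<Sum>i\<in>UNIV. \<bar>Dx p T \<Omega> i u z\<bar> powr p))"
    proof (rule AE_I2)
      fix z
      have "norm (grad_x p T \<Omega> u z) \<le> (\<Sum>i\<in>UNIV. \<bar>Dx p T \<Omega> i u z\<bar>)"
        using norm_le_l1_cart[of "grad_x p T \<Omega> u z"] by (simp add: grad_x_def)
      then have "norm (grad_x p T \<Omega> u z) powr p \<le> (\<Sum>i\<in>UNIV. \<bar>Dx p T \<Omega> i u z\<bar>) powr p"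
        using p by (intro powr_mono2) auto
      also have "\<dots> \<le> real (card (UNIV :: 'd set)) powr p * (\<Sum>i\<in>UNIV. \<bar>Dx p T \<Omega> i u z\<bar> powr p)"
        using p by (intro powr_sum_le) auto
      finally show "norm (norm (grad_x p T \<Omega> u z) powr p)
        \<le> norm (real (card (UNIV :: 'd set)) powr p * (\<Sum>i\<in>UNIV. \<bar>Dx p T \<Omega> i u z\<bar> powr p))"
        by (simp add: sum_nonneg)
    qed
  qed
  moreover have "\<bar>Dx p T \<Omega> i u z\<bar> powr p \<le> norm (grad_x p T \<Omega> u z) powr p" for z
    using component_le_norm_cart[of "grad_x p T \<Omega> u z" i] p by (intro powr_mono2) (auto simp: grad_x_def)
  ultimately have "(\<integral>z. \<bar>Dx p T \<Omega> i u z\<bar> powr p \<partial>?M) \<le> (\<integral>z. norm (grad_x p T \<Omega> u z) powr p \<partial>?M)"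
    using i by (intro integral_mono) auto
  then show ?thesis using p by (auto simp: Lp_norm_def intro!: powr_mono2)
qed

text \<open>
  The factor \<open>d powr p\<close> makes the second summand dominate the \<open>p\<close>-th power of the sum of the absolute
  values of the partial derivatives.
\<close>

definition energy_density :: "real \<Rightarrow> (real \<times> (real ^ 'd)) set \<Rightarrow> (real \<times> (real ^ 'd) \<Rightarrow> real) \<Rightarrow>
    (real \<times> (real ^ 'd) \<Rightarrow> real \<times> (real ^ 'd) \<Rightarrow> real) \<Rightarrow> real \<times> (real ^ 'd) \<Rightarrow> real" where
  "energy_density p U v v' z = indicator U z *
     (\<bar>v z\<bar> powr p + real CARD('d) powr p * (\<Sum>i\<in>UNIV. \<bar>v' z (0, axis i 1)\<bar> powr p))"

lemma energy_density_measurable: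
  fixes v :: "real \<times> (real ^ 'd) \<Rightarrow> real"
  assumes U: "open U" and v: "continuous_on U v"
    and v': "\<And>b. b \<in> Basis \<Longrightarrow> continuous_on U (\<lambda>z. v' z b)"
  shows "energy_density p U v v' \<in> borel_measurable borel"
proof -
  have m: "(\<lambda>z. indicator U z *\<^sub>R f z) \<in> borel_measurable borel" if "continuous_on U f" for f :: "_ \<Rightarrow> real"
    using U that by (intro borel_measurable_continuous_on_indicator) auto
  have [measurable]: "U \<in> sets borel" using U by simp
  define V where "V z = indicator U z *\<^sub>R v z" for z
  define D where "D i z = indicator U z *\<^sub>R v' z (0, axis i 1)" for i z
  have [measurable]: "V \<in> borel_measurable borel" "D i \<in> borel_measurable borel" for i
    unfolding V_def [abs_def] D_def [abs_def] by (intro m v v' axis_Basis_prod)+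
  have "energy_density p U v v' = (\<lambda>z. indicator U z *
     (\<bar>V z\<bar> powr p + real CARD('d) powr p * (\<Sum>i\<in>UNIV. \<bar>D i z\<bar> powr p)))"
    by (rule ext) (simp add: energy_density_def V_def D_def indicator_def)
  then show ?thesis by simp
qed

lemma Morrey_on_slices:
  assumes p: "real CARD('d) < p"
  obtains C where "C \<ge> 0" and
    "\<And>T (v :: real \<times> (real ^ 'd) \<Rightarrow> real) v' z.
       \<lbrakk>\<And>z. z \<in> cylinder T (ball 0 1) \<Longrightarrow> (v has_derivative v' z) (at z);
        \<And>b. b \<in> Basis \<Longrightarrow> continuous_on (cylinder T (ball 0 1)) (\<lambda>z. v' z b)\<rbrakk> \<Longrightarrow>
       ennreal (\<bar>indicator (cylinder T (ball 0 1)) z * v z\<bar> powr p)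
         \<le> ennreal C * (\<integral>\<^sup>+y. ennreal (energy_density p (cylinder T (ball 0 1)) v v' (fst z, y)) \<partial>lborel)"
proof -
  have p': "real DIM(real ^ 'd) < p" using p by simp
  have p0: "p > 0" using p by linarith
  obtain C where C: "C \<ge> 0" and Morrey: "\<And>(f :: real ^ 'd \<Rightarrow> real) f' G x.
       \<lbrakk>\<And>y. y \<in> ball 0 1 \<Longrightarrow> (f has_derivative f' y) (at y);
       continuous_on (ball 0 1) G; \<And>y h. y \<in> ball 0 1 \<Longrightarrow> \<bar>f' y h\<bar> \<le> norm h * G y; x \<in> ball 0 1\<rbrakk> \<Longrightarrow>
     ennreal (\<bar>f x\<bar> powr p) \<le>
       ennreal C * (\<integral>\<^sup>+y. ennreal (indicator (ball 0 1) y * (\<bar>f y\<bar> powr p + G y powr p)) \<partial>lborel)"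
    by (rule Morrey_ball[OF p']) blast
  show thesis
  proof (rule that[OF C])
    fix T and v :: "real \<times> (real ^ 'd) \<Rightarrow> real" and v' and z :: "real \<times> (real ^ 'd)"
    let ?U = "cylinder T (ball (0 :: real ^ 'd) 1)"
    assume v: "\<And>z. z \<in> ?U \<Longrightarrow> (v has_derivative v' z) (at z)"
      and v': "\<And>b. b \<in> Basis \<Longrightarrow> continuous_on ?U (\<lambda>z. v' z b)"
    show "ennreal (\<bar>indicator ?U z * v z\<bar> powr p)
         \<le> ennreal C * (\<integral>\<^sup>+y. ennreal (energy_density p ?U v v' (fst z, y)) \<partial>lborel)"
    proof (cases "z \<in> ?U")
      case True
      define t x where "t = fst z" and "x = snd z"
      have z: "z = (t, x)" by (simp add: t_def x_def)
      have tx: "0 < t" "t < T" "x \<in> ball 0 1" using True by (auto simp: z cylinder_def)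
      have in_U: "(t, y) \<in> ?U" if "y \<in> ball 0 1" for y using that tx by (auto simp: cylinder_def)
      define G where "G y = (\<Sum>i\<in>UNIV. \<bar>v' (t, y) (0, axis i 1)\<bar>)" for y
      have "ennreal (\<bar>v (t, x)\<bar> powr p) \<le>
        ennreal C * (\<integral>\<^sup>+y. ennreal (indicator (ball 0 1) y * (\<bar>v (t, y)\<bar> powr p + G y powr p)) \<partial>lborel)"
      proof (rule Morrey[where f' = "\<lambda>y h. v' (t, y) (0, h)"])
        fix y :: "real ^ 'd" assume y: "y \<in> ball 0 1"
        have "((\<lambda>y. (t, y)) has_derivative (\<lambda>h. (0, h))) (at y)"
          by (auto intro!: derivative_eq_intros)
        from has_derivative_compose[OF this v[OF in_U[OF y]]]
        show "((\<lambda>y. v (t, y)) has_derivative (\<lambda>h. v' (t, y) (0, h))) (at y)" .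
        fix h :: "real ^ 'd"
        have lin: "linear (v' (t, y))" using v[OF in_U[OF y]] by (rule has_derivative_linear)
        have "(0 :: real, h) = (\<Sum>i\<in>UNIV. (h $ i) *\<^sub>R (0, axis i 1))"
          by (subst basis_expansion[symmetric, of h]) (simp add: sum_prod scalar_mult_eq_scaleR)
        then have "v' (t, y) (0, h) = v' (t, y) (\<Sum>i\<in>UNIV. (h $ i) *\<^sub>R (0, axis i 1))"
          by (rule arg_cong)
        also have "\<dots> = (\<Sum>i\<in>UNIV. h $ i * v' (t, y) (0, axis i 1))"
          by (simp only: linear_sum[OF lin] linear_scale[OF lin] real_scaleR_def)
        also have "\<bar>\<dots>\<bar> \<le> (\<Sum>i\<in>UNIV. \<bar>h $ i * v' (t, y) (0, axis i 1)\<bar>)" by (rule sum_abs)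
        also have "\<dots> \<le> (\<Sum>i\<in>UNIV. norm h * \<bar>v' (t, y) (0, axis i 1)\<bar>)"
          unfolding abs_mult by (intro sum_mono mult_right_mono component_le_norm_cart) auto
        finally show "\<bar>v' (t, y) (0, h)\<bar> \<le> norm h * G y" by (simp add: G_def sum_distrib_left)
      next
        show "continuous_on (ball 0 1) G"
          unfolding G_def
          by (intro continuous_intros continuous_on_compose2[OF v'[OF axis_Basis_prod]]) (use in_U in auto)
      qed (use tx in auto)
      also have "\<dots> \<le> ennreal C * (\<integral>\<^sup>+y. ennreal (energy_density p ?U v v' (t, y)) \<partial>lborel)"
      proof (intro mult_left_mono nn_integral_mono ennreal_leI)
        fix y
        have "G y powr p \<le> real CARD('d) powr p * (\<Sum>i\<in>UNIV. \<bar>v' (t, y) (0, axis i 1)\<bar> powr p)"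
          unfolding G_def using p0 by (intro powr_sum_le) auto
        then show "indicator (ball 0 1) y * (\<bar>v (t, y)\<bar> powr p + G y powr p) \<le> energy_density p ?U v v' (t, y)"
          using in_U[of y] by (cases "y \<in> ball 0 1") (auto simp: energy_density_def sum_nonneg)
      qed simp
      finally show ?thesis using True by (simp add: z)
    qed (use p0 in simp)
  qed
qed

text \<open>
  The operator \<open>Dx\<close> picks derivatives by choice and is thus not linear on the nose. The weak
  derivative of an approximating function is therefore taken to be the sum of those picked for \<open>u\<close> and
  for the difference, whose norm tends to zero; it agrees almost everywhere with the classical
  derivative in the energy density. A subsequence of the approximations converges almost everywhere.
\<close>

lemma H_alpha_1_0_approximation:
  fixes u :: "real \<times> (real ^ 'd) \<Rightarrow> real"
  assumes \<Omega>: "open \<Omega>" "bounded \<Omega>" and p: "p > 1" and T: "T > 0"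
    and u: "u \<in> H_alpha_1_0 \<alpha> p T \<Omega>" and r: "borel_rep (cylinder T \<Omega>) u u'"
  obtains v v' S where
    "\<And>n z. z \<in> cylinder T \<Omega> \<Longrightarrow> (v n has_derivative v' n z) (at z)"
    "\<And>n b. b \<in> Basis \<Longrightarrow> continuous_on (cylinder T \<Omega>) (\<lambda>z. v' n z b)"
    "\<And>n. (\<integral>\<^sup>+z. ennreal (energy_density p (cylinder T \<Omega>) (v n) (v' n) z) \<partial>lborel) \<le> ennreal (S n)"
    "\<And>n. S n > 0"
    "S \<longlonglongrightarrow> 2 powr p * real CARD('d) powr p * (real CARD('d) + 1) * sum_Dx_norms p T \<Omega> u powr p"
    "AE z in lborel. (\<lambda>n. indicator (cylinder T \<Omega>) z * v n z) \<longlonglongrightarrow> u' z"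
proof -
  let ?U = "cylinder T \<Omega>" and ?d = "real CARD('d)"
  let ?N = "\<lambda>f. Lp_norm p ?U f"
  have U: "open ?U" using \<Omega>(1) by (rule open_cylinder)
  then have UB: "?U \<in> sets borel" by simp
  have "bounded ?U" unfolding cylinder_def using \<Omega>(2) by (intro bounded_Times) auto
  then have Ul: "?U \<in> lmeasurable" using U by (rule lmeasurable_open)
  have p0: "p > 0" "p \<ge> 1" using p by auto
  note L1 = Lp_space_imp_integrable[OF p0(2) _ Ul]
  obtain a where a: "\<And>n. a n \<in> H_alpha_1 \<alpha> p T \<Omega>" "\<And>n. a n \<in> Cinf ({0..T} \<times> \<Omega>)"
    "(\<lambda>n. H_alpha_1_norm \<alpha> p T \<Omega> (\<lambda>z. a n z - u z)) \<longlonglongrightarrow> 0" and uH: "u \<in> H_alpha_1 \<alpha> p T \<Omega>"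
    using u unfolding H_alpha_1_0_def by blast
  have Dx: "Dx p T \<Omega> i f \<in> Lp_space p ?U \<and> weak_partial_x T \<Omega> i f (Dx p T \<Omega> i f)"
    if "\<exists>g \<in> Lp_space p ?U. weak_partial_x T \<Omega> i f g" for f i
    using someI_ex[of "\<lambda>g. g \<in> Lp_space p ?U \<and> weak_partial_x T \<Omega> i f g"] that
    unfolding Dx_def by blast
  have uL: "u \<in> Lp_space p ?U" "Dx p T \<Omega> i u \<in> Lp_space p ?U" "weak_partial_x T \<Omega> i u (Dx p T \<Omega> i u)" for i
    using uH Dx[of i u] unfolding H_alpha_1_def by auto
  define e where "e n z = a n z - u z" for n z
  have e_eq: "e n = (\<lambda>z. a n z + (-1) * u z)" for n by (auto simp: e_def)
  have eL: "e n \<in> Lp_space p ?U" for n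
    unfolding e_eq using a(1) uL by (intro Lp_space_lincomb p0) (auto simp: H_alpha_1_def)
  have eD: "Dx p T \<Omega> i (e n) \<in> Lp_space p ?U \<and> weak_partial_x T \<Omega> i (e n) (Dx p T \<Omega> i (e n))" for i n
  proof (rule Dx)
    obtain g where g: "g \<in> Lp_space p ?U" "weak_partial_x T \<Omega> i (a n) g"
      using a(1)[of n] unfolding H_alpha_1_def by auto
    have "weak_partial_x T \<Omega> i (e n) (\<lambda>z. g z + (-1) * Dx p T \<Omega> i u z)"
      unfolding e_eq
      by (rule weak_partial_x_lincomb[OF \<Omega>(1) _ _ _ _ g(2) uL(3)])
         (use a(1) uL g in \<open>auto intro!: L1 simp: H_alpha_1_def\<close>)
    then show "\<exists>g \<in> Lp_space p ?U. weak_partial_x T \<Omega> i (e n) g"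
      using Lp_space_lincomb[OF p0(1) g(1) uL(2)] by blast
  qed
  have aD: "weak_partial_x T \<Omega> i (a n) (\<lambda>z. Dx p T \<Omega> i u z + 1 * Dx p T \<Omega> i (e n) z)" for i n
  proof -
    have "a n = (\<lambda>z. u z + 1 * e n z)" by (auto simp: e_def)
    then show ?thesis
      using weak_partial_x_lincomb[OF \<Omega>(1) L1 L1 L1 L1 uL(3) conjunct2[OF eD[of i n]], where s=1]
        uL eL eD by simp
  qed
  define \<epsilon> where "\<epsilon> n = H_alpha_1_norm \<alpha> p T \<Omega> (e n)" for n
  have \<epsilon>: "\<epsilon> \<longlonglongrightarrow> 0" using a(3) unfolding \<epsilon>_def [abs_def] e_def [abs_def] .
  have N0: "?N f \<ge> 0" for f :: "real \<times> (real ^ 'd) \<Rightarrow> 'b::euclidean_space" by (simp add: Lp_norm_def)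
  have \<epsilon>1: "?N (e n) \<le> \<epsilon> n" and \<epsilon>2: "?N (Dx p T \<Omega> i (e n)) \<le> \<epsilon> n" for i n
  proof -
    show "?N (e n) \<le> \<epsilon> n"
      unfolding \<epsilon>_def H_alpha_1_norm_def
      using N0[of "dt_frac \<alpha> p T \<Omega> (e n)"] N0[of "grad_x p T \<Omega> (e n)"] by linarith
    have "?N (Dx p T \<Omega> i (e n)) \<le> ?N (grad_x p T \<Omega> (e n))"
      using Lp_norm_Dx_le_grad_x[OF p0(1)] eD by blast
    then show "?N (Dx p T \<Omega> i (e n)) \<le> \<epsilon> n"
      unfolding \<epsilon>_def H_alpha_1_norm_def
      using N0[of "dt_frac \<alpha> p T \<Omega> (e n)"] N0[of "e n"] by linarith
  qed
  have \<epsilon>0: "\<epsilon> n \<ge> 0" for n using order_trans[OF N0 \<epsilon>1] .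
  have "(\<lambda>n. \<epsilon> n powr p) \<longlonglongrightarrow> 0 powr p"
    using p0 \<epsilon>0 by (intro tendsto_powr' \<epsilon> tendsto_const) auto
  then have \<epsilon>p: "(\<lambda>n. \<epsilon> n powr p) \<longlonglongrightarrow> 0" by simp
  have rep: "\<exists>f'. borel_rep ?U f f'" if "f \<in> Lp_space p ?U" for f :: "real \<times> (real ^ 'd) \<Rightarrow> real"
    using borel_rep_exists[OF UB, of f] that unfolding Lp_space_def by blast
  obtain e' where e': "\<And>n. borel_rep ?U (e n) (e' n)" using rep[OF eL] by metis
  obtain h where h: "\<And>i. borel_rep ?U (Dx p T \<Omega> i u) (h i)" using rep[OF uL(2)] by metis
  define k where "k n i = (SOME f'. borel_rep ?U (Dx p T \<Omega> i (e n)) f')" for n i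
  have k: "borel_rep ?U (Dx p T \<Omega> i (e n)) (k n i)" for i n
    unfolding k_def by (rule someI_ex[OF rep[OF conjunct1[OF eD]]])
  have pw: "integrable lborel (\<lambda>z. \<bar>f' z\<bar> powr p)" "(\<integral>z. \<bar>f' z\<bar> powr p \<partial>lborel) = ?N f powr p"
    if "f \<in> Lp_space p ?U" "borel_rep ?U f f'" for f f'
    using borel_rep_Lp[OF UB that(2), of p] that(1) p0 by (auto simp: powr_powr)
  have "(\<lambda>n. \<integral>z. norm (\<bar>e' n z\<bar> powr p) \<partial>lborel) \<longlonglongrightarrow> 0"
  proof -
    show ?thesis using \<epsilon>p
    proof (rule Lim_null_comparison[rotated])
      show "\<forall>\<^sub>F n in sequentially. norm (\<integral>z. norm (\<bar>e' n z\<bar> powr p) \<partial>lborel) \<le> \<epsilon> n powr p"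
        using pw(2)[OF eL e'] \<epsilon>1 N0 p0 by (auto intro!: always_eventually powr_mono2)
    qed
  qed
  from tendsto_L1_AE_subseq[OF pw(1)[OF eL e'] this]
  obtain \<rho> where \<rho>: "strict_mono \<rho>" "AE z in lborel. (\<lambda>n. \<bar>e' (\<rho> n) z\<bar> powr p) \<longlonglongrightarrow> 0" by blast
  have "\<exists>v'. (\<forall>z\<in>?U. (a n has_derivative v' z) (at z)) \<and> (\<forall>b\<in>Basis. continuous_on ?U (\<lambda>z. v' z b))" for n
    by (rule Cinf_imp_derivative_on_cylinder[OF \<Omega>(1) a(2)[of n]]) blast
  then obtain v' where v': "\<And>n z. z \<in> ?U \<Longrightarrow> (a n has_derivative v' n z) (at z)"
    "\<And>n b. b \<in> Basis \<Longrightarrow> continuous_on ?U (\<lambda>z. v' n z b)" by metis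
  let ?Kc = "2 powr p * ?d powr p"
  let ?S = "sum_Dx_norms p T \<Omega> u"
  \<comment> \<open>The last summand keeps the bounds positive, as the tangent argument for the concave power demands.\<close>
  define S where "S n = ?Kc * (?d + 1) * (?S powr p + \<epsilon> n powr p) + 1 / real (Suc n)" for n
  have d1: "?d powr p \<ge> 1" using p0 by (intro ge_one_powr_ge_zero) (auto simp: Suc_leI)
  have energy: "(\<integral>\<^sup>+z. ennreal (energy_density p ?U (a n) (v' n) z) \<partial>lborel) \<le> ennreal (S n)" for n
  proof -
    let ?F = "\<lambda>z. \<bar>u' z\<bar> powr p + \<bar>e' n z\<bar> powr p + (\<Sum>i\<in>UNIV. \<bar>h i z\<bar> powr p + \<bar>k n i z\<bar> powr p)"
    have iF: "integrable lborel ?F"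
      using pw(1)[OF uL(1) r] pw(1)[OF eL e'] pw(1)[OF uL(2) h] pw(1)[OF conjunct1[OF eD] k] by auto
    have "AE z in lborel. \<forall>i\<in>UNIV. z \<in> ?U \<longrightarrow> h i z + k n i z = v' n z (0, axis i 1)"
    proof (rule AE_finite_allI)
      fix i
      have kc: "borel_rep ?U (\<lambda>z. Dx p T \<Omega> i u z + 1 * Dx p T \<Omega> i (e n) z) (\<lambda>z. h i z + k n i z)"
        unfolding borel_rep_def
        using borel_repD[OF h[of i]] borel_repD[OF k[of i n]] by auto
      show "AE z in lborel. z \<in> ?U \<longrightarrow> h i z + k n i z = v' n z (0, axis i 1)"
      proof (rule weak_partial_x_eq_classical[OF \<Omega>(1) v'(1) v'(2)[OF axis_Basis_prod] kc _ aD])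
        have "integrable (lebesgue_on ?U) (\<lambda>z. Dx p T \<Omega> i u z + 1 * Dx p T \<Omega> i (e n) z)"
          using L1[OF uL(2)] L1[OF conjunct1[OF eD]] by auto
        then show "integrable lborel (\<lambda>z. h i z + k n i z)"
          by (subst (asm) borel_rep_integrable[OF UB kc])
      qed
    qed simp
    with borel_repD(3)[OF r] borel_repD(3)[OF e'[of n]]
    have "AE z in lborel. ennreal (energy_density p ?U (a n) (v' n) z) \<le> ennreal (?Kc * ?F z)"
    proof eventually_elim
      case (elim z)
      show ?case
      proof (cases "z \<in> ?U")
        case True
        note pa = abs_add_powr_le[of p, OF less_imp_le[OF p0(1)]]
        have "a n z = u' z + e' n z" using elim True by (simp add: e_def)
        then have "\<bar>a n z\<bar> powr p \<le> 2 powr p * (\<bar>u' z\<bar> powr p + \<bar>e' n z\<bar> powr p)" using pa by simp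
        also have "\<dots> \<le> ?Kc * (\<bar>u' z\<bar> powr p + \<bar>e' n z\<bar> powr p)"
          using d1 by (intro mult_right_mono) auto
        finally have 1: "\<bar>a n z\<bar> powr p \<le> ?Kc * (\<bar>u' z\<bar> powr p + \<bar>e' n z\<bar> powr p)" .
        have "(\<Sum>i\<in>UNIV. \<bar>v' n z (0, axis i 1)\<bar> powr p) = (\<Sum>i\<in>UNIV. \<bar>h i z + k n i z\<bar> powr p)"
          using elim True by simp
        also have "\<dots> \<le> (\<Sum>i\<in>UNIV. 2 powr p * (\<bar>h i z\<bar> powr p + \<bar>k n i z\<bar> powr p))"
          by (intro sum_mono pa)
        finally have "?d powr p * (\<Sum>i\<in>UNIV. \<bar>v' n z (0, axis i 1)\<bar> powr p)
            \<le> ?d powr p * (\<Sum>i\<in>UNIV. 2 powr p * (\<bar>h i z\<bar> powr p + \<bar>k n i z\<bar> powr p))"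
          by (rule mult_left_mono) simp
        also have "\<dots> = ?Kc * (\<Sum>i\<in>UNIV. \<bar>h i z\<bar> powr p + \<bar>k n i z\<bar> powr p)"
          by (simp add: sum_distrib_left mult_ac)
        finally have 2: "?d powr p * (\<Sum>i\<in>UNIV. \<bar>v' n z (0, axis i 1)\<bar> powr p)
            \<le> ?Kc * (\<Sum>i\<in>UNIV. \<bar>h i z\<bar> powr p + \<bar>k n i z\<bar> powr p)" .
        have "energy_density p ?U (a n) (v' n) z \<le> ?Kc * ?F z"
          using add_mono[OF 1 2] True unfolding energy_density_def distrib_left by simp
        then show ?thesis by (rule ennreal_leI)
      qed (simp add: energy_density_def)
    qed
    then have "(\<integral>\<^sup>+z. ennreal (energy_density p ?U (a n) (v' n) z) \<partial>lborel) \<le> (\<integral>\<^sup>+z. ennreal (?Kc * ?F z) \<partial>lborel)"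
      by (rule nn_integral_mono_AE)
    also have "\<dots> = ennreal (\<integral>z. ?Kc * ?F z \<partial>lborel)"
      using iF by (intro nn_integral_eq_integral) (auto intro!: AE_I2 mult_nonneg_nonneg add_nonneg_nonneg sum_nonneg)
    also have "(\<integral>z. ?Kc * ?F z \<partial>lborel) = ?Kc * (?N u powr p + ?N (e n) powr p +
        (\<Sum>i\<in>UNIV. ?N (Dx p T \<Omega> i u) powr p + ?N (Dx p T \<Omega> i (e n)) powr p))"
      using pw[OF uL(1) r] pw[OF eL e'[of n]] pw[OF uL(2) h] pw[OF conjunct1[OF eD] k[of _ n]] by simp
    also have "\<dots> \<le> ?Kc * (?S powr p + \<epsilon> n powr p + (\<Sum>i\<in>(UNIV::'d set). ?S powr p + \<epsilon> n powr p))"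
    proof (intro mult_left_mono add_mono sum_mono powr_mono2 \<epsilon>1 \<epsilon>2 N0)
      have s: "(\<Sum>i\<in>UNIV. ?N (Dx p T \<Omega> i u)) \<ge> 0" by (intro sum_nonneg N0)
      then show "?N u \<le> ?S" by (simp add: sum_Dx_norms_def)
      fix i
      have "?N (Dx p T \<Omega> i u) \<le> (\<Sum>i\<in>UNIV. ?N (Dx p T \<Omega> i u))"
        by (intro member_le_sum N0) auto
      then show "?N (Dx p T \<Omega> i u) \<le> ?S" using N0[of u] by (simp add: sum_Dx_norms_def)
    qed (use p0 in auto)
    also have "\<dots> \<le> S n" by (simp add: S_def algebra_simps)
    finally show ?thesis by (simp add: ennreal_leI)
  qed
  have Spos: "S n > 0" for n
    unfolding S_def by (intro add_nonneg_pos mult_nonneg_nonneg add_nonneg_nonneg) auto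
  have Slim: "S \<longlonglongrightarrow> ?Kc * (?d + 1) * ?S powr p"
  proof -
    have "S \<longlonglongrightarrow> ?Kc * (?d + 1) * (?S powr p + 0) + 0"
      unfolding S_def [abs_def] by (intro \<epsilon>p tendsto_add tendsto_mult tendsto_const LIMSEQ_Suc[OF lim_1_over_n])
    then show ?thesis by simp
  qed
  show thesis
  proof (rule that[of "\<lambda>n. a (\<rho> n)" "\<lambda>n. v' (\<rho> n)" "\<lambda>n. S (\<rho> n)"])
    show "(\<lambda>n. S (\<rho> n)) \<longlonglongrightarrow> ?Kc * (?d + 1) * ?S powr p"
      using LIMSEQ_subseq_LIMSEQ[OF Slim \<rho>(1)] by (simp add: o_def)
    have "AE z in lborel. \<forall>n. (z \<in> ?U \<longrightarrow> e n z = e' n z)"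
      unfolding AE_all_countable using borel_repD(3)[OF e'] by blast
    with \<rho>(2) borel_repD(3)[OF r]
    show "AE z in lborel. (\<lambda>n. indicator ?U z * a (\<rho> n) z) \<longlonglongrightarrow> u' z"
    proof eventually_elim
      case (elim z)
      show ?case
      proof (cases "z \<in> ?U")
        case True
        have "(\<lambda>n. (\<bar>e' (\<rho> n) z\<bar> powr p) powr (1 / p)) \<longlonglongrightarrow> 0 powr (1 / p)"
          using elim(1) p0 by (intro tendsto_powr') auto
        then have "(\<lambda>n. \<bar>e' (\<rho> n) z\<bar>) \<longlonglongrightarrow> 0" using p0 by (simp add: powr_powr)
        then have "(\<lambda>n. u' z + e' (\<rho> n) z) \<longlonglongrightarrow> u' z + 0"
          by (intro tendsto_intros) (simp add: tendsto_rabs_zero_iff)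
        moreover have "a n z = u' z + e' n z" for n
        proof -
          have "e n z = e' n z" "u z = u' z" using elim True by auto
          then show ?thesis by (simp add: e_def)
        qed
        ultimately show ?thesis using True by simp
      next
        case False
        then show ?thesis using borel_repD(2)[OF r False] by simp
      qed
    qed
  qed (use v' energy Spos in auto)
qed

section \<open>The embedding\<close>

text \<open>
  The right-hand side depends on \<open>z\<close> only through \<open>x\<close>: this is the supremum bound in time.
\<close>

lemma fractional_sup_bound:
  assumes \<alpha>: "0 < \<alpha>" "\<alpha> < 1" and p: "1 < p" "1 / \<alpha> < p"
  obtains C where "C \<ge> 0" and
    "\<And>T \<Omega> (u :: real \<times> (real ^ 'd) \<Rightarrow> real) g u' g'. \<lbrakk>T > 0; open \<Omega>; bounded \<Omega>;
       u \<in> Lp_space p (cylinder T \<Omega>); g \<in> Lp_space p (cylinder T \<Omega>); weak_dt_frac \<alpha> T \<Omega> u g;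
       borel_rep (cylinder T \<Omega>) u u'; borel_rep (cylinder T \<Omega>) g g'\<rbrakk> \<Longrightarrow>
       AE z in lborel. ennreal (\<bar>u' z\<bar> powr p)
         \<le> ennreal (C * T powr (\<alpha> * p - 1)) * (\<integral>\<^sup>+s. ennreal (\<bar>g' (s, snd z)\<bar> powr p) \<partial>lborel)"
proof -
  obtain C where C: "C \<ge> 0" and Holder: "\<And>T h t. \<lbrakk>T > 0; h \<in> borel_measurable borel; integrable lborel (\<lambda>s. \<bar>h s\<bar> powr p)\<rbrakk> \<Longrightarrow>
      \<bar>\<integral>r. frac_kernel \<alpha> T r * h (t - r) \<partial>lborel\<bar> powr p
        \<le> C * T powr (\<alpha> * p - 1) * (\<integral>s. \<bar>h s\<bar> powr p \<partial>lborel)"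
    by (rule frac_kernel_Holder[OF \<alpha>(1) p]) blast
  show thesis
  proof (rule that[OF C])
    fix T and \<Omega> :: "(real ^ 'd) set" and u g u' g' :: "real \<times> (real ^ 'd) \<Rightarrow> real"
    let ?U = "cylinder T \<Omega>"
    assume T: "T > 0" and \<Omega>: "open \<Omega>" "bounded \<Omega>"
      and Lp: "u \<in> Lp_space p ?U" "g \<in> Lp_space p ?U" and weak: "weak_dt_frac \<alpha> T \<Omega> u g"
      and u': "borel_rep ?U u u'" and g': "borel_rep ?U g g'"
    have U: "open ?U" using \<Omega>(1) by (rule open_cylinder)
    then have UB: "?U \<in> sets borel" by simp
    have "bounded ?U" unfolding cylinder_def using \<Omega>(2) by (intro bounded_Times) auto
    then have Ul: "?U \<in> lmeasurable" using U by (rule lmeasurable_open)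
    have iu: "integrable lborel u'" "integrable lborel g'"
      using Lp_space_imp_integrable[OF _ Lp(1) Ul] Lp_space_imp_integrable[OF _ Lp(2) Ul] p(1)
      by (auto simp: borel_rep_integrable[OF UB u'] borel_rep_integrable[OF UB g'])
    have gp: "integrable lborel (\<lambda>z. \<bar>g' z\<bar> powr p)"
      using borel_rep_Lp(1)[OF UB g'] Lp(2) by blast
    have [measurable]: "g' \<in> borel_measurable borel" using borel_repD(1)[OF g'] .
    have "integrable (lborel \<Otimes>\<^sub>M lborel) (case_prod (\<lambda>s x. \<bar>g' (s, x)\<bar> powr p))"
      using gp by (simp add: lborel_prod case_prod_beta')
    then have "AE x in lborel. integrable lborel (\<lambda>s. \<bar>g' (s, x)\<bar> powr p)"
      by (rule lborel_pair.AE_integrable_snd)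
    then have sec: "AE z in (lborel :: (real \<times> (real ^ 'd)) measure). integrable lborel (\<lambda>s. \<bar>g' (s, snd z)\<bar> powr p)"
      by (rule AE_lborel_snd)
    have "AE z in lborel. z \<in> ?U \<longrightarrow> u' z = (\<integral>r. frac_kernel \<alpha> T r * g' (z - r *\<^sub>R (1, 0)) \<partial>lborel)"
      by (rule weak_dt_frac_imp_representation[OF \<alpha> T \<Omega>(1) u' iu(1) g' iu(2) weak])
    with sec show "AE z in lborel. ennreal (\<bar>u' z\<bar> powr p)
         \<le> ennreal (C * T powr (\<alpha> * p - 1)) * (\<integral>\<^sup>+s. ennreal (\<bar>g' (s, snd z)\<bar> powr p) \<partial>lborel)"
    proof eventually_elim
      case (elim z)
      show ?case
      proof (cases "z \<in> ?U")
        case True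
        define h where "h s = g' (s, snd z)" for s
        have h: "h \<in> borel_measurable borel" "integrable lborel (\<lambda>s. \<bar>h s\<bar> powr p)"
          using elim(1) by (auto simp: h_def [abs_def])
        have "g' (z - r *\<^sub>R (1, 0)) = h (fst z - r)" for r by (cases z) (simp add: h_def)
        then have "u' z = (\<integral>r. frac_kernel \<alpha> T r * h (fst z - r) \<partial>lborel)" using elim(2) True by simp
        then have "\<bar>u' z\<bar> powr p \<le> C * T powr (\<alpha> * p - 1) * (\<integral>s. \<bar>h s\<bar> powr p \<partial>lborel)"
          using Holder[OF T h] by simp
        then have "ennreal (\<bar>u' z\<bar> powr p) \<le> ennreal (C * T powr (\<alpha> * p - 1)) * ennreal (\<integral>s. \<bar>h s\<bar> powr p \<partial>lborel)"
          using C by (subst ennreal_mult[symmetric]) (auto intro!: ennreal_leI)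
        also have "ennreal (\<integral>s. \<bar>h s\<bar> powr p \<partial>lborel) = (\<integral>\<^sup>+s. ennreal (\<bar>h s\<bar> powr p) \<partial>lborel)"
          using h(2) by (intro nn_integral_eq_integral[symmetric]) auto
        finally show ?thesis by (simp add: h_def)
      qed (use borel_repD(2)[OF u'] p in simp)
    qed
  qed
qed

theorem theoremA6:
  fixes \<alpha> p q \<theta> :: real
  assumes "0 < \<alpha>" and "\<alpha> < 1" and "1 < p" and "1 < q"
    and "max (1 / \<alpha>) (real CARD('d::finite)) < p"
    and "p \<le> real CARD('d) + 1 / \<alpha>"
    and "p < q" and "q \<le> 2 * p"
    and "\<theta> = p / q"
  shows "\<theta> \<in> {0<..<1} \<and>
    (\<exists>N. \<forall>T>0. \<forall>\<psi> \<in> H_alpha_1_0 \<alpha> p T (ball (0 :: real ^ 'd) 1).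
       \<psi> \<in> Lp_space q (cylinder T (ball 0 1)) \<and>
       Lp_norm q (cylinder T (ball 0 1)) \<psi>
         \<le> N * T powr (\<alpha> * p / q - 1 / p + 1 / q)
             * sum_Dx_norms p T (ball 0 1) \<psi> powr (1 - \<theta>)
             * Lp_norm p (cylinder T (ball 0 1)) (dt_frac \<alpha> p T (ball 0 1) \<psi>) powr \<theta>)"
proof (intro conjI)
  show "\<theta> \<in> {0<..<1}" using assms by (simp add: divide_less_eq)
  have p: "1 / \<alpha> < p" "real CARD('d) < p" and p0: "p > 0" and q0: "q > 0" using assms by auto
  let ?d = "real CARD('d)"
  define \<sigma> where "\<sigma> = (q - p) / p"
  have \<sigma>: "\<sigma> > 0" using assms p0 by (simp add: \<sigma>_def)
  obtain Ca where Ca: "Ca \<ge> 0" and sup_bound: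
    "\<And>T \<Omega> (u :: real \<times> (real ^ 'd) \<Rightarrow> real) g u' g'. \<lbrakk>T > 0; open \<Omega>; bounded \<Omega>;
       u \<in> Lp_space p (cylinder T \<Omega>); g \<in> Lp_space p (cylinder T \<Omega>); weak_dt_frac \<alpha> T \<Omega> u g;
       borel_rep (cylinder T \<Omega>) u u'; borel_rep (cylinder T \<Omega>) g g'\<rbrakk> \<Longrightarrow>
       AE z in lborel. ennreal (\<bar>u' z\<bar> powr p)
         \<le> ennreal (Ca * T powr (\<alpha> * p - 1)) * (\<integral>\<^sup>+s. ennreal (\<bar>g' (s, snd z)\<bar> powr p) \<partial>lborel)"
    by (rule fractional_sup_bound[OF assms(1-3) p(1)]) blast
  obtain Cm where Cm: "Cm \<ge> 0" and Morrey:
    "\<And>T (v :: real \<times> (real ^ 'd) \<Rightarrow> real) v' z.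
       \<lbrakk>\<And>z. z \<in> cylinder T (ball 0 1) \<Longrightarrow> (v has_derivative v' z) (at z);
        \<And>b. b \<in> Basis \<Longrightarrow> continuous_on (cylinder T (ball 0 1)) (\<lambda>z. v' z b)\<rbrakk> \<Longrightarrow>
       ennreal (\<bar>indicator (cylinder T (ball 0 1)) z * v z\<bar> powr p)
         \<le> ennreal Cm * (\<integral>\<^sup>+y. ennreal (energy_density p (cylinder T (ball 0 1)) v v' (fst z, y)) \<partial>lborel)"
    by (rule Morrey_on_slices[OF p(2)]) blast
  define c where "c = 2 powr p * ?d powr p * (?d + 1)"
  have c: "c \<ge> 0" by (simp add: c_def)
  define N where "N = (Ca * ((Cm + 1) * c) powr \<sigma>) powr (1 / q)"
  show "\<exists>N. \<forall>T>0. \<forall>\<psi> \<in> H_alpha_1_0 \<alpha> p T (ball (0 :: real ^ 'd) 1).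
       \<psi> \<in> Lp_space q (cylinder T (ball 0 1)) \<and>
       Lp_norm q (cylinder T (ball 0 1)) \<psi>
         \<le> N * T powr (\<alpha> * p / q - 1 / p + 1 / q)
             * sum_Dx_norms p T (ball 0 1) \<psi> powr (1 - \<theta>)
             * Lp_norm p (cylinder T (ball 0 1)) (dt_frac \<alpha> p T (ball 0 1) \<psi>) powr \<theta>"
  proof (intro exI[of _ N] allI impI ballI)
    fix T :: real and \<psi> :: "real \<times> (real ^ 'd) \<Rightarrow> real"
    let ?B = "ball (0 :: real ^ 'd) 1"
    let ?U = "cylinder T ?B"
    assume T: "T > 0" and \<psi>: "\<psi> \<in> H_alpha_1_0 \<alpha> p T ?B"
    have UB: "?U \<in> sets borel" using open_cylinder[of ?B T] by simp
    define g where "g = dt_frac \<alpha> p T ?B \<psi>"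
    have \<psi>L: "\<psi> \<in> Lp_space p ?U" and ex: "\<exists>g \<in> Lp_space p ?U. weak_dt_frac \<alpha> T ?B \<psi> g"
      using \<psi> by (auto simp: H_alpha_1_0_def H_alpha_1_def)
    have g: "g \<in> Lp_space p ?U" "weak_dt_frac \<alpha> T ?B \<psi> g"
      using someI_ex[of "\<lambda>g. g \<in> Lp_space p ?U \<and> weak_dt_frac \<alpha> T ?B \<psi> g"] ex
      unfolding g_def dt_frac_def by blast+
    obtain u' where u': "borel_rep ?U \<psi> u'"
      using borel_rep_exists[OF UB, of \<psi>] \<psi>L unfolding Lp_space_def by blast
    obtain g' where g': "borel_rep ?U g g'"
      using borel_rep_exists[OF UB, of g] g(1) unfolding Lp_space_def by blast
    let ?D = "Lp_norm p ?U g" and ?S = "sum_Dx_norms p T ?B \<psi>"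
    have D0: "?D \<ge> 0" and S0: "?S \<ge> 0"
      by (auto simp: Lp_norm_def sum_Dx_norms_def intro!: add_nonneg_nonneg sum_nonneg)
    have \<Gamma>: "(\<integral>\<^sup>+z. ennreal (\<bar>g' z\<bar> powr p) \<partial>lborel) = ennreal (?D powr p)"
    proof -
      have i: "integrable lborel (\<lambda>z. \<bar>g' z\<bar> powr p)" using borel_rep_Lp(1)[OF UB g'] g(1) by blast
      have "(\<integral>\<^sup>+z. ennreal (\<bar>g' z\<bar> powr p) \<partial>lborel) = ennreal (\<integral>z. \<bar>g' z\<bar> powr p \<partial>lborel)"
        using i by (intro nn_integral_eq_integral) auto
      also have "(\<integral>z. \<bar>g' z\<bar> powr p \<partial>lborel) = ?D powr p"
        using p0 by (simp add: borel_rep_Lp(2)[OF UB g'] powr_powr)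
      finally show ?thesis .
    qed
    obtain v v' S where v: "\<And>n z. z \<in> ?U \<Longrightarrow> (v n has_derivative v' n z) (at z)"
      "\<And>n b. b \<in> Basis \<Longrightarrow> continuous_on ?U (\<lambda>z. v' n z b)"
      and S: "\<And>n. (\<integral>\<^sup>+z. ennreal (energy_density p ?U (v n) (v' n) z) \<partial>lborel) \<le> ennreal (S n)"
      "\<And>n. S n > 0" "S \<longlonglongrightarrow> c * ?S powr p"
      and lim: "AE z in lborel. (\<lambda>n. indicator ?U z * v n z) \<longlonglongrightarrow> u' z"
      unfolding c_def
      by (rule H_alpha_1_0_approximation[OF open_ball bounded_ball assms(3) T \<psi> u']) blast
    have vc: "continuous_on ?U (v n)" for n
      by (rule has_derivative_continuous_on, rule has_derivative_at_withinI, rule v(1))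
    have wm: "(\<lambda>z. indicator ?U z * v n z) \<in> borel_measurable borel" for n
      using borel_measurable_continuous_on_indicator[OF UB vc] by simp
    have Wm: "energy_density p ?U (v n) (v' n) \<in> borel_measurable borel" for n
      using open_cylinder[of ?B T] vc v(2) by (intro energy_density_measurable) auto
    have u'm: "u' \<in> borel_measurable borel" using borel_repD(1)[OF u'] .
    have fb: "AE z in lborel. ennreal (\<bar>u' z\<bar> powr p)
         \<le> ennreal (Ca * T powr (\<alpha> * p - 1)) * (\<integral>\<^sup>+s. ennreal (\<bar>g' (s, snd z)\<bar> powr p) \<partial>lborel)"
      by (rule sup_bound[OF T open_ball bounded_ball \<psi>L g u' g'])
    define R where "R = Ca * T powr (\<alpha> * p - 1) * ?D powr p * (T powr (1 - \<sigma>) * ((Cm + 1) * (c * ?S powr p)) powr \<sigma>)"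
    have R0: "R \<ge> 0" using Ca by (simp add: R_def)
    have main: "(\<integral>\<^sup>+z. ennreal (\<bar>u' z\<bar> powr q) \<partial>lborel) \<le> ennreal R"
      unfolding R_def \<sigma>_def
    proof (rule mixed_norm_interpolation_limit[OF u'm borel_repD(1)[OF g'] wm Wm p0 assms(7,8) T _ Cm fb _ _ \<Gamma> _ S lim])
      show "energy_density p ?U (v n) (v' n) (t, y) = 0" if "t \<notin> {0<..<T}" for n t y
        using that by (auto simp: energy_density_def cylinder_def indicator_def)
      show "ennreal (\<bar>indicator ?U z * v n z\<bar> powr p)
        \<le> ennreal Cm * (\<integral>\<^sup>+y. ennreal (energy_density p ?U (v n) (v' n) (fst z, y)) \<partial>lborel)" for n z
        by (rule Morrey[OF v(1) v(2)])
    qed (use Ca in auto)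
    have iq: "integrable lborel (\<lambda>z. \<bar>u' z\<bar> powr q)"
      unfolding integrable_iff_bounded using main u'm by (auto simp: less_top top_unique intro: le_less_trans)
    then show "\<psi> \<in> Lp_space q ?U \<and> Lp_norm q ?U \<psi>
         \<le> N * T powr (\<alpha> * p / q - 1 / p + 1 / q) * ?S powr (1 - \<theta>)
             * Lp_norm p ?U (dt_frac \<alpha> p T ?B \<psi>) powr \<theta>"
    proof (intro conjI)
      show "\<psi> \<in> Lp_space q ?U" using iq borel_rep_Lp(1)[OF UB u'] by blast
      have "ennreal (\<integral>z. \<bar>u' z\<bar> powr q \<partial>lborel) \<le> ennreal R"
        using main nn_integral_eq_integral[OF iq] by simp
      then have "(\<integral>z. \<bar>u' z\<bar> powr q \<partial>lborel) \<le> R" using R0 by simp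
      then have "Lp_norm q ?U \<psi> \<le> R powr (1 / q)"
        unfolding borel_rep_Lp(2)[OF UB u'] using q0 by (intro powr_mono2) auto
      also have "R = (Ca * ((Cm + 1) * c) powr \<sigma>) * (T powr (\<alpha> * p - 1) * T powr (1 - \<sigma>)) * (?S powr p) powr \<sigma> * ?D powr p"
        using Cm c by (simp add: R_def powr_mult mult_ac)
      also have "T powr (\<alpha> * p - 1) * T powr (1 - \<sigma>) = T powr (\<alpha> * p - \<sigma>)"
        by (simp add: powr_add[symmetric])
      also have "((Ca * ((Cm + 1) * c) powr \<sigma>) * T powr (\<alpha> * p - \<sigma>) * (?S powr p) powr \<sigma> * ?D powr p) powr (1 / q)
         = N * T powr ((\<alpha> * p - \<sigma>) / q) * ?S powr (p * \<sigma> / q) * ?D powr (p / q)"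
        using Ca Cm c by (simp add: N_def powr_mult powr_powr)
      also have "(\<alpha> * p - \<sigma>) / q = \<alpha> * p / q - 1 / p + 1 / q"
        using p0 q0 by (simp add: \<sigma>_def field_simps)
      also have "p * \<sigma> / q = 1 - \<theta>"
        using p0 q0 by (simp add: \<sigma>_def assms(9) field_simps)
      finally show "Lp_norm q ?U \<psi>
         \<le> N * T powr (\<alpha> * p / q - 1 / p + 1 / q) * ?S powr (1 - \<theta>)
             * Lp_norm p ?U (dt_frac \<alpha> p T ?B \<psi>) powr \<theta>"
        by (simp add: g_def assms(9))
    qed
  qed
qed

end
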